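(* Let $L\colon\mathbb R^n\times\mathbb R^n\to\mathbb R_+$ and $\varphi\colon\mathbb R^n\to\mathbb R_+\cup\{+\infty\}$ satisfy the standing assumptions listed in the context, let $V$ be the value function, and assume that $$\forall x_0\in\mathbb R^n,\ \exists M>0,\ \exists r>0,\ \forall (x,u)\in B(x_0,r)\times B(0,r):\quad L(x,u)\le M.$$ Then $V$ is the smallest function among all lower semicontinuous functions $W\colon\mathbb R_+\times\mathbb R^n\to\mathbb R_+\cup\{+\infty\}$ satisfying the initial condition $W(0,\cdot)=\varphi$ and the contingent inequality $$\forall (t,x)\in\mathrm{dom}(W),\ t>0,\ \exists u\in\mathbb R^n:\quad D_\uparrow W(t,x)(-1,u)\le -L(x,u);$$ that is, $V$ itself is such a function, and $W\ge V$ on $\mathbb R_+\times\mathbb R^n$ for every such $W$.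
   Context: Notation: $\mathbb R_+=[0,+\infty)$; $B(x,r)$ is the closed ball with centre $x$ and radius $r$. Standing assumptions: $L\colon\mathbb R^n\times\mathbb R^n\to\mathbb R_+$ is lower semicontinuous and $L(x,\cdot)$ is convex for every $x$; there is a convex function $\Theta\colon\mathbb R^n\to\mathbb R_+$ with $\lim_{|u|\to\infty}\Theta(u)/|u|=+\infty$ and $L(x,u)\ge\Theta(u)$ for all $(x,u)$; $\varphi\colon\mathbb R^n\to\mathbb R_+\cup\{+\infty\}$ is lower semicontinuous and not identically $+\infty$. Value function: for $(t,x)\in\mathbb R_+\times\mathbb R^n$, $$V(t,x)=\inf\Big\{\int_0^t L(y(s),y'(s))\,ds+\varphi(y(t)) : y\in W^{1,1}(0,t;\mathbb R^n),\ y(0)=x\Big\},$$ so $V(0,x)=\varphi(x)$. $\mathrm{dom}(W)$ is the set where $W<+\infty$. For $(t,x)\in\mathrm{dom}(W)$ and $(\alpha,u)\in\mathbb R\times\mathbb R^n$, $$D_\uparrow W(t,x)(\alpha,u)=\liminf_{h\to0+,\,(\alpha',v)\to(\alpha,u)}\frac{W(t+h\alpha',x+hv)-W(t,x)}{h}.$$ *)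

theory Defs
  imports "HOL-Analysis.Analysis"
begin

(* Stated without limits inferior so that it applies to real-valued as well as to
   ennreal-valued functions. *)
definition lsc_on :: "'a::topological_space set \<Rightarrow> ('a \<Rightarrow> 'b::linorder) \<Rightarrow> bool" where
  "lsc_on S f \<longleftrightarrow>
     (\<forall>x\<in>S. \<forall>a. a < f x \<longrightarrow> (\<forall>\<^sub>F y in at x within S. a < f y))"

(* psi is a continuously differentiable function, with derivative psi', whose support is a
   compact subset of the open interval (0,t). *)
definition test_function :: "real \<Rightarrow> (real \<Rightarrow> real) \<Rightarrow> (real \<Rightarrow> real) \<Rightarrow> bool" where
  "test_function t \<psi> \<psi>' \<longleftrightarrow>
     (\<forall>s. (\<psi> has_real_derivative \<psi>' s) (at s)) \<and> continuous_on UNIV \<psi>' \<and>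
     (\<exists>a b. 0 < a \<and> b < t \<and> (\<forall>s. s \<notin> {a..b} \<longrightarrow> \<psi> s = 0))"

(* y is (the continuous representative of) an element of W^{1,1}(0,t;R^n) with weak
   derivative v.  The representative makes y(0) and y(t) meaningful; its integrability on
   [0,t] is automatic.  The weak derivative v is determined up to null sets.
   For t = 0 every pair (y,v) qualifies. *)
definition sobolev_W11 ::
  "real \<Rightarrow> (real \<Rightarrow> real^'n) \<Rightarrow> (real \<Rightarrow> real^'n) \<Rightarrow> bool" where
  "sobolev_W11 t y v \<longleftrightarrow>
     continuous_on {0..t} y \<and> set_integrable lebesgue {0..t} v \<and>
     (\<forall>\<psi> \<psi>'. test_function t \<psi> \<psi>' \<longrightarrow>
        (LINT s:{0..t}|lebesgue. \<psi>' s *\<^sub>R y s) = - (LINT s:{0..t}|lebesgue. \<psi> s *\<^sub>R v s))"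

definition value_function ::
  "(real^'n \<Rightarrow> real^'n \<Rightarrow> real) \<Rightarrow> (real^'n \<Rightarrow> ennreal) \<Rightarrow> real \<Rightarrow> real^'n \<Rightarrow> ennreal" where
  "value_function L \<phi> t x =
     Inf {(\<integral>\<^sup>+s\<in>{0..t}. ennreal (L (y s) (v s)) \<partial>lebesgue) + \<phi> (y t) | y v.
            sobolev_W11 t y v \<and> y 0 = x}"

definition standing_assumptions ::
  "(real^'n \<Rightarrow> real^'n \<Rightarrow> real) \<Rightarrow> (real^'n \<Rightarrow> ennreal) \<Rightarrow> bool" where
  "standing_assumptions L \<phi> \<longleftrightarrow>
     (\<forall>x u. 0 \<le> L x u) \<and> lsc_on UNIV (\<lambda>(x, u). L x u) \<and> (\<forall>x. convex_on UNIV (L x)) \<and>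
     (\<exists>\<Theta> :: real^'n \<Rightarrow> real.
        convex_on UNIV \<Theta> \<and> (\<forall>u. 0 \<le> \<Theta> u) \<and>
        filterlim (\<lambda>u. \<Theta> u / norm u) at_top at_infinity \<and> (\<forall>x u. \<Theta> u \<le> L x u)) \<and>
     lsc_on UNIV \<phi> \<and> (\<exists>x. \<phi> x \<noteq> \<infinity>)"

(* Functions on [0,\<infinity>) x R^n are modelled on all of R x R^n, their values at negative times
   being irrelevant.  The derivative is meant for W t x < \<infinity>, and it is used only for t > 0:
   there t + h * \<alpha>' is positive for small h, so only values of W at nonnegative times enter. *)
definition contingent_derivative ::
  "(real \<Rightarrow> real^'n \<Rightarrow> ennreal) \<Rightarrow> real \<Rightarrow> real^'n \<Rightarrow> real \<Rightarrow> real^'n \<Rightarrow> ereal" where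
  "contingent_derivative W t x \<alpha> u =
     Liminf (at_right 0 \<times>\<^sub>F nhds (\<alpha>, u))
       (\<lambda>(h, \<alpha>', v).
          (enn2ereal (W (t + h * \<alpha>') (x + h *\<^sub>R v)) - enn2ereal (W t x)) / ereal h)"

definition contingent_supersolution ::
  "(real^'n \<Rightarrow> real^'n \<Rightarrow> real) \<Rightarrow> (real^'n \<Rightarrow> ennreal) \<Rightarrow>
     (real \<Rightarrow> real^'n \<Rightarrow> ennreal) \<Rightarrow> bool" where
  "contingent_supersolution L \<phi> W \<longleftrightarrow>
     lsc_on ({0..} \<times> UNIV) (\<lambda>(t, x). W t x) \<and> (\<forall>x. W 0 x = \<phi> x) \<and>
     (\<forall>t x. 0 < t \<and> W t x < \<infinity> \<longrightarrow>
        (\<exists>u. contingent_derivative W t x (-1) u \<le> ereal (- L x u)))"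

end

theory Submission
  imports Defs "HOL-Complex_Analysis.Great_Picard"
begin

text \<open>
  Elements of \<open>W\<^sup>1\<^sup>,\<^sup>1\<close> are the functions \<open>x + \<integral>\<^sub>0 v\<close> with \<open>v\<close> integrable. Bounded cost makes the
  velocities uniformly integrable, so trajectories converge uniformly along a subsequence; the local
  affine minorants of \<open>L\<close>, applied to averages of the velocity over short intervals, show that the
  cost is lower semicontinuous along such sequences. Hence the value function is lower semicontinuous
  and minimizers exist.

  Since \<open>L\<close> does not depend on time, a minimizer can be reparametrized; comparing costs shows that its
  velocity is bounded. The difference quotients of a minimizer at \<open>0\<close> therefore have a cluster point
  \<open>u\<close>, and dynamic programming gives the contingent inequality in the direction \<open>(-1, u)\<close>.

  For a supersolution \<open>W\<close>, the contingent inequality provides Euler steps along which \<open>W\<close> decreases at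
  least by the running cost, up to a small error. The steps may accumulate before time \<open>0\<close>, but \<open>W\<close>
  is lower semicontinuous and a maximality argument continues them down to time \<open>0\<close>. As the error
  tends to \<open>0\<close>, such paths converge to a trajectory whose total cost is at most \<open>W(t, x)\<close>.
\<close>

subsection \<open>Trajectories with integrable velocity\<close>

text \<open>Since \<open>L\<close> is only lower semicontinuous in the state, the running cost
  cannot be transferred from one position to a nearby one; this shapes both halves. Velocity bounds
  come from running the same curve on another clock, so that \<open>L\<close> is only compared at
  equal positions. Euler steps are charged at their frozen starting point, so the compactness
  theorem must accept a cost evaluated near the trajectory instead of on it. The local bound on
  \<open>L\<close> for small velocities is what makes slowing down cheap; without a velocity bound
  the quotients at 0 could escape to infinity and leave no contingent direction. Weak convergence of
  velocities is expressed through their primitives: integrals over intervals are increments of the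
  path, so uniform convergence of paths carries all the information, and measure theory enters only
  to find a density for the limit path. All costs stay in \<open>ennreal\<close>, where Fatou's
  lemma asks for measurability only.\<close>

definition prim :: "(real \<Rightarrow> 'a::euclidean_space) \<Rightarrow> real \<Rightarrow> 'a" where
  "prim v s = (LINT \<sigma>:{0..s}|lborel. v \<sigma>)"

text \<open>There is no sign change to the left of 0: the interval is empty there and a null set at
  0. A clock built from \<open>prim\<close> is therefore the identity on negative times.\<close>

lemma prim_nonpos: "s \<le> 0 \<Longrightarrow> prim v s = 0"
proof -
  assume s: "s \<le> 0"
  have "AE \<sigma> in lborel. indicator {0..s} \<sigma> *\<^sub>R v \<sigma> = 0"
    using AE_lborel_singleton[of 0] by eventually_elim (use s in \<open>auto simp: indicator_def\<close>)
  then show ?thesis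
    unfolding prim_def set_lebesgue_integral_def by (rule integral_eq_zero_AE)
qed

lemma prim_0 [simp]: "prim v 0 = 0"
  by (simp add: prim_nonpos)

lemma set_integrable_of_integrable:
  fixes v :: "real \<Rightarrow> 'a::euclidean_space"
  assumes "integrable lborel v" "A \<in> sets borel" shows "set_integrable lborel A v"
  using assms unfolding set_integrable_def by (auto intro: integrable_mult_indicator)

lemma prim_diff:
  fixes v :: "real \<Rightarrow> 'a::euclidean_space"
  assumes v: "integrable lborel v" and "0 \<le> a" "a \<le> b"
  shows "prim v b - prim v a = (LINT \<sigma>:{a<..b}|lborel. v \<sigma>)"
proof -
  have "{0..b} = {0..a} \<union> {a<..b}" "{0..a} \<inter> {a<..b} = {}"
    using assms by auto
  then have "prim v b = prim v a + (LINT \<sigma>:{a<..b}|lborel. v \<sigma>)"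
    unfolding prim_def
    using set_integral_Un[of "{0..a}" "{a<..b}" lborel v] set_integrable_of_integrable[OF v]
    by simp
  then show ?thesis by simp
qed

lemma norm_prim_diff_le:
  fixes v :: "real \<Rightarrow> 'a::euclidean_space"
  assumes v: "integrable lborel v" and "0 \<le> a" "a \<le> b"
  shows "norm (prim v b - prim v a) \<le> (LINT \<sigma>:{a<..b}|lborel. norm (v \<sigma>))"
  unfolding prim_diff[OF assms]
  using set_integrable_of_integrable[OF v] by (intro set_integral_norm_bound) auto

text \<open>Cutting \<open>v\<close> off to the left of 0 turns \<open>prim v\<close> into an
  indefinite integral with a base point left of 0, whose continuity is known. This treats 0 and
  negative arguments like all others.\<close>

lemma isCont_prim:
  fixes v :: "real \<Rightarrow> 'a::euclidean_space"
  assumes v: "integrable lborel v"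
  shows "isCont (prim v) s"
proof -
  define w where "w \<sigma> = indicator {0..} \<sigma> *\<^sub>R v \<sigma>" for \<sigma>
  have w: "integrable lborel w"
    unfolding w_def using v by (intro integrable_mult_indicator) auto
  define c where "c = min s 0 - 1"
  define d where "d = s + 1"
  have eq: "prim v x = integral {c..x} w" if "x \<in> {c..d}" for x
  proof -
    have "prim v x = (LINT \<sigma>:{c..x}|lborel. w \<sigma>)"
      unfolding prim_def set_lebesgue_integral_def w_def
      by (intro Bochner_Integration.integral_cong) (auto simp: indicator_def c_def)
    also have "\<dots> = integral {c..x} w"
      by (rule set_borel_integral_eq_integral) (auto intro: set_integrable_of_integrable w)
    finally show ?thesis .
  qed
  have "w integrable_on {c..d}"
    by (rule set_borel_integral_eq_integral) (auto intro: set_integrable_of_integrable w)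
  then have "continuous_on {c..d} (\<lambda>x. integral {c..x} w)"
    by (rule indefinite_integral_continuous_1)
  then have "continuous_on {c..d} (prim v)"
    by (rule continuous_on_eq) (simp add: eq)
  moreover have "s \<in> interior {c..d}"
    by (auto simp: c_def d_def)
  ultimately show ?thesis
    by (rule continuous_on_interior)
qed

lemma continuous_on_prim:
  fixes v :: "real \<Rightarrow> 'a::euclidean_space"
  shows "integrable lborel v \<Longrightarrow> continuous_on A (prim v)"
  by (simp add: isCont_prim continuous_at_imp_continuous_on)

lemma borel_measurable_prim:
  fixes v :: "real \<Rightarrow> 'a::euclidean_space"
  shows "integrable lborel v \<Longrightarrow> prim v \<in> borel_measurable borel"
  by (rule borel_measurable_continuous_onI) (rule continuous_on_prim)

lemma prim_cong_AE:
  fixes v w :: "real \<Rightarrow> 'a::euclidean_space"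
  assumes "AE s in lborel. s \<in> {0..t} \<longrightarrow> v s = w s" "s \<le> t"
    and "v \<in> borel_measurable borel" "w \<in> borel_measurable borel"
  shows "prim v s = prim w s"
  unfolding prim_def
  by (rule set_lebesgue_integral_cong_AE) (use assms in auto)

section \<open>Weak derivatives: integration by parts and the du Bois-Reymond lemma\<close>

lemma test_function_continuous:
  assumes "test_function t \<psi> \<psi>'"
  shows "continuous_on A \<psi>" "continuous_on A \<psi>'"
proof -
  have "\<And>s. (\<psi> has_real_derivative \<psi>' s) (at s)"
    using assms by (auto simp: test_function_def)
  then show "continuous_on A \<psi>"
    by (meson DERIV_isCont continuous_at_imp_continuous_on)
  show "continuous_on A \<psi>'"
    using assms by (auto simp: test_function_def intro: continuous_on_subset)
qed

text \<open>\<open>\<psi>\<close> vanishes at \<open>t\<close> because its support ends before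
  \<open>t\<close>. As the inner integral over the triangle, this turns \<open>\<psi>'\<close> into
  \<open>-\<psi>\<close>.\<close>

lemma test_function_integral:
  assumes "test_function t \<psi> \<psi>'" "\<sigma> \<le> t"
  shows "(LINT s:{\<sigma>..t}|lborel. \<psi>' s) = - \<psi> \<sigma>"
proof -
  have d: "\<And>s. (\<psi> has_real_derivative \<psi>' s) (at s)"
    using assms by (auto simp: test_function_def)
  have z: "\<psi> t = 0"
    using assms(1) unfolding test_function_def
    by (metis atLeastAtMost_iff linorder_not_less)
  have "(\<psi>' has_integral \<psi> t - \<psi> \<sigma>) {\<sigma>..t}"
    by (rule fundamental_theorem_of_calculus[OF assms(2)])
       (use d in \<open>auto simp: has_real_derivative_iff_has_vector_derivative[symmetric]
          intro: has_field_derivative_at_within\<close>)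
  moreover have "set_integrable lborel {\<sigma>..t} \<psi>'"
    by (rule borel_integrable_atLeastAtMost') (rule test_function_continuous(2)[OF assms(1)])
  ultimately show ?thesis
    using z by (simp add: set_borel_integral_eq_integral(2) integral_unique)
qed

text \<open>Fubini on the triangle \<open>\<sigma> \<le> s\<close>.\<close>

lemma prim_integration_by_parts:
  fixes v :: "real \<Rightarrow> 'a::euclidean_space"
  assumes v: "integrable lborel v" and \<psi>: "test_function t \<psi> \<psi>'"
  shows "(LINT s:{0..t}|lborel. \<psi>' s *\<^sub>R prim v s) = - (LINT s:{0..t}|lborel. \<psi> s *\<^sub>R v s)"
proof (cases "0 \<le> t")
  case True
  have [measurable]: "v \<in> borel_measurable borel" "\<psi>' \<in> borel_measurable borel" "\<psi> \<in> borel_measurable borel"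
    using v test_function_continuous[OF \<psi>] by (auto intro: borel_measurable_continuous_onI)
  define F where "F = (\<lambda>(\<sigma>,s). (indicator {0..t} s * indicator {0..s} \<sigma> * \<psi>' s) *\<^sub>R v \<sigma>)"
  have i1: "integrable lborel (\<lambda>s. indicator {0..t} s * \<psi>' s)"
    using borel_integrable_atLeastAtMost'[OF test_function_continuous(2)[OF \<psi>], of 0 t]
    by (simp add: set_integrable_def)
  have [measurable]: "F \<in> borel_measurable (lborel \<Otimes>\<^sub>M lborel)"
  proof -
    have "F = (\<lambda>p. (indicator {0..t} (snd p) * indicator {p. 0 \<le> fst p \<and> fst p \<le> snd p} p * \<psi>' (snd p)) *\<^sub>R v (fst p))"
      by (auto simp: F_def indicator_def fun_eq_iff)
    also have "\<dots> \<in> borel_measurable (lborel \<Otimes>\<^sub>M lborel)"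
      by measurable
    finally show ?thesis .
  qed
  \<comment> \<open>Without the indicator of the triangle the integrand is a product of integrable
    functions of one variable each; it dominates \<open>F\<close>.\<close>
  have G: "integrable (lborel \<Otimes>\<^sub>M lborel) (\<lambda>(\<sigma>,s). (indicator {0..t} s * \<psi>' s) *\<^sub>R v \<sigma>)"
  proof -
    have "integrable (lborel \<Otimes>\<^sub>M lborel) (\<lambda>p. norm (v (fst p)) * norm (indicator {0..t} (snd p) * \<psi>' (snd p)))"
      apply (rule lborel_pair.Fubini_integrable)
        apply measurable
      using v i1 by (auto simp: integrable_mult_right_iff)
    then show ?thesis
      by (rule Bochner_Integration.integrable_bound) (auto simp: split_beta)
  qed
  have F: "integrable (lborel \<Otimes>\<^sub>M lborel) F"
    by (rule Bochner_Integration.integrable_bound[OF G])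
       (auto simp: F_def indicator_def abs_mult split_beta)
  have "(LINT s:{0..t}|lborel. \<psi>' s *\<^sub>R prim v s) = (LINT s|lborel. LINT \<sigma>|lborel. F (\<sigma>,s))"
    unfolding prim_def set_lebesgue_integral_def integral_scaleR_right[symmetric] F_def
    by (intro Bochner_Integration.integral_cong refl) (auto simp: mult_ac)
  also have "\<dots> = (LINT \<sigma>|lborel. LINT s|lborel. F (\<sigma>,s))"
    using lborel_pair.Fubini_integral[of "\<lambda>x y. F (x,y)"] F by simp
  also have "\<dots> = (LINT \<sigma>|lborel. indicator {0..t} \<sigma> *\<^sub>R (- \<psi> \<sigma>) *\<^sub>R v \<sigma>)"
  proof (intro Bochner_Integration.integral_cong refl)
    fix \<sigma> :: real
    have "(LINT s|lborel. F (\<sigma>,s)) = (LINT s|lborel. (indicator {0..t} \<sigma> * (indicator {\<sigma>..t} s * \<psi>' s)) *\<^sub>R v \<sigma>)"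
      by (intro Bochner_Integration.integral_cong refl) (auto simp: F_def indicator_def)
    also have "\<dots> = (LINT s|lborel. (indicator {0..t} \<sigma> * (indicator {\<sigma>..t} s * \<psi>' s))) *\<^sub>R v \<sigma>"
    proof (rule integral_scaleR_left)
      have "integrable lborel (\<lambda>s. indicator {\<sigma>..t} s * \<psi>' s)"
        using borel_integrable_atLeastAtMost'[OF test_function_continuous(2)[OF \<psi>], of \<sigma> t]
        by (simp add: set_integrable_def)
      then show "integrable lborel (\<lambda>s. indicator {0..t} \<sigma> * (indicator {\<sigma>..t} s * \<psi>' s))"
        by (rule integrable_mult_right)
    qed
    also have "(LINT s|lborel. (indicator {0..t} \<sigma> * (indicator {\<sigma>..t} s * \<psi>' s)))
      = indicator {0..t} \<sigma> * (- \<psi> \<sigma>)"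
      using test_function_integral[OF \<psi>, of \<sigma>]
      by (auto simp: set_lebesgue_integral_def indicator_def)
    finally show "(LINT s|lborel. F (\<sigma>,s)) = indicator {0..t} \<sigma> *\<^sub>R (- \<psi> \<sigma>) *\<^sub>R v \<sigma>"
      by simp
  qed
  also have "\<dots> = - (LINT s:{0..t}|lborel. \<psi> s *\<^sub>R v s)"
    unfolding set_lebesgue_integral_def by (subst integral_minus[symmetric]) simp
  finally show ?thesis .
qed (simp add: set_lebesgue_integral_def)

text \<open>The derivative of the test function is \<open>\<omega> (d - m)\<close> with a weight \<open>\<omega>\<close> and \<open>m\<close> the
  weighted mean of \<open>d\<close>, so that testing gives \<open>\<integral> \<omega> (d - m)\<^sup>2 = 0\<close>.\<close>

lemma du_Bois_Reymond_interval:
  fixes d :: "real \<Rightarrow> real"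
  assumes d: "continuous_on {0..t} d" and ab: "0 < a" "a < b" "b < t"
    and 0: "\<And>\<psi> \<psi>'. test_function t \<psi> \<psi>' \<Longrightarrow> (LINT s:{0..t}|lborel. \<psi>' s * d s) = 0"
  obtains m where "\<And>s. s \<in> {a<..<b} \<Longrightarrow> d s = m"
proof -
  \<comment> \<open>Extension by the boundary values: \<open>g\<close> then becomes continuous on
    the whole line and has an antiderivative there.\<close>
  define D where "D s = d (max 0 (min t s))" for s
  have D: "continuous_on UNIV D"
    unfolding D_def by (rule continuous_on_compose2[OF d]) (use ab in \<open>auto intro!: continuous_intros\<close>)
  \<comment> \<open>Continuous and positive exactly on \<open>(a,b)\<close>: \<open>g\<close>
    inherits the support, and \<open>\<omega>\<close> can be cancelled at the end.\<close>
  define \<omega> where "\<omega> s = max 0 ((s - a) * (b - s))" for s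
  have \<omega>: "continuous_on UNIV \<omega>" unfolding \<omega>_def by (intro continuous_intros)
  have \<omega>_out: "\<omega> s = 0" if "s \<notin> {a<..<b}" for s
    using that ab unfolding \<omega>_def by (auto simp: max_def mult_le_0_iff zero_le_mult_iff)
  have \<omega>_in: "\<omega> s > 0" if "s \<in> {a<..<b}" for s
    using that unfolding \<omega>_def by (auto simp: max_def)
  have \<omega>_nn: "\<omega> s \<ge> 0" for s by (simp add: \<omega>_def)
  have int: "f integrable_on {a..b}" if "continuous_on UNIV f" for f :: "real \<Rightarrow> real"
    using that by (meson continuous_on_subset integrable_continuous_interval subset_UNIV)
  have pos: "integral {a..b} \<omega> > 0"
  proof -
    have "integral {a..b} \<omega> \<noteq> 0"
    proof
      assume "integral {a..b} \<omega> = 0"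
      then have "\<forall>s\<in>{a..b}. \<omega> s = 0"
        using integral_eq_0_iff[of a b \<omega>] \<omega> \<omega>_nn ab continuous_on_subset by blast
      with \<omega>_in[of "(a+b)/2"] ab show False by auto
    qed
    moreover have "integral {a..b} \<omega> \<ge> 0"
      by (rule integral_nonneg) (use \<omega>_nn int \<omega> in auto)
    ultimately show ?thesis by simp
  qed
  define m where "m = integral {a..b} (\<lambda>s. \<omega> s * D s) / integral {a..b} \<omega>"
  define g where "g s = \<omega> s * (D s - m)" for s
  have g: "continuous_on UNIV g" unfolding g_def by (intro continuous_intros \<omega> D)
  have g0: "integral {a..b} g = 0"
  proof -
    have "integral {a..b} g = integral {a..b} (\<lambda>s. \<omega> s * D s - m * \<omega> s)"
      unfolding g_def by (intro arg_cong[where f="integral {a..b}"] ext) (simp add: algebra_simps)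
    also have "\<dots> = integral {a..b} (\<lambda>s. \<omega> s * D s) - integral {a..b} (\<lambda>s. m * \<omega> s)"
      by (intro Henstock_Kurzweil_Integration.integral_diff int continuous_intros \<omega> D)
    also have "\<dots> = 0" using pos by (simp add: m_def)
    finally show ?thesis .
  qed
  obtain F where F: "\<And>s. (F has_vector_derivative g s) (at s)"
    using einterval_antiderivative[of "-\<infinity>" "\<infinity>" g] g by (auto simp: continuous_on_eq_continuous_at)
  define \<psi> where "\<psi> s = F s - F a" for s
  have \<psi>: "(\<psi> has_real_derivative g s) (at s)" for s
    unfolding \<psi>_def has_real_derivative_iff_has_vector_derivative
    using F[of s] by (auto intro!: derivative_eq_intros)
  have FTC: "(g has_integral F y - F x) {x..y}" if "x \<le> y" for x y
    by (rule fundamental_theorem_of_calculus[OF that]) (auto intro: F has_vector_derivative_at_within)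
  have out: "F x = F y" if "x \<le> y" "\<And>s. s \<in> {x..y} \<Longrightarrow> s \<notin> {a<..<b}" for x y
  proof -
    have "(g has_integral 0) {x..y}"
      by (rule has_integral_is_0) (use that \<omega>_out in \<open>auto simp: g_def\<close>)
    then have "0 = F y - F x" using FTC[OF that(1)] by (rule has_integral_unique)
    then show ?thesis by simp
  qed
  \<comment> \<open>The choice of \<open>m\<close> makes the total integral of \<open>g\<close>
    vanish, which brings \<open>\<psi>\<close> back to 0 at \<open>b\<close> and gives it compact
    support.\<close>
  have Fab: "F b = F a"
    using integral_unique[OF FTC[of a b]] g0 ab by simp
  have \<psi>_out: "\<psi> s = 0" if "s \<notin> {a..b}" for s
  proof (cases "s < a")
    case True
    then show ?thesis using out[of s a] by (simp add: \<psi>_def)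
  next
    case False
    then show ?thesis using that out[of b s] Fab by (simp add: \<psi>_def)
  qed
  have "test_function t \<psi> g"
    unfolding test_function_def using \<psi> g \<psi>_out ab by blast
  from 0[OF this] have "(LINT s:{0..t}|lborel. g s * d s) = 0" .
  also have "(LINT s:{0..t}|lborel. g s * d s) = (LINT s:{a..b}|lborel. g s * D s)"
    unfolding set_lebesgue_integral_def
  proof (intro Bochner_Integration.integral_cong refl)
    fix s show "indicator {0..t} s *\<^sub>R (g s * d s) = indicator {a..b} s *\<^sub>R (g s * D s)"
    proof (cases "s \<in> {a<..<b}")
      case True
      then show ?thesis using ab by (simp add: D_def)
    next
      case False
      then show ?thesis by (simp add: g_def \<omega>_out)
    qed
  qed
  also have "\<dots> = integral {a..b} (\<lambda>s. g s * D s)"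
    by (intro set_borel_integral_eq_integral borel_integrable_atLeastAtMost' continuous_intros
        continuous_on_subset[OF g] continuous_on_subset[OF D]) auto
  finally have "integral {a..b} (\<lambda>s. g s * D s) = 0" .
  moreover have "integral {a..b} (\<lambda>s. \<omega> s * (D s - m)\<^sup>2) =
     integral {a..b} (\<lambda>s. g s * D s - m * g s)"
    unfolding g_def by (intro arg_cong[where f="integral {a..b}"] ext) (simp add: power2_eq_square algebra_simps)
  moreover have "integral {a..b} (\<lambda>s. g s * D s - m * g s) =
     integral {a..b} (\<lambda>s. g s * D s) - integral {a..b} (\<lambda>s. m * g s)"
    by (intro Henstock_Kurzweil_Integration.integral_diff int continuous_intros g D)
  ultimately have "integral {a..b} (\<lambda>s. \<omega> s * (D s - m)\<^sup>2) = 0" using g0 by simp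
  moreover have "continuous_on {a..b} (\<lambda>s. \<omega> s * (D s - m)\<^sup>2)"
    by (intro continuous_intros continuous_on_subset[OF \<omega>] continuous_on_subset[OF D]) auto
  ultimately have *: "\<omega> s * (D s - m)\<^sup>2 = 0" if "s \<in> {a..b}" for s
    using integral_eq_0_iff[of a b "\<lambda>s. \<omega> s * (D s - m)\<^sup>2"] ab \<omega>_nn that by auto
  have Dm: "D s = m" if "s \<in> {a<..<b}" for s
    using *[of s] \<omega>_in[OF that] that by simp
  have "d s = m" if "s \<in> {a<..<b}" for s
  proof -
    have "max 0 (min t s) = s" using that ab by auto
    then show ?thesis using Dm[OF that] by (simp add: D_def)
  qed
  then show ?thesis by (rule that)
qed

text \<open>Every interior point lies together with \<open>t/2\<close> in some interval compactly
  inside \<open>(0,t)\<close>, so all local constants agree; continuity adds the endpoints.\<close>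

lemma du_Bois_Reymond:
  fixes d :: "real \<Rightarrow> real"
  assumes d: "continuous_on {0..t} d" and t: "0 < t"
    and 0: "\<And>\<psi> \<psi>'. test_function t \<psi> \<psi>' \<Longrightarrow> (LINT s:{0..t}|lborel. \<psi>' s * d s) = 0"
    and s: "s \<in> {0..t}"
  shows "d s = d 0"
proof -
  have eq: "d x = d (t/2)" if x: "x \<in> {0<..<t}" for x
  proof -
    define a where "a = min x (t/2) / 2"
    define b where "b = (max x (t/2) + t) / 2"
    have ab: "0 < a" "a < b" "b < t" "x \<in> {a<..<b}" "t/2 \<in> {a<..<b}"
      using x t by (auto simp: a_def b_def min_def max_def)
    obtain m where "\<And>s. s \<in> {a<..<b} \<Longrightarrow> d s = m"
      using du_Bois_Reymond_interval[of t d a b] d ab(1-3) 0 by blast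
    with ab show ?thesis by metis
  qed
  have cl: "closure {0<..<t} = {0..t}" using t by simp
  have "d x = d (t/2)" if "x \<in> {0..t}" for x
    by (rule continuous_constant_on_closure[of "{0<..<t}"]) (use d that cl in \<open>auto intro: eq\<close>)
  with s t show ?thesis by (metis atLeastAtMost_iff order.strict_implies_order order_refl)
qed

section \<open>Borel versions of Sobolev velocities\<close>

lemma lebesgue_borel_version:
  fixes f :: "real \<Rightarrow> 'a::euclidean_space"
  assumes f: "f \<in> borel_measurable lebesgue"
  obtains g where "g \<in> borel_measurable borel" "AE x in lborel. f x = g x"
proof -
  have "\<exists>g. g \<in> borel_measurable borel \<and> (AE x in lborel. f x \<bullet> b = g x)" for b
    using completion_ex_borel_measurable_real[of "\<lambda>x. f x \<bullet> b" lborel] f by auto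
  then have "\<forall>b. \<exists>g. g \<in> borel_measurable borel \<and> (AE x in lborel. f x \<bullet> b = g x)" by blast
  from choice[OF this] obtain G where G: "\<And>b. G b \<in> borel_measurable borel" "\<And>b. AE x in lborel. f x \<bullet> b = G b x"
    by blast
  define g where "g x = (\<Sum>b\<in>Basis. G b x *\<^sub>R b)" for x
  have "g \<in> borel_measurable borel" unfolding g_def using G(1) by measurable
  moreover have "AE x in lborel. \<forall>b\<in>Basis. f x \<bullet> b = G b x"
    using G(2) by (simp add: AE_finite_all)
  then have "AE x in lborel. f x = g x"
    by eventually_elim (metis (no_types, lifting) g_def euclidean_representation sum.cong)
  ultimately show ?thesis by (rule that)
qed

lemma lebesgue_set_integral_AE_borel:
  fixes f g :: "real \<Rightarrow> 'a::euclidean_space"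
  assumes "set_borel_measurable borel A g" "AE x in lborel. x \<in> A \<longrightarrow> f x = g x"
    "set_borel_measurable lebesgue A f"
  shows "(LINT x:A|lebesgue. f x) = (LINT x:A|lborel. g x)"
proof -
  have "(LINT x|lebesgue. indicator A x *\<^sub>R f x) = (LINT x|lebesgue. indicator A x *\<^sub>R g x)"
  proof (rule integral_cong_AE)
    show "AE x in lebesgue. indicator A x *\<^sub>R f x = indicator A x *\<^sub>R g x"
      using assms(2) unfolding AE_completion_iff by eventually_elim (auto simp: indicator_def)
    show "(\<lambda>x. indicator A x *\<^sub>R g x) \<in> borel_measurable lebesgue"
      using assms(1) unfolding set_borel_measurable_def by (intro measurable_completion) simp
  qed (use assms in \<open>auto simp: set_borel_measurable_def\<close>)
  also have "\<dots> = (LINT x|lborel. indicator A x *\<^sub>R g x)"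
    using assms(1) unfolding set_borel_measurable_def by (intro integral_completion) simp
  finally show ?thesis by (simp add: set_lebesgue_integral_def)
qed

lemma continuous_on_set_borel_measurable:
  fixes f :: "real \<Rightarrow> 'a::euclidean_space"
  assumes "continuous_on {a..b} f"
  shows "set_borel_measurable borel {a..b} f" "set_borel_measurable lebesgue {a..b} f"
proof -
  show *: "set_borel_measurable borel {a..b} f"
    using assms by (simp add: set_borel_measurable_def borel_measurable_continuous_on_indicator)
  show "set_borel_measurable lebesgue {a..b} f"
    using * unfolding set_borel_measurable_def by (intro measurable_completion) simp
qed

lemma sobolev_W11_prim:
  fixes v :: "real \<Rightarrow> real^'n"
  assumes v: "integrable lborel v"
  shows "sobolev_W11 t (\<lambda>s. x + prim v s) v"
  unfolding sobolev_W11_def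
proof (intro conjI allI impI)
  have [measurable]: "v \<in> borel_measurable borel" using v by auto
  show "continuous_on {0..t} (\<lambda>s. x + prim v s)"
    by (intro continuous_intros continuous_on_prim v)
  have "integrable lebesgue v" using v by (subst integrable_completion) auto
  then show "set_integrable lebesgue {0..t} v"
    unfolding set_integrable_def by (intro integrable_mult_indicator) auto
  fix \<psi> \<psi>' assume \<psi>: "test_function t \<psi> \<psi>'"
  note cont = test_function_continuous[OF \<psi>]
  have [measurable]: "\<psi> \<in> borel_measurable borel"
    by (intro borel_measurable_continuous_onI cont)
  have c: "continuous_on {0..t} (\<lambda>s. \<psi>' s *\<^sub>R (x + prim v s))"
    by (intro continuous_intros cont continuous_on_prim v)
  have "(LINT s:{0..t}|lebesgue. \<psi>' s *\<^sub>R (x + prim v s)) = (LINT s:{0..t}|lborel. \<psi>' s *\<^sub>R (x + prim v s))"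
    by (intro lebesgue_set_integral_AE_borel continuous_on_set_borel_measurable c) auto
  also have "\<dots> = (LINT s:{0..t}|lborel. \<psi>' s *\<^sub>R x) + (LINT s:{0..t}|lborel. \<psi>' s *\<^sub>R prim v s)"
    unfolding scaleR_add_right
    by (intro set_integral_add borel_integrable_atLeastAtMost' continuous_intros cont
        continuous_on_prim v)
  \<comment> \<open>The constant drops out because \<open>\<psi>\<close> vanishes at both ends of
    the interval.\<close>
  also have "(LINT s:{0..t}|lborel. \<psi>' s *\<^sub>R x) = 0"
  proof (cases "0 \<le> t")
    case True
    have "(LINT s:{0..t}|lborel. \<psi>' s) = 0"
      using test_function_integral[OF \<psi> True] \<psi> unfolding test_function_def
      by (metis add.inverse_neutral atLeastAtMost_iff linorder_not_less)
    moreover have "set_integrable lborel {0..t} \<psi>'"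
      by (rule borel_integrable_atLeastAtMost'[OF cont(2)])
    ultimately show ?thesis
      unfolding set_lebesgue_integral_def set_integrable_def
      using integral_scaleR_left[of x lborel "\<lambda>s. indicator {0..t} s *\<^sub>R \<psi>' s"] by simp
  qed (simp add: set_lebesgue_integral_def)
  also have "(LINT s:{0..t}|lborel. \<psi>' s *\<^sub>R prim v s) = - (LINT s:{0..t}|lborel. \<psi> s *\<^sub>R v s)"
    by (rule prim_integration_by_parts[OF v \<psi>])
  also have "(LINT s:{0..t}|lborel. \<psi> s *\<^sub>R v s) = (LINT s:{0..t}|lebesgue. \<psi> s *\<^sub>R v s)"
    by (rule lebesgue_set_integral_AE_borel[symmetric])
       (auto simp: set_borel_measurable_def intro!: measurable_completion)
  finally show "(LINT s:{0..t}|lebesgue. \<psi>' s *\<^sub>R (x + prim v s)) = - (LINT s:{0..t}|lebesgue. \<psi> s *\<^sub>R v s)"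
    by simp
qed

text \<open>By the integration by parts formula, \<open>y - prim w\<close> has weak derivative 0,
  where \<open>w\<close> is a Borel version of \<open>v\<close>; the du Bois-Reymond lemma in each
  coordinate makes it constant.\<close>

lemma sobolev_W11_imp_prim:
  fixes y v :: "real \<Rightarrow> real^'n"
  assumes y: "sobolev_W11 t y v" and t: "0 \<le> t"
  obtains w where "integrable lborel w" "AE s in lborel. s \<in> {0..t} \<longrightarrow> v s = w s"
    "\<And>s. s \<notin> {0..t} \<Longrightarrow> w s = 0"
    "\<And>s. s \<in> {0..t} \<Longrightarrow> y s = y 0 + prim w s"
proof -
  \<comment> \<open>The cutoff precedes the choice of a Borel version because \<open>v\<close> is
    known to be measurable only on \<open>{0..t}\<close>.\<close>
  define v1 where "v1 s = indicator {0..t} s *\<^sub>R v s" for s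
  have int: "integrable lebesgue v1"
    using y unfolding sobolev_W11_def set_integrable_def v1_def by auto
  obtain w0 where w0: "w0 \<in> borel_measurable borel" "AE x in lborel. v1 x = w0 x"
    using lebesgue_borel_version[OF borel_measurable_integrable[OF int]] by blast
  define w where "w s = indicator {0..t} s *\<^sub>R w0 s" for s
  have [measurable]: "w \<in> borel_measurable borel" unfolding w_def using w0(1) by measurable
  have AE: "AE s in lborel. v1 s = w s"
    using w0(2) by eventually_elim (auto simp: v1_def w_def indicator_def)
  have w: "integrable lborel w"
  proof -
    have "integrable lebesgue w"
      by (rule integrable_cong_AE_imp[OF int]) (use AE in \<open>auto simp: AE_completion_iff intro: measurable_completion\<close>)
    then show ?thesis by (subst (asm) integrable_completion) auto
  qed
  have AEv: "AE s in lborel. s \<in> {0..t} \<longrightarrow> v s = w s"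
    using AE by eventually_elim (auto simp: v1_def)
  have out: "\<And>s. s \<notin> {0..t} \<Longrightarrow> w s = 0" by (simp add: w_def)
  have cy: "continuous_on {0..t} y" using y by (simp add: sobolev_W11_def)
  have rep: "y s = y 0 + prim w s" if s: "s \<in> {0..t}" for s
  proof (cases "t = 0")
    case False
    then have t: "0 < t" using t by simp
    define D where "D s = y s - prim w s" for s
    have cD: "continuous_on {0..t} D" unfolding D_def by (intro continuous_intros cy continuous_on_prim w)
    have "D s \<bullet> b = D 0 \<bullet> b" if b: "b \<in> Basis" for b
    proof (rule du_Bois_Reymond[of t "\<lambda>s. D s \<bullet> b"])
      show "continuous_on {0..t} (\<lambda>s. D s \<bullet> b)" by (intro continuous_intros cD)
      fix \<psi> \<psi>' assume \<psi>: "test_function t \<psi> \<psi>'"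
      note cont = test_function_continuous[OF \<psi>]
      have [measurable]: "\<psi> \<in> borel_measurable borel"
        by (intro borel_measurable_continuous_onI cont)
      have [measurable]: "\<psi> \<in> borel_measurable lebesgue"
        by (auto intro: measurable_completion)
      have c: "continuous_on {0..t} (\<lambda>s. \<psi>' s *\<^sub>R y s)" "continuous_on {0..t} (\<lambda>s. \<psi>' s *\<^sub>R prim w s)"
        by (intro continuous_intros cont cy continuous_on_prim w)+
      have "(LINT s:{0..t}|lborel. \<psi>' s *\<^sub>R y s) = (LINT s:{0..t}|lebesgue. \<psi>' s *\<^sub>R y s)"
        by (rule lebesgue_set_integral_AE_borel[symmetric])
           (use continuous_on_set_borel_measurable c in auto)
      also have "\<dots> = - (LINT s:{0..t}|lebesgue. \<psi> s *\<^sub>R v s)"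
        using y \<psi> by (simp add: sobolev_W11_def)
      also have "(LINT s:{0..t}|lebesgue. \<psi> s *\<^sub>R v s) = (LINT s:{0..t}|lborel. \<psi> s *\<^sub>R w s)"
      proof (rule lebesgue_set_integral_AE_borel)
        show "set_borel_measurable lebesgue {0..t} (\<lambda>s. \<psi> s *\<^sub>R v s)"
        proof -
          have "(\<lambda>s. \<psi> s *\<^sub>R v1 s) \<in> borel_measurable lebesgue"
            by (intro borel_measurable_scaleR borel_measurable_integrable[OF int]) simp
          then show ?thesis
            unfolding set_borel_measurable_def v1_def by (simp add: mult.commute)
        qed
        show "AE s in lborel. s \<in> {0..t} \<longrightarrow> \<psi> s *\<^sub>R v s = \<psi> s *\<^sub>R w s"
          using AEv by eventually_elim auto
      qed (simp add: set_borel_measurable_def)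
      also have "- \<dots> = (LINT s:{0..t}|lborel. \<psi>' s *\<^sub>R prim w s)"
        using prim_integration_by_parts[OF w \<psi>] by simp
      finally have "(LINT s:{0..t}|lborel. \<psi>' s *\<^sub>R y s) - (LINT s:{0..t}|lborel. \<psi>' s *\<^sub>R prim w s) = 0"
        by simp
      then have *: "(LINT s:{0..t}|lborel. \<psi>' s *\<^sub>R D s) = 0"
        unfolding D_def scaleR_diff_right
        by (subst set_integral_diff) (use c in \<open>auto intro: borel_integrable_atLeastAtMost'\<close>)
      have "set_integrable lborel {0..t} (\<lambda>s. \<psi>' s *\<^sub>R D s)"
        by (intro borel_integrable_atLeastAtMost' continuous_intros cont cD)
      then have "(LINT s:{0..t}|lborel. \<psi>' s * (D s \<bullet> b)) = (LINT s:{0..t}|lborel. \<psi>' s *\<^sub>R D s) \<bullet> b"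
        unfolding set_lebesgue_integral_def set_integrable_def
        by (subst integral_inner_left[symmetric]) (auto simp: mult.assoc)
      with * show "(LINT s:{0..t}|lborel. \<psi>' s * (D s \<bullet> b)) = 0" by simp
    qed (use t s in auto)
    then have "D s = D 0" by (rule euclidean_eqI)
    then show ?thesis by (simp add: D_def algebra_simps)
  qed (use s in auto)
  show ?thesis by (rule that[OF w AEv out rep])
qed

section \<open>The cost of a Borel velocity\<close>

definition cost :: "('a::euclidean_space \<Rightarrow> 'a \<Rightarrow> real) \<Rightarrow> real \<Rightarrow> 'a \<Rightarrow> (real \<Rightarrow> 'a) \<Rightarrow> ennreal" where
  "cost L t x v = (\<integral>\<^sup>+s\<in>{0..t}. ennreal (L (x + prim v s) (v s)) \<partial>lborel)"

lemma value_function_le_cost: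
  fixes v :: "real \<Rightarrow> real^'n"
  assumes "integrable lborel v"
  shows "value_function L \<phi> t x \<le> cost L t x v + \<phi> (x + prim v t)"
  unfolding value_function_def
proof (rule Inf_lower, intro CollectI exI conjI)
  show "sobolev_W11 t (\<lambda>s. x + prim v s) v" by (rule sobolev_W11_prim[OF assms])
qed (auto simp: cost_def nn_integral_completion)

text \<open>Together with \<open>value_function_le_cost\<close>, the infimum over Sobolev pairs
  becomes one over integrable Borel velocities. Their vanishing outside \<open>{0..t}\<close> lets
  paths with different horizons be compared on one interval.\<close>

lemma value_function_lessE:
  fixes L :: "real^'n \<Rightarrow> real^'n \<Rightarrow> real"
  assumes "value_function L \<phi> t x < a" and t: "0 \<le> t"
  obtains v where "integrable lborel v" "\<And>s. s \<notin> {0..t} \<Longrightarrow> v s = 0"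
    "cost L t x v + \<phi> (x + prim v t) < a"
proof -
  obtain y v where yv: "sobolev_W11 t y v" "y 0 = x"
    "(\<integral>\<^sup>+s\<in>{0..t}. ennreal (L (y s) (v s)) \<partial>lebesgue) + \<phi> (y t) < a"
    using assms(1) unfolding value_function_def Inf_less_iff by blast
  obtain w where w: "integrable lborel w" "AE s in lborel. s \<in> {0..t} \<longrightarrow> v s = w s"
    "\<And>s. s \<notin> {0..t} \<Longrightarrow> w s = 0"
    "\<And>s. s \<in> {0..t} \<Longrightarrow> y s = y 0 + prim w s"
    using sobolev_W11_imp_prim[OF yv(1) t] by metis
  have "cost L t x w = (\<integral>\<^sup>+s\<in>{0..t}. ennreal (L (y s) (v s)) \<partial>lebesgue)"
    unfolding cost_def nn_integral_completion
  proof (rule nn_integral_cong_AE)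
    have eq: "y s = x + prim w s" if "s \<in> {0..t}" for s
      using w(4)[OF that] yv(2) by simp
    show "AE s in lborel. ennreal (L (x + prim w s) (w s)) * indicator {0..t} s =
        ennreal (L (y s) (v s)) * indicator {0..t} s"
      using w(2) by eventually_elim (auto simp: indicator_def eq)
  qed
  moreover have "y t = x + prim w t" using w(4)[of t] yv(2) t by simp
  ultimately show ?thesis using yv(3) by (intro that[OF w(1,3)]) auto
qed

subsection \<open>Superlinear Lagrangians\<close>

lemma lsc_on_UNIV_open:
  assumes "lsc_on UNIV f" shows "open {x. a < f x}"
proof (subst open_subopen, safe)
  fix x assume "a < f x"
  then have "\<forall>\<^sub>F y in at x. a < f y" using assms by (auto simp: lsc_on_def)
  then obtain S where "open S" "x \<in> S" "\<forall>y\<in>S. y \<noteq> x \<longrightarrow> a < f y"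
    unfolding eventually_at_topological by auto
  with \<open>a < f x\<close> show "\<exists>T. open T \<and> x \<in> T \<and> T \<subseteq> {x. a < f x}" by (intro exI[of _ S]) auto
qed

lemma lsc_on_UNIV_borel_measurable:
  fixes f :: "'a::topological_space \<Rightarrow> real"
  assumes "lsc_on UNIV f" shows "f \<in> borel_measurable borel"
  by (rule borel_measurableI_greater) (use lsc_on_UNIV_open[OF assms] in simp)

lemma lsc_on_sequentially:
  fixes f :: "'a::topological_space \<Rightarrow> 'b::linorder"
  assumes f: "lsc_on S f" and x: "x \<in> S" and X: "X \<longlonglongrightarrow> x" "\<And>n. X n \<in> S" and a: "a < f x"
  shows "\<forall>\<^sub>F n in sequentially. a < f (X n)"
proof -
  have "\<forall>\<^sub>F y in at x within S. a < f y" using f x a by (auto simp: lsc_on_def)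
  then obtain U where "open U" "x \<in> U" "\<And>y. y \<in> U \<Longrightarrow> y \<noteq> x \<Longrightarrow> y \<in> S \<Longrightarrow> a < f y"
    unfolding eventually_at_topological by blast
  then have U: "open U" "x \<in> U" "\<And>y. y \<in> U \<Longrightarrow> y \<in> S \<Longrightarrow> a < f y" using a by metis+
  have "\<forall>\<^sub>F n in sequentially. X n \<in> U" using X(1) U(1,2) by (rule topological_tendstoD)
  then show ?thesis by eventually_elim (use U X in auto)
qed

lemma lsc_on_le_Liminf:
  fixes f :: "'a::topological_space \<Rightarrow> ennreal"
  assumes "lsc_on S f" "x \<in> S" "X \<longlonglongrightarrow> x" "\<And>n. X n \<in> S"
  shows "f x \<le> liminf (\<lambda>n. f (X n))"
  unfolding le_Liminf_iff using lsc_on_sequentially[OF assms] by blast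

locale lagrangian =
  fixes L :: "'a::euclidean_space \<Rightarrow> 'a \<Rightarrow> real" and \<Theta> :: "'a \<Rightarrow> real"
  assumes nonneg: "0 \<le> L x u"
    and lsc: "lsc_on UNIV (\<lambda>(x, u). L x u)"
    and convex: "convex_on UNIV (L x)"
    and superlinear: "filterlim (\<lambda>u. \<Theta> u / norm u) at_top at_infinity"
    and \<Theta>_nonneg: "0 \<le> \<Theta> u"
    and \<Theta>_le: "\<Theta> u \<le> L x u"
begin

lemma measurable_L: "(\<lambda>(x, u). L x u) \<in> borel_measurable borel"
  by (rule lsc_on_UNIV_borel_measurable[OF lsc])

lemma measurable_L_compose [measurable (raw)]:
  assumes "f \<in> M \<rightarrow>\<^sub>M borel" "g \<in> M \<rightarrow>\<^sub>M borel"
  shows "(\<lambda>z. L (f z) (g z)) \<in> borel_measurable M"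
proof -
  have "(\<lambda>z. (f z, g z)) \<in> M \<rightarrow>\<^sub>M borel"
    using assms by (simp add: borel_prod[symmetric])
  from measurable_compose[OF this measurable_L] show ?thesis by simp
qed

lemma superlinear_norm:
  obtains R where "R > 0" "\<And>u. norm u \<ge> R \<Longrightarrow> K * norm u \<le> \<Theta> u"
proof -
  have "eventually (\<lambda>u. K \<le> \<Theta> u / norm u) at_infinity"
    using superlinear by (simp add: filterlim_at_top)
  then obtain b where b: "\<And>u. b \<le> norm u \<Longrightarrow> K \<le> \<Theta> u / norm u"
    unfolding eventually_at_infinity by auto
  show ?thesis
  proof (rule that[of "max b 1"])
    fix u :: 'a assume u: "max b 1 \<le> norm u"
    then have "0 < norm u" by linarith
    with b[of u] u show "K * norm u \<le> \<Theta> u" by (simp add: pos_le_divide_eq)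
  qed simp
qed

text \<open>The form of superlinear growth behind de la Vallee-Poussin's criterion: for large
  \<open>K\<close> the part of the speed that is controlled by the cost has a small coefficient, and
  the rest is bounded.\<close>

lemma norm_le_L:
  assumes "0 < K" obtains C where "C \<ge> 0" "\<And>x u. norm u \<le> L x u / K + C"
proof -
  obtain R where R: "R > 0" "\<And>u. norm u \<ge> R \<Longrightarrow> K * norm u \<le> \<Theta> u" using superlinear_norm by blast
  show ?thesis
  proof (rule that[of R])
    fix x u
    show "norm u \<le> L x u / K + R"
    proof (cases "norm u \<ge> R")
      case True
      then have "K * norm u \<le> L x u" using R(2)[OF True] \<Theta>_le[of u x] by linarith
      then show ?thesis using assms R(1) by (simp add: field_simps add.commute add_increasing)
    next
      case False
      moreover have "0 \<le> L x u / K" using nonneg assms by simp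
      ultimately show ?thesis by linarith
    qed
  qed (use R in simp)
qed

text \<open>A hyperplane strictly below the graph of \<open>L x0\<close> stays below that of
  \<open>L x\<close> for \<open>x\<close> near \<open>x0\<close>: for large \<open>u\<close> because
  \<open>\<Theta>\<close> outgrows every affine function, whatever \<open>x\<close> is, and on the
  remaining compact ball by lower semicontinuity and the tube lemma. One minorant thus serves all
  positions near \<open>x0\<close>, which replaces continuity of \<open>L\<close> in
  \<open>x\<close>.\<close>

lemma affine_minorant:
  assumes e: "e > 0"
  obtains p a \<delta> where "\<delta> > 0" "a + p \<bullet> u0 > L x0 u0 - e"
    "\<And>x u. dist x x0 < \<delta> \<Longrightarrow> a + p \<bullet> u \<le> L x u"
proof -
  define S where "S = epigraph UNIV (L x0)"
  have cont: "continuous_on UNIV (L x0)"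
    by (rule convex_on_continuous) (use convex in auto)
  have "convex S" unfolding S_def using convex by (simp add: convex_epigraph)
  moreover have "closed S"
  proof -
    have "S = {z. L x0 (fst z) \<le> snd z}" by (simp add: S_def epigraph_def)
    then show ?thesis
      by (auto intro!: closed_Collect_le continuous_intros continuous_on_compose2[OF cont])
  qed
  moreover have "(u0, L x0 u0 - e) \<notin> S" using e by (simp add: S_def mem_epigraph)
  ultimately obtain A b where
    A: "A \<bullet> (u0, L x0 u0 - e) < b" "\<And>z. z \<in> S \<Longrightarrow> b < A \<bullet> z"
    using separating_hyperplane_closed_point by metis
  obtain p0 q where Aeq: "A = (p0, q)" by (cases A)
  have mem: "b < p0 \<bullet> u + q * L x0 u" for u
    using A(2)[of "(u, L x0 u)"] by (simp add: Aeq S_def mem_epigraph)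
  have up: "p0 \<bullet> u0 + q * (L x0 u0 - e) < b" using A(1) by (simp add: Aeq)
  \<comment> \<open>The two inequalities at \<open>u0\<close> differ by \<open>q * e\<close>; so the
    hyperplane is not vertical and can be solved for the last coordinate.\<close>
  have "q * e > 0" using mem[of u0] up by (simp add: algebra_simps)
  then have q: "q > 0" using e by (simp add: zero_less_mult_iff)
  define p where "p = - (1/q) *\<^sub>R p0"
  define a where "a = b / q"
  have strict: "a + p \<bullet> u < L x0 u" for u
    using mem[of u] q by (simp add: a_def p_def field_simps)
  have at: "a + p \<bullet> u0 > L x0 u0 - e" using up q by (simp add: a_def p_def field_simps)
  \<comment> \<open>For \<open>norm u \<ge> 1\<close> the affine function is at most
    \<open>(norm p + \<bar>a\<bar>) * norm u\<close>.\<close>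
  obtain R where R: "R > 0" "\<And>u. norm u \<ge> R \<Longrightarrow> (norm p + \<bar>a\<bar>) * norm u \<le> \<Theta> u"
    using superlinear_norm by blast
  define R1 where "R1 = max R 1"
  have far: "a + p \<bullet> u \<le> L x u" if "norm u > R1" for x u
  proof -
    have "a \<le> \<bar>a\<bar> * norm u"
      using that mult_left_mono[of 1 "norm u" "\<bar>a\<bar>"] by (simp add: R1_def)
    moreover have "p \<bullet> u \<le> norm p * norm u" by (rule norm_cauchy_schwarz)
    moreover have "(norm p + \<bar>a\<bar>) * norm u \<le> \<Theta> u" using that by (intro R) (simp add: R1_def)
    ultimately show ?thesis using \<Theta>_le[of u x] by (simp add: algebra_simps)
  qed
  define W where "W = {z. a + p \<bullet> snd z < (\<lambda>(x,u). L x u) z}"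
  have oW: "open W"
  proof (subst open_subopen, safe)
    fix x u assume "(x, u) \<in> W"
    then have xu: "a + p \<bullet> u < L x u" by (simp add: W_def)
    define m where "m = (a + p \<bullet> u + L x u) / 2"
    have "open ({z. m < (\<lambda>(x,u). L x u) z} \<inter> {z. a + p \<bullet> snd z < m})"
      by (intro open_Int lsc_on_UNIV_open lsc open_Collect_less continuous_intros)
    moreover have "(x, u) \<in> {z. m < (\<lambda>(x,u). L x u) z} \<inter> {z. a + p \<bullet> snd z < m}"
      using xu by (auto simp: m_def field_simps)
    moreover have "{z. m < (\<lambda>(x,u). L x u) z} \<inter> {z. a + p \<bullet> snd z < m} \<subseteq> W"
      by (auto simp: W_def)
    ultimately show "\<exists>T. open T \<and> (x, u) \<in> T \<and> T \<subseteq> W" by blast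
  qed
  have "\<exists>U V. openin euclidean U \<and> openin euclidean V \<and> x0 \<in> U \<and> cball 0 R1 \<subseteq> V \<and> U \<times> V \<subseteq> W"
  proof (rule tube_lemma_right)
    show "openin (prod_topology euclidean euclidean) W"
      using oW by simp
    show "compactin euclidean (cball (0::'a) R1)" by simp
    show "{x0} \<times> cball 0 R1 \<subseteq> W" using strict by (auto simp: W_def)
  qed simp
  then obtain U V where UV: "open U" "x0 \<in> U" "cball 0 R1 \<subseteq> V" "U \<times> V \<subseteq> W"
    by auto
  obtain \<delta> where \<delta>: "\<delta> > 0" "ball x0 \<delta> \<subseteq> U" using UV(1,2) open_contains_ball by blast
  show ?thesis
  proof (rule that[OF \<delta>(1) at])
    fix x u assume "dist x x0 < \<delta>"
    then have x: "x \<in> U" using \<delta>(2) by (auto simp: dist_commute)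
    show "a + p \<bullet> u \<le> L x u"
    proof (cases "norm u > R1")
      case False
      then have "(x, u) \<in> W" using x UV(3,4) by (auto simp: subset_iff)
      then show ?thesis by (simp add: W_def)
    qed (rule far)
  qed
qed

text \<open>Halving the speed pays off where the speed is high, because \<open>v / 2\<close> is a convex combination
  of \<open>v\<close> and a vector of length \<open>r\<close>.\<close>

lemma half_speed_le:
  assumes M: "\<And>u. norm u \<le> r \<Longrightarrow> L x u \<le> M" and r: "r > 0" and v: "norm v > 2 * r"
    and K: "K \<ge> 0" "K * norm v \<le> L x v"
  shows "2 * L x ((1/2) *\<^sub>R v) \<le> L x v + 2 * M - r * K"
proof -
  define n where "n = norm v"
  have n: "n > 2 * r" "n > r" "n > 0" using v r by (auto simp: n_def)
  \<comment> \<open>Solves \<open>n / 2 = \<theta> * n + (1 - \<theta>) * r\<close>.\<close>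
  define \<theta> where "\<theta> = (n / 2 - r) / (n - r)"
  have \<theta>: "0 \<le> \<theta>" "\<theta> \<le> 1" using n r by (auto simp: \<theta>_def field_simps)
  have comb: "(1/2) *\<^sub>R v = \<theta> *\<^sub>R v + (1 - \<theta>) *\<^sub>R ((r / n) *\<^sub>R v)"
  proof -
    have "1/2 = \<theta> + (1 - \<theta>) * (r / n)"
      using n r by (simp add: \<theta>_def divide_simps)
    then show ?thesis by (metis scaleR_left_distrib scaleR_scaleR)
  qed
  have "L x ((1/2) *\<^sub>R v) \<le> \<theta> * L x v + (1 - \<theta>) * L x ((r / n) *\<^sub>R v)"
    unfolding comb using convex_onD[OF convex[of x], of "1 - \<theta>" v "(r / n) *\<^sub>R v"] \<theta> by simp
  also have "L x ((r / n) *\<^sub>R v) \<le> M"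
    using n r by (intro M) (simp add: n_def)
  finally have "L x ((1/2) *\<^sub>R v) \<le> \<theta> * L x v + (1 - \<theta>) * M"
    using \<theta> by (simp add: mult_left_mono)
  \<comment> \<open>The amount by which \<open>2 * \<theta>\<close> falls short of 1 is the gain:
    times \<open>L x v \<ge> K * n\<close> it is at least \<open>r * K\<close>, while the vector of
    length \<open>r\<close> costs at most \<open>2 * M\<close>.\<close>
  moreover have "2 * \<theta> = 1 - r / (n - r)" using n by (simp add: \<theta>_def field_simps)
  then have "2 * \<theta> * L x v = L x v - r / (n - r) * L x v" by (simp add: left_diff_distrib)
  ultimately have "2 * L x ((1/2) *\<^sub>R v) \<le> L x v - r / (n - r) * L x v + 2 * (1 - \<theta>) * M"
    by linarith
  moreover have "2 * (1 - \<theta>) * M \<le> 2 * M"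
    using \<theta> M[of 0] nonneg[of x 0] r by (simp add: algebra_simps)
  moreover have "r * K \<le> r / (n - r) * L x v"
  proof -
    have "K * (n - r) \<le> L x v" using K r by (simp add: n_def algebra_simps add_increasing)
    then have "K \<le> L x v / (n - r)" using n by (simp add: pos_le_divide_eq)
    then have "r * K \<le> r * (L x v / (n - r))" using r by (intro mult_left_mono) auto
    then show ?thesis by simp
  qed
  ultimately show ?thesis by linarith
qed

text \<open>Convexity between \<open>v\<close> and \<open>2 v\<close> with weight
  \<open>\<mu> = \<delta> / (1 - \<delta>)\<close>; here
  \<open>(1 - \<delta>) * \<mu> = \<delta>\<close>, so the price of speeding up is linear in
  \<open>\<delta>\<close>.\<close>

lemma faster_le:
  assumes \<delta>: "0 \<le> \<delta>" "\<delta> \<le> 1/2"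
  shows "(1 - \<delta>) * L x ((1 / (1 - \<delta>)) *\<^sub>R v) \<le> L x v + \<delta> * L x (2 *\<^sub>R v)"
proof -
  define \<mu> where "\<mu> = \<delta> / (1 - \<delta>)"
  have \<mu>: "0 \<le> \<mu>" "\<mu> \<le> 1" using \<delta> by (auto simp: \<mu>_def field_simps)
  have "1 / (1 - \<delta>) = (1 - \<mu>) + \<mu> * 2" using \<delta> by (simp add: \<mu>_def field_simps)
  then have comb: "(1 / (1 - \<delta>)) *\<^sub>R v = (1 - \<mu>) *\<^sub>R v + \<mu> *\<^sub>R (2 *\<^sub>R v)"
    by (metis scaleR_left_distrib scaleR_scaleR)
  have "L x ((1 / (1 - \<delta>)) *\<^sub>R v) \<le> (1 - \<mu>) * L x v + \<mu> * L x (2 *\<^sub>R v)"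
    unfolding comb using convex_onD[OF convex[of x] \<mu>, of v "2 *\<^sub>R v"] by simp
  then have "(1 - \<delta>) * L x ((1 / (1 - \<delta>)) *\<^sub>R v) \<le> (1 - \<delta>) * ((1 - \<mu>) * L x v + \<mu> * L x (2 *\<^sub>R v))"
    using \<delta> by (intro mult_left_mono) auto
  also have "\<dots> = (1 - 2 * \<delta>) * L x v + \<delta> * L x (2 *\<^sub>R v)"
    using \<delta> by (simp add: \<mu>_def divide_simps)
  also have "\<dots> \<le> L x v + \<delta> * L x (2 *\<^sub>R v)"
    using \<delta> nonneg[of x v] by (simp add: algebra_simps)
  finally show ?thesis .
qed

end

text \<open>A finite cover leaves finitely many bounds and radii. The common radius is what the
  velocity bound needs along a whole trajectory.\<close>

lemma locally_bounded_imp_bounded_on_compact: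
  fixes L :: "'a::euclidean_space \<Rightarrow> 'b::real_normed_vector \<Rightarrow> real"
  assumes bdd: "\<forall>x0. \<exists>M>0. \<exists>r>0. \<forall>x\<in>cball x0 r. \<forall>u\<in>cball 0 r. L x u \<le> M" and K: "compact K"
  obtains M r where "M > 0" "r > 0" "\<And>x u. x \<in> K \<Longrightarrow> norm u \<le> r \<Longrightarrow> L x u \<le> M"
proof -
  have "\<forall>x0. \<exists>M r. M > 0 \<and> r > 0 \<and> (\<forall>x\<in>cball x0 r. \<forall>u\<in>cball 0 r. L x u \<le> M)"
    using bdd by blast
  then obtain M r where Mr: "\<And>x0. M x0 > (0::real)" "\<And>x0. r x0 > (0::real)"
    "\<And>x0 x u. x \<in> cball x0 (r x0) \<Longrightarrow> u \<in> cball 0 (r x0) \<Longrightarrow> L x u \<le> M x0"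
    by metis
  obtain D where D: "D \<subseteq> K" "finite D" "K \<subseteq> (\<Union>x\<in>D. ball x (r x))"
  proof (rule compactE_image[OF K])
    show "K \<subseteq> (\<Union>x\<in>K. ball x (r x))" using Mr(2) by force
  qed auto
  show ?thesis
  proof (cases "D = {}")
    case True
    then show ?thesis using D(3) by (intro that[of 1 1]) auto
  next
    case False
    show ?thesis
    proof (rule that[of "Max (M ` D)" "Min (r ` D)"])
      show "Max (M ` D) > 0" "Min (r ` D) > 0" using False D(2) Mr by (auto simp: Max_gr_iff)
      fix x and u :: 'b assume "x \<in> K" and u: "norm u \<le> Min (r ` D)"
      then obtain x0 where x0: "x0 \<in> D" "x \<in> ball x0 (r x0)" using D(3) by blast
      then have "norm u \<le> r x0" using u D(2) by (meson Min_le finite_imageI image_eqI order_trans)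
      then have "L x u \<le> M x0" using x0 by (intro Mr(3)) auto
      also have "\<dots> \<le> Max (M ` D)" using x0 D(2) by simp
      finally show "L x u \<le> Max (M ` D)" .
    qed
  qed
qed

subsection \<open>Translations and difference quotients in \<open>L\<^sup>1\<close>\<close>

lemma integral_translate:
  fixes f :: "real \<Rightarrow> 'a::euclidean_space"
  shows "(LINT s|lborel. f (h + s)) = (LINT s|lborel. f s)"
  using lborel_integral_real_affine[of 1 f h] by simp

lemma integrable_translate:
  fixes f :: "real \<Rightarrow> 'a::euclidean_space"
  shows "integrable lborel f \<Longrightarrow> integrable lborel (\<lambda>s. f (h + s))"
  using lborel_integrable_real_affine[of f 1 h] by simp

text \<open>A compact \<open>C n\<close> inside \<open>U\<close> that misses little measure stays in
  \<open>U\<close> under small shifts. Both indicators are then 1 on \<open>C n\<close>, and off it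
  each contributes at most the missing measure to the integral.\<close>

lemma translate_continuous_open:
  fixes U :: "real set"
  assumes U: "open U" "emeasure lborel U < \<infinity>" and e: "e > 0"
  obtains d where "d > 0"
    "\<And>h. \<bar>h\<bar> < d \<Longrightarrow> (LINT s|lborel. \<bar>indicator U (h + s) - indicator U s :: real\<bar>) < e"
proof -
  obtain C where C: "\<And>n. compact (C n :: real set)" "\<And>n. C n \<subseteq> interior (C (Suc n))" "\<Union>(range C) = U"
    using open_Union_compact_subsets[OF U(1)] by metis
  have CU: "C n \<subseteq> U" for n using C(3) by blast
  have "incseq C" using C(2) interior_subset by (intro incseq_SucI) blast
  then have "(\<lambda>n. measure lborel (C n)) \<longlonglongrightarrow> measure lborel (\<Union>(range C))"
    using U C by (intro Lim_measure_incseq) (auto simp: compact_imp_closed)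
  then have "\<forall>\<^sub>F n in sequentially. measure lborel U - e / 2 < measure lborel (C n)"
    using e by (intro order_tendstoD(1)) (auto simp: C(3))
  then obtain n where n: "measure lborel U - e / 2 < measure lborel (C n)"
    by (auto simp: eventually_sequentially)
  obtain d where d: "d > 0" "(\<Union>x\<in>C n. ball x d) \<subseteq> U"
    using compact_subset_open_imp_ball_epsilon_subset[OF C(1) U(1) CU] by metis
  have iU: "integrable lborel (indicator U :: real \<Rightarrow> real)"
    using U by (intro integrable_real_indicator) auto
  have iC: "integrable lborel (indicator (C n) :: real \<Rightarrow> real)"
    using C emeasure_compact_finite[OF C(1), of n] by (intro integrable_real_indicator) (auto simp: compact_imp_closed)
  show ?thesis
  proof (rule that[OF d(1)])
    fix h :: real assume h: "\<bar>h\<bar> < d"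
    have "(LINT s|lborel. \<bar>indicator U (h + s) - indicator U s :: real\<bar>)
        \<le> (LINT s|lborel. (indicator U (h + s) - indicator (C n) s) + (indicator U s - indicator (C n) s) :: real)"
    proof (rule integral_mono)
      fix s :: real
      have "h + s \<in> U" if "s \<in> C n"
      proof -
        have "h + s \<in> ball s d" using h by (simp add: dist_real_def)
        with d(2) that show ?thesis by blast
      qed
      then show "\<bar>indicator U (h + s) - indicator U s :: real\<bar> \<le>
        (indicator U (h + s) - indicator (C n) s) + (indicator U s - indicator (C n) s)"
        using CU[of n] by (auto simp: indicator_def)
    qed (intro integrable_abs Bochner_Integration.integrable_diff Bochner_Integration.integrable_add
        integrable_translate iU iC)+
    also have "\<dots> = 2 * (measure lborel U - measure lborel (C n))"
      using integral_translate[of "indicator U :: real \<Rightarrow> real" h] integrable_translate[OF iU, of h] iU iC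
      by simp
    also have "\<dots> < e" using n by simp
    finally show "(LINT s|lborel. \<bar>indicator U (h + s) - indicator U s :: real\<bar>) < e" .
  qed
qed

text \<open>Outer regularity: \<open>A\<close> differs from an open set by a set \<open>B\<close>
  with measure below \<open>e / 4\<close>, which enters once shifted and once unshifted.\<close>

lemma translate_continuous_indicator:
  fixes A :: "real set"
  assumes A: "A \<in> sets borel" "emeasure lborel A < \<infinity>" and e: "e > 0"
  obtains d where "d > 0"
    "\<And>h. \<bar>h\<bar> < d \<Longrightarrow> (LINT s|lborel. \<bar>indicator A (h + s) - indicator A s :: real\<bar>) < e"
proof -
  obtain U where U: "open U" "A \<subseteq> U" "(U - A) \<in> lmeasurable" "emeasure lebesgue (U - A) < ennreal (e / 4)"
    using sets_lebesgue_outer_open[of A "e / 4"] A e by auto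
  have mUA: "emeasure lborel (U - A) < ennreal (e / 4)" using U A by simp
  have fB: "emeasure lborel (U - A) < top" using mUA ennreal_less_top by (rule order.strict_trans)
  have fU: "emeasure lborel U < \<infinity>"
  proof -
    have "emeasure lborel U = emeasure lborel A + emeasure lborel (U - A)"
      using U A by (subst plus_emeasure) (auto simp: Un_absorb1)
    also have "\<dots> < \<infinity>" using A fB by simp
    finally show ?thesis .
  qed
  obtain d where d: "d > 0"
    "\<And>h. \<bar>h\<bar> < d \<Longrightarrow> (LINT s|lborel. \<bar>indicator U (h + s) - indicator U s :: real\<bar>) < e / 2"
    using translate_continuous_open[OF U(1) fU, of "e / 2"] e by auto
  define B where "B = U - A"
  have B: "B \<in> sets borel" "emeasure lborel B < \<infinity>"
    using U A fB unfolding B_def by auto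
  have iB: "integrable lborel (indicator B :: real \<Rightarrow> real)" using B by simp
  have iU: "integrable lborel (indicator U :: real \<Rightarrow> real)" using U fU by simp
  have iA: "integrable lborel (indicator A :: real \<Rightarrow> real)" using A by simp
  have mB: "measure lborel B < e / 4"
    using mUA e B(2) by (simp add: emeasure_eq_ennreal_measure ennreal_less_iff flip: B_def)
  show ?thesis
  proof (rule that[OF d(1)])
    fix h :: real assume h: "\<bar>h\<bar> < d"
    have "(LINT s|lborel. \<bar>indicator A (h + s) - indicator A s :: real\<bar>)
        \<le> (LINT s|lborel. \<bar>indicator U (h + s) - indicator U s\<bar> + (indicator B (h + s) + indicator B s) :: real)"
    proof (rule integral_mono)
      fix s :: real
      show "\<bar>indicator A (h + s) - indicator A s :: real\<bar> \<le>
        \<bar>indicator U (h + s) - indicator U s\<bar> + (indicator B (h + s) + indicator B s)"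
        using U(2) by (auto simp: indicator_def B_def)
    qed (intro integrable_abs Bochner_Integration.integrable_diff Bochner_Integration.integrable_add
        integrable_translate iU iB iA)+
    also have "\<dots> = (LINT s|lborel. \<bar>indicator U (h + s) - indicator U s :: real\<bar>) + 2 * measure lborel B"
      using integral_translate[of "indicator B :: real \<Rightarrow> real" h] integrable_translate[OF iB, of h]
        iB iU integrable_translate[OF iU, of h] by simp
    also have "\<dots> < e" using d(2)[OF h] mB by simp
    finally show "(LINT s|lborel. \<bar>indicator A (h + s) - indicator A s :: real\<bar>) < e" .
  qed
qed

text \<open>Translation invariance makes the error of approximating \<open>f\<close> the same before
  and after the shift, so the property passes from indicators to sums and to limits in mean.\<close>

lemma translate_continuous_L1:
  fixes f :: "real \<Rightarrow> 'a::euclidean_space"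
  assumes f: "integrable lborel f"
  shows "\<forall>e>0. \<exists>d>0. \<forall>h. \<bar>h\<bar> < d \<longrightarrow> (LINT s|lborel. norm (f (h + s) - f s)) < e"
  using f
proof (induction rule: integrable_induct)
  case (base A c)
  show ?case
  proof (intro allI impI)
    fix e :: real assume e: "e > 0"
    have "e / (norm c + 1) > 0" using e by (simp add: add_nonneg_pos)
    then obtain d where d: "d > 0"
      "\<And>h. \<bar>h\<bar> < d \<Longrightarrow> (LINT s|lborel. \<bar>indicator A (h + s) - indicator A s :: real\<bar>) < e / (norm c + 1)"
      using translate_continuous_indicator[of A "e / (norm c + 1)"] base by auto
    have "(LINT s|lborel. norm (indicator A (h + s) *\<^sub>R c - indicator A s *\<^sub>R c)) < e" if h: "\<bar>h\<bar> < d" for h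
    proof -
      have "(LINT s|lborel. norm (indicator A (h + s) *\<^sub>R c - indicator A s *\<^sub>R c)) =
        (LINT s|lborel. \<bar>indicator A (h + s) - indicator A s :: real\<bar> * norm c)"
        by (simp flip: scaleR_left_diff_distrib)
      also have "\<dots> = (LINT s|lborel. \<bar>indicator A (h + s) - indicator A s :: real\<bar>) * norm c"
        by simp
      also have "\<dots> \<le> (LINT s|lborel. \<bar>indicator A (h + s) - indicator A s :: real\<bar>) * (norm c + 1)"
        by (intro mult_left_mono integral_nonneg_AE) auto
      also have "\<dots> < e" using d(2)[OF h] by (simp add: pos_less_divide_eq add_nonneg_pos)
      finally show ?thesis .
    qed
    with d(1) show "\<exists>d>0. \<forall>h. \<bar>h\<bar> < d \<longrightarrow> (LINT s|lborel. norm (indicator A (h + s) *\<^sub>R c - indicator A s *\<^sub>R c)) < e"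
      by blast
  qed
next
  case (add f g)
  show ?case
  proof (intro allI impI)
    fix e :: real assume e: "e > 0"
    obtain d1 where d1: "d1 > 0" "\<And>h. \<bar>h\<bar> < d1 \<Longrightarrow> (LINT s|lborel. norm (f (h + s) - f s)) < e / 2"
      using add.IH(1) e half_gt_zero by blast
    obtain d2 where d2: "d2 > 0" "\<And>h. \<bar>h\<bar> < d2 \<Longrightarrow> (LINT s|lborel. norm (g (h + s) - g s)) < e / 2"
      using add.IH(2) e half_gt_zero by blast
    have "(LINT s|lborel. norm (f (h + s) + g (h + s) - (f s + g s))) < e" if h: "\<bar>h\<bar> < min d1 d2" for h
    proof -
      have i: "integrable lborel (\<lambda>s. norm (f (h + s) - f s))" "integrable lborel (\<lambda>s. norm (g (h + s) - g s))"
        by (intro integrable_norm Bochner_Integration.integrable_diff integrable_translate add)+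
      have "(LINT s|lborel. norm (f (h + s) + g (h + s) - (f s + g s))) \<le>
        (LINT s|lborel. norm (f (h + s) - f s) + norm (g (h + s) - g s))"
      proof (rule integral_mono)
        show "integrable lborel (\<lambda>s. norm (f (h + s) + g (h + s) - (f s + g s)))"
          by (intro integrable_norm Bochner_Integration.integrable_diff Bochner_Integration.integrable_add integrable_translate add)
        fix s
        show "norm (f (h + s) + g (h + s) - (f s + g s)) \<le> norm (f (h + s) - f s) + norm (g (h + s) - g s)"
          by (rule norm_diff_triangle_ineq)
      qed (use i in auto)
      also have "\<dots> < e" using d1(2)[of h] d2(2)[of h] h i by simp
      finally show ?thesis .
    qed
    moreover have "min d1 d2 > 0" using d1 d2 by simp
    ultimately show "\<exists>d>0. \<forall>h. \<bar>h\<bar> < d \<longrightarrow> (LINT s|lborel. norm (f (h + s) + g (h + s) - (f s + g s))) < e"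
      by blast
  qed
next
  case (lim f s)
  show ?case
  proof (intro allI impI)
    fix e :: real assume e: "e > 0"
    have "(\<lambda>i. LINT x|lborel. norm (s i x - f x)) \<longlonglongrightarrow> (LINT x::real|lborel. 0)"
    \<comment> \<open>The approximations satisfy \<open>norm (s i x) \<le> 2 * norm (f x)\<close>,
      whence the factor 3.\<close>
    proof (rule integral_dominated_convergence[where w="\<lambda>x. 3 * norm (f x)"])
      show "AE x in lborel. (\<lambda>i. norm (s i x - f x)) \<longlonglongrightarrow> 0"
        using lim.hyps by (auto intro!: AE_I2 tendsto_norm_zero LIM_zero)
      show "AE x in lborel. norm (norm (s i x - f x)) \<le> 3 * norm (f x)" for i
        using lim(3)[of _ i] norm_triangle_ineq4[of "s i _" "f _"]
        by (intro AE_I2) (smt (verit) norm_ge_zero real_norm_def space_lborel UNIV_I)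
    qed (use lim in auto)
    then have "\<forall>\<^sub>F i in sequentially. (LINT x|lborel. norm (s i x - f x)) < e / 3"
      using e by (intro order_tendstoD) auto
    then obtain i where i: "(LINT x|lborel. norm (s i x - f x)) < e / 3"
      by (auto simp: eventually_sequentially)
    obtain d where d: "d > 0" "\<And>h. \<bar>h\<bar> < d \<Longrightarrow> (LINT x|lborel. norm (s i (h + x) - s i x)) < e / 3"
      using lim.IH[of i] divide_pos_pos[OF e zero_less_numeral] by blast
    have "(LINT x|lborel. norm (f (h + x) - f x)) < e" if h: "\<bar>h\<bar> < d" for h
    proof -
      define G where "G x = norm (s i x - f x)" for x
      have iG: "integrable lborel G" unfolding G_def
        by (intro integrable_norm Bochner_Integration.integrable_diff lim)
      have i1: "integrable lborel (\<lambda>x. norm (s i (h + x) - s i x))"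
        by (intro integrable_norm Bochner_Integration.integrable_diff integrable_translate lim)
      have "(LINT x|lborel. norm (f (h + x) - f x)) \<le>
         (LINT x|lborel. G (h + x) + norm (s i (h + x) - s i x) + G x)"
      proof (rule integral_mono)
        show "integrable lborel (\<lambda>x. norm (f (h + x) - f x))"
          by (intro integrable_norm Bochner_Integration.integrable_diff integrable_translate lim)
        show "integrable lborel (\<lambda>x. G (h + x) + norm (s i (h + x) - s i x) + G x)"
          by (intro Bochner_Integration.integrable_add i1 iG integrable_translate)
        fix x
        have "f (h + x) - f x = (f (h + x) - s i (h + x)) + (s i (h + x) - s i x) + (s i x - f x)" by simp
        then have "norm (f (h + x) - f x) \<le> norm (f (h + x) - s i (h + x)) + norm (s i (h + x) - s i x) + norm (s i x - f x)"
          by (metis norm_triangle_ineq norm_triangle_mono order_refl)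
        then show "norm (f (h + x) - f x) \<le> G (h + x) + norm (s i (h + x) - s i x) + G x"
          by (simp add: G_def norm_minus_commute)
      qed
      also have "\<dots> = 2 * (LINT x|lborel. G x) + (LINT x|lborel. norm (s i (h + x) - s i x))"
        using integral_translate[of G h] integrable_translate[OF iG, of h] iG i1 by simp
      also have "\<dots> < e" using i d(2)[OF h] by (simp add: G_def)
      finally show ?thesis .
    qed
    with d(1) show "\<exists>d>0. \<forall>h. \<bar>h\<bar> < d \<longrightarrow> (LINT x|lborel. norm (f (h + x) - f x)) < e" by blast
  qed
qed

text \<open>\<open>L\<^sup>1\<close>-convergence of the difference quotients replaces Lebesgue's differentiation theorem.\<close>

lemma AE_difference_quotient_subseq:
  fixes v :: "real \<Rightarrow> 'a::euclidean_space"
  assumes v: "integrable lborel v" and h: "\<And>n. h n > 0" "h \<longlonglongrightarrow> 0"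
  obtains r :: "nat \<Rightarrow> nat" where "strict_mono r"
    "AE s in lborel. 0 \<le> s \<longrightarrow> (\<lambda>n. (prim v (s + h (r n)) - prim v s) /\<^sub>R h (r n)) \<longlonglongrightarrow> v s"
proof -
  have [measurable]: "v \<in> borel_measurable borel" using v by auto
  \<comment> \<open>The error of the difference quotient, written as an average over shifts of
    \<open>v (\<theta> + s) - v s\<close>.\<close>
  define u where "u n s = (LINT \<theta>:{0<..h n}|lborel. v (\<theta> + s) - v s) /\<^sub>R h n" for n s
  have quot: "(prim v (s + h n) - prim v s) /\<^sub>R h n - v s = u n s" if s: "0 \<le> s" for n s
  proof -
    have "prim v (s + h n) - prim v s = (LINT \<sigma>:{s<..s + h n}|lborel. v \<sigma>)"
      using prim_diff[OF v s, of "s + h n"] h(1)[of n] by simp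
    also have "\<dots> = (LINT \<theta>|lborel. indicator {s<..s + h n} (s + \<theta>) *\<^sub>R v (s + \<theta>))"
      unfolding set_lebesgue_integral_def
      using integral_translate[of "\<lambda>\<sigma>. indicator {s<..s + h n} \<sigma> *\<^sub>R v \<sigma>" s] by simp
    also have "\<dots> = (LINT \<theta>:{0<..h n}|lborel. v (\<theta> + s))"
      unfolding set_lebesgue_integral_def
      by (intro Bochner_Integration.integral_cong) (auto simp: indicator_def add.commute)
    finally have 1: "prim v (s + h n) - prim v s = (LINT \<theta>:{0<..h n}|lborel. v (\<theta> + s))" .
    have i: "set_integrable lborel {0<..h n} (\<lambda>\<theta>. v (\<theta> + s))"
      by (intro set_integrable_of_integrable) (use integrable_translate[OF v, of s] in \<open>auto simp: add.commute\<close>)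
    have "(LINT \<theta>:{0<..h n}|lborel. v (\<theta> + s) - v s) = (LINT \<theta>:{0<..h n}|lborel. v (\<theta> + s)) - h n *\<^sub>R v s"
      using h(1)[of n] i by (subst set_integral_diff) (auto simp: set_integrable_def set_integral_const set_lebesgue_integral_def)
    then show ?thesis using h(1)[of n] by (simp add: u_def 1 scaleR_diff_right)
  qed
  have [measurable]: "u n \<in> borel_measurable borel" for n
    unfolding u_def set_lebesgue_integral_def by measurable
  \<comment> \<open>Minkowski's inequality by Fubini: the norm of an average over shifts is at most
    the largest norm for a single shift, which is small by continuity of translations.\<close>
  have bound: "(\<integral>\<^sup>+s. ennreal (norm (u n s)) \<partial>lborel) \<le> ennreal e"
    if e: "e \<ge> 0" and E: "\<And>\<theta>. 0 < \<theta> \<Longrightarrow> \<theta> \<le> h n \<Longrightarrow> (LINT s|lborel. norm (v (\<theta> + s) - v s)) \<le> e" for e n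
  proof -
    define H where "H \<theta> s = ennreal (indicator {0<..h n} \<theta> * norm (v (\<theta> + s) - v s) / h n)" for \<theta> s
    have [measurable]: "(\<lambda>(\<theta>,s). H \<theta> s) \<in> borel_measurable (lborel \<Otimes>\<^sub>M lborel)"
      unfolding H_def by measurable
    have "(\<integral>\<^sup>+s. ennreal (norm (u n s)) \<partial>lborel) \<le> (\<integral>\<^sup>+s. (\<integral>\<^sup>+\<theta>. H \<theta> s \<partial>lborel) \<partial>lborel)"
    proof (rule nn_integral_mono)
      fix s
      have iv: "integrable lborel (\<lambda>\<theta>. indicator {0<..h n} \<theta> *\<^sub>R (v (\<theta> + s) - v s))"
      proof -
        have "set_integrable lborel {0<..h n} (\<lambda>\<theta>. v (\<theta> + s))"
          by (intro set_integrable_of_integrable) (use integrable_translate[OF v, of s] in \<open>auto simp: add.commute\<close>)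
        then have "set_integrable lborel {0<..h n} (\<lambda>\<theta>. v (\<theta> + s) - v s)"
          using h(1)[of n] by (intro set_integral_diff) (auto simp: set_integrable_def less_imp_le intro!: integrable_scaleR_left integrable_real_indicator)
        then show ?thesis by (simp add: set_integrable_def)
      qed
      have "norm (u n s) \<le> (LINT \<theta>|lborel. indicator {0<..h n} \<theta> * norm (v (\<theta> + s) - v s)) / h n"
        using integral_norm_bound[of lborel "\<lambda>\<theta>. indicator {0<..h n} \<theta> *\<^sub>R (v (\<theta> + s) - v s)"] h(1)[of n]
        by (simp add: u_def set_lebesgue_integral_def divide_right_mono divide_inverse_commute)
      also have "\<dots> = (LINT \<theta>|lborel. indicator {0<..h n} \<theta> * norm (v (\<theta> + s) - v s) / h n)"
        by simp
      finally have "ennreal (norm (u n s)) \<le> ennreal (LINT \<theta>|lborel. indicator {0<..h n} \<theta> * norm (v (\<theta> + s) - v s) / h n)"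
        by (rule ennreal_leI)
      also have "\<dots> = (\<integral>\<^sup>+\<theta>. H \<theta> s \<partial>lborel)"
        unfolding H_def using integrable_norm[OF iv] h(1)[of n]
        by (intro nn_integral_eq_integral[symmetric]) auto
      finally show "ennreal (norm (u n s)) \<le> (\<integral>\<^sup>+\<theta>. H \<theta> s \<partial>lborel)" .
    qed
    also have "\<dots> = (\<integral>\<^sup>+\<theta>. (\<integral>\<^sup>+s. H \<theta> s \<partial>lborel) \<partial>lborel)"
      by (rule lborel_pair.Fubini') measurable
    also have "\<dots> \<le> (\<integral>\<^sup>+\<theta>. ennreal (e / h n) * indicator {0<..h n} \<theta> \<partial>lborel)"
    proof (rule nn_integral_mono)
      fix \<theta> :: real
      show "(\<integral>\<^sup>+s. H \<theta> s \<partial>lborel) \<le> ennreal (e / h n) * indicator {0<..h n} \<theta>"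
      proof (cases "\<theta> \<in> {0<..h n}")
        case True
        have "(\<integral>\<^sup>+s. H \<theta> s \<partial>lborel) = ennreal (LINT s|lborel. norm (v (\<theta> + s) - v s) / h n)"
          unfolding H_def using True h(1)[of n]
          by (subst nn_integral_eq_integral[symmetric])
             (auto intro!: integrable_norm Bochner_Integration.integrable_diff integrable_translate v)
        also have "\<dots> \<le> ennreal (e / h n)"
          using E[of \<theta>] True h(1)[of n] by (intro ennreal_leI) (simp add: divide_right_mono)
        finally show ?thesis using True by simp
      qed (simp add: H_def)
    qed
    also have "\<dots> = ennreal e"
      using h(1)[of n] e by (simp add: nn_integral_cmult_indicator flip: ennreal_mult)
    finally show ?thesis .
  qed
  have ui: "integrable lborel (u n)" for n
  proof (rule integrableI_bounded)
    have "(LINT s|lborel. norm (v (\<theta> + s) - v s)) \<le> 2 * (LINT s|lborel. norm (v s))" for \<theta>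
    proof -
      have "(LINT s|lborel. norm (v (\<theta> + s) - v s)) \<le> (LINT s|lborel. norm (v (\<theta> + s)) + norm (v s))"
        by (intro integral_mono norm_triangle_ineq4 integrable_norm Bochner_Integration.integrable_diff
            Bochner_Integration.integrable_add integrable_translate v)
      also have "\<dots> = 2 * (LINT s|lborel. norm (v s))"
        using integral_translate[of "\<lambda>s. norm (v s)" \<theta>] integrable_translate[OF v, of \<theta>] v by simp
      finally show ?thesis .
    qed
    then have "(\<integral>\<^sup>+s. ennreal (norm (u n s)) \<partial>lborel) \<le> ennreal (2 * (LINT s|lborel. norm (v s)))"
      by (intro bound) auto
    then show "(\<integral>\<^sup>+s. ennreal (norm (u n s)) \<partial>lborel) < \<infinity>"
      using ennreal_less_top le_less_trans by (metis infinity_ennreal_def)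
  qed simp
  have "(\<lambda>n. LINT s|lborel. norm (u n s)) \<longlonglongrightarrow> 0"
  proof (rule order_tendstoI)
    fix a :: real assume "a < 0"
    then show "\<forall>\<^sub>F n in sequentially. a < (LINT s|lborel. norm (u n s))"
      by (intro always_eventually allI less_le_trans[OF _ integral_nonneg_AE]) auto
  next
    fix a :: real assume a: "0 < a"
    obtain d where d: "d > 0" "\<And>\<theta>. \<bar>\<theta>\<bar> < d \<Longrightarrow> (LINT s|lborel. norm (v (\<theta> + s) - v s)) < a / 2"
      using translate_continuous_L1[OF v] a half_gt_zero by blast
    have "\<forall>\<^sub>F n in sequentially. h n < d" using h(2) d(1) by (rule order_tendstoD)
    then show "\<forall>\<^sub>F n in sequentially. (LINT s|lborel. norm (u n s)) < a"
    proof eventually_elim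
      case (elim n)
      have "(\<integral>\<^sup>+s. ennreal (norm (u n s)) \<partial>lborel) \<le> ennreal (a / 2)"
        using a elim by (intro bound less_imp_le d(2)) auto
      moreover have "(\<integral>\<^sup>+s. ennreal (norm (u n s)) \<partial>lborel) = ennreal (LINT s|lborel. norm (u n s))"
        using ui[of n] by (intro nn_integral_eq_integral) auto
      ultimately show ?case using a by (simp add: ennreal_le_iff)
    qed
  qed
  \<comment> \<open>Convergence in mean gives convergence almost everywhere only along a
    subsequence; this suffices, as the window lengths are free to choose.\<close>
  from tendsto_L1_AE_subseq[OF ui this] obtain r where
    r: "strict_mono r" "AE s in lborel. (\<lambda>n. u (r n) s) \<longlonglongrightarrow> 0" by auto
  show ?thesis
  proof (rule that[OF r(1)])
    show "AE s in lborel. 0 \<le> s \<longrightarrow> (\<lambda>n. (prim v (s + h (r n)) - prim v s) /\<^sub>R h (r n)) \<longlonglongrightarrow> v s"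
      using r(2)
    proof (eventually_elim, intro impI)
      fix s :: real assume s: "(\<lambda>n. u (r n) s) \<longlonglongrightarrow> 0" "0 \<le> s"
      then have "(\<lambda>n. (prim v (s + h (r n)) - prim v s) /\<^sub>R h (r n) - v s) \<longlonglongrightarrow> 0"
        by (simp add: quot)
      then show "(\<lambda>n. (prim v (s + h (r n)) - prim v s) /\<^sub>R h (r n)) \<longlonglongrightarrow> v s"
        by (rule LIM_zero_cancel)
    qed
  qed
qed

subsection \<open>Weak compactness\<close>

text \<open>The epsilon-delta form of equi-integrability. On intervals it is equicontinuity of the
  primitives, and on small open sets it controls limit measures; bounds in mean are stated
  separately.\<close>

definition uniformly_integrable :: "('i \<Rightarrow> real \<Rightarrow> 'a::euclidean_space) \<Rightarrow> bool" where
  "uniformly_integrable w \<longleftrightarrow> (\<forall>i. integrable lborel (w i)) \<and>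
     (\<forall>e>0. \<exists>d>0. \<forall>i. \<forall>A\<in>sets borel. emeasure lborel A < ennreal d \<longrightarrow>
        (LINT s:A|lborel. norm (w i s)) \<le> e)"

lemma uniformly_integrable_dominated:
  fixes w :: "'i \<Rightarrow> real \<Rightarrow> 'a::euclidean_space" and p :: "'i \<Rightarrow> real \<Rightarrow> 'b::euclidean_space"
  assumes w: "uniformly_integrable w" and p: "\<And>i. p i \<in> borel_measurable borel"
    and le: "\<And>i s. norm (p i s) \<le> c * norm (w i s)"
  shows "uniformly_integrable p"
  unfolding uniformly_integrable_def
proof (intro conjI allI impI)
  have int_w: "integrable lborel (w i)" for i using w by (simp add: uniformly_integrable_def)
  have le': "norm (p i s) \<le> norm (\<bar>c\<bar> * norm (w i s))" for i s
    using le[of i s] mult_right_mono[OF abs_ge_self, of "norm (w i s)" c] by (simp add: abs_mult)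
  show int_p: "integrable lborel (p i)" for i
    by (rule Bochner_Integration.integrable_bound[of _ "\<lambda>s. \<bar>c\<bar> * norm (w i s)"])
       (use int_w p le' in auto)
  fix e :: real assume e: "e > 0"
  \<comment> \<open>The bound \<open>c\<close> may be 0 or negative, hence
    \<open>\<bar>c\<bar> + 1\<close> as divisor.\<close>
  have "e / (\<bar>c\<bar> + 1) > 0" using e by (simp add: add_nonneg_pos)
  then obtain d where d: "d > 0" "\<And>i A. A \<in> sets borel \<Longrightarrow> emeasure lborel A < ennreal d \<Longrightarrow>
      (LINT s:A|lborel. norm (w i s)) \<le> e / (\<bar>c\<bar> + 1)"
    using w unfolding uniformly_integrable_def by meson
  have "(LINT s:A|lborel. norm (p i s)) \<le> e" if A: "A \<in> sets borel" "emeasure lborel A < ennreal d" for i A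
  proof -
    have "(LINT s:A|lborel. norm (p i s)) \<le> (LINT s:A|lborel. (\<bar>c\<bar> + 1) * norm (w i s))"
    proof (rule set_integral_mono)
      show "set_integrable lborel A (\<lambda>s. norm (p i s))" "set_integrable lborel A (\<lambda>s. (\<bar>c\<bar> + 1) * norm (w i s))"
        by (intro set_integrable_of_integrable integrable_norm integrable_mult_right int_p int_w A)+
      fix s show "norm (p i s) \<le> (\<bar>c\<bar> + 1) * norm (w i s)"
        using le'[of i s] by (simp add: abs_mult distrib_right add_increasing2)
    qed
    also have "\<dots> = (\<bar>c\<bar> + 1) * (LINT s:A|lborel. norm (w i s))"
      by (rule set_integral_mult_right)
    also have "\<dots> \<le> (\<bar>c\<bar> + 1) * (e / (\<bar>c\<bar> + 1))"
      by (intro mult_left_mono d A) auto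
    also have "\<dots> = e" by (simp add: add_nonneg_eq_0_iff)
    finally show ?thesis .
  qed
  with d(1) show "\<exists>d>0. \<forall>i. \<forall>A\<in>sets borel. emeasure lborel A < ennreal d \<longrightarrow>
        (LINT s:A|lborel. norm (p i s)) \<le> e" by blast
qed

text \<open>Inclusion-exclusion for one more interval. Its intersection with the union of the first
  \<open>n\<close> is again a union of \<open>n\<close> half-open intervals, possibly empty ones, so
  the induction must leave the endpoints arbitrary.\<close>

lemma tendsto_measure_UN_Ioc:
  fixes \<mu> :: "real measure" and p :: "nat \<Rightarrow> real \<Rightarrow> real" and n :: nat
  assumes \<mu>: "finite_measure \<mu>" "sets \<mu> = sets borel"
    and p: "\<And>k. integrable lborel (p k)"
    and lim: "\<And>a b. a \<le> b \<Longrightarrow> (\<lambda>k. LINT s:{a<..b}|lborel. p k s) \<longlonglongrightarrow> measure \<mu> {a<..b}"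
  shows "(\<lambda>k. LINT s:(\<Union>i<n. {a i<..b i})|lborel. p k s) \<longlonglongrightarrow> measure \<mu> (\<Union>i<n. {a i<..b i})"
proof (induction n arbitrary: a b)
  case 0
  then show ?case by (simp add: set_lebesgue_integral_def)
next
  case (Suc n)
  interpret finite_measure \<mu> by fact
  have lim': "(\<lambda>k. LINT s:{a<..b}|lborel. p k s) \<longlonglongrightarrow> measure \<mu> {a<..b}" for a b
    using lim[of a b] by (cases "a \<le> b") (auto simp: set_lebesgue_integral_def)
  define A where "A = (\<Union>i<n. {a i<..b i})"
  define B where "B = {a n<..b n}"
  have [measurable]: "A \<in> sets borel" "B \<in> sets borel" by (auto simp: A_def B_def)
  have AB: "A \<inter> B = (\<Union>i<n. {max (a i) (a n)<..min (b i) (b n)})"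
    by (auto simp: A_def B_def)
  have eq: "(LINT s:A \<union> B|lborel. p k s) =
     (LINT s:A|lborel. p k s) + (LINT s:B|lborel. p k s) - (LINT s:A \<inter> B|lborel. p k s)" for k
  proof -
    have i: "integrable lborel (\<lambda>s. indicator C s *\<^sub>R p k s)" if "C \<in> sets borel" for C
      using that p by (intro integrable_mult_indicator) auto
    have "(LINT s|lborel. indicator (A \<union> B) s *\<^sub>R p k s) = (LINT s|lborel. indicator A s *\<^sub>R p k s + indicator B s *\<^sub>R p k s - indicator (A \<inter> B) s *\<^sub>R p k s)"
      by (intro Bochner_Integration.integral_cong) (auto simp: indicator_def)
    also have "\<dots> = (LINT s|lborel. indicator A s *\<^sub>R p k s) + (LINT s|lborel. indicator B s *\<^sub>R p k s) - (LINT s|lborel. indicator (A \<inter> B) s *\<^sub>R p k s)"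
      by (subst Bochner_Integration.integral_diff, intro Bochner_Integration.integrable_add i, simp, simp, intro i, simp,
          subst Bochner_Integration.integral_add, intro i, simp, intro i, simp, rule refl)
    finally show ?thesis by (simp add: set_lebesgue_integral_def)
  qed
  have "(\<lambda>k. LINT s:A \<union> B|lborel. p k s) \<longlonglongrightarrow> measure \<mu> A + measure \<mu> B - measure \<mu> (A \<inter> B)"
    unfolding eq
  proof (intro tendsto_intros)
    show "(\<lambda>k. LINT s:A|lborel. p k s) \<longlonglongrightarrow> measure \<mu> A" unfolding A_def by (rule Suc.IH)
    show "(\<lambda>k. LINT s:B|lborel. p k s) \<longlonglongrightarrow> measure \<mu> B" unfolding B_def by (rule lim')
    show "(\<lambda>k. LINT s:A \<inter> B|lborel. p k s) \<longlonglongrightarrow> measure \<mu> (A \<inter> B)" unfolding AB by (rule Suc.IH)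
  qed
  also have "measure \<mu> A + measure \<mu> B - measure \<mu> (A \<inter> B) = measure \<mu> (A \<union> B)"
  proof -
    have "measure \<mu> (A \<union> B) = measure \<mu> A + measure \<mu> (B - A)"
      by (rule finite_measure_Union') (simp_all add: \<mu>(2))
    moreover have "measure \<mu> (B - A) = measure \<mu> B - measure \<mu> (B \<inter> A)"
      by (rule finite_measure_Diff') (simp_all add: \<mu>(2))
    ultimately show ?thesis by (simp add: Int_commute)
  qed
  also have "A \<union> B = (\<Union>i<Suc n. {a i<..b i})" by (auto simp: A_def B_def lessThan_Suc)
  finally show ?case .
qed

text \<open>Convergence is known on finite unions of intervals only. By inner regularity a null set
  may be replaced by a compact one, which such a union covers inside an open set of small measure;
  there the uniform bound \<open>e\<close> survives the limit.\<close>

lemma absolutely_continuous_weak_limit: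
  fixes \<mu> :: "real measure" and p :: "nat \<Rightarrow> real \<Rightarrow> real"
  assumes \<mu>: "finite_measure \<mu>" "sets \<mu> = sets borel"
    and p: "uniformly_integrable p"
    and lim: "\<And>a b. a \<le> b \<Longrightarrow> (\<lambda>k. LINT s:{a<..b}|lborel. p k s) \<longlonglongrightarrow> measure \<mu> {a<..b}"
  shows "absolutely_continuous lborel \<mu>"
  unfolding absolutely_continuous_def
proof
  interpret finite_measure \<mu> by fact
  have ip: "integrable lborel (p k)" for k using p by (simp add: uniformly_integrable_def)
  fix N assume "N \<in> null_sets (lborel :: real measure)"
  then have N: "N \<in> sets borel" "emeasure lborel N = 0" by auto
  have compact_null: "emeasure \<mu> K = 0" if K: "compact K" "K \<subseteq> N" for K
  proof -
    have KB: "K \<in> sets borel" using K by (simp add: compact_imp_closed)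
    have "measure \<mu> K \<le> e" if e: "e > 0" for e
    proof -
      obtain d where d: "d > 0" "\<And>k A. A \<in> sets borel \<Longrightarrow> emeasure lborel A < ennreal d \<Longrightarrow>
          (LINT s:A|lborel. norm (p k s)) \<le> e"
        using p e unfolding uniformly_integrable_def by meson
      have K0: "emeasure lborel K = 0" using emeasure_mono[OF K(2), of lborel] N by simp
      obtain U where U: "open U" "K \<subseteq> U" "(U - K) \<in> lmeasurable" "emeasure lebesgue (U - K) < ennreal d"
        using sets_lebesgue_outer_open[of K d] KB d(1) by auto
      have "emeasure lborel U = emeasure lborel K + emeasure lborel (U - K)"
        using U KB by (subst plus_emeasure) (auto simp: Un_absorb1)
      then have mU: "emeasure lborel U < ennreal d" using K0 U KB by simp
      \<comment> \<open>The doubled radius keeps the closed right ends of the covering intervals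
        inside \<open>U\<close>.\<close>
      have "\<forall>x\<in>K. \<exists>r>0. ball x (2 * r) \<subseteq> U"
      proof
        fix x assume "x \<in> K"
        then obtain r where "r > 0" "ball x r \<subseteq> U" using U open_contains_ball by blast
        then show "\<exists>r>0. ball x (2 * r) \<subseteq> U" by (intro exI[of _ "r / 2"]) auto
      qed
      then obtain r where r: "\<And>x. x \<in> K \<Longrightarrow> r x > 0" "\<And>x. x \<in> K \<Longrightarrow> ball x (2 * r x) \<subseteq> U"
        by metis
      obtain D where D: "D \<subseteq> K" "finite D" "K \<subseteq> (\<Union>x\<in>D. ball x (r x))"
      proof (rule compactE_image[OF K(1)])
        show "K \<subseteq> (\<Union>x\<in>K. ball x (r x))" using r(1) by force
      qed auto
      obtain c where c: "bij_betw c {..<card D} D"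
        using ex_bij_betw_nat_finite[OF D(2)] by (auto simp: atLeast0LessThan)
      define B where "B = (\<Union>i<card D. {c i - r (c i)<..c i + r (c i)})"
      have B_eq: "B = (\<Union>x\<in>D. {x - r x<..x + r x})"
      proof -
        have "B = (\<Union>x\<in>c ` {..<card D}. {x - r x<..x + r x})" by (simp add: B_def)
        then show ?thesis using bij_betw_imp_surj_on[OF c] by simp
      qed
      have "ball x (r x) \<subseteq> {x - r x<..x + r x}" for x by (auto simp: dist_real_def)
      then have KB': "K \<subseteq> B" using D(3) unfolding B_eq by blast
      have "{x - r x<..x + r x} \<subseteq> ball x (2 * r x)" if "x \<in> K" for x
        using r(1)[OF that] by (auto simp: dist_real_def)
      then have BU: "B \<subseteq> U" using r(2) D(1) unfolding B_eq by blast
      have [measurable]: "B \<in> sets borel" by (simp add: B_def)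
      have mB: "emeasure lborel B < ennreal d"
        using emeasure_mono[OF BU, of lborel] U(1) mU by simp
      have "(\<lambda>k. LINT s:B|lborel. p k s) \<longlonglongrightarrow> measure \<mu> B"
        unfolding B_def by (rule tendsto_measure_UN_Ioc[OF \<mu> ip lim])
      moreover have "(LINT s:B|lborel. p k s) \<le> e" for k
      proof -
        have "(LINT s:B|lborel. p k s) \<le> (LINT s:B|lborel. norm (p k s))"
          by (intro set_integral_mono set_integrable_of_integrable integrable_norm ip) auto
        also have "\<dots> \<le> e" by (rule d(2)) (use mB in auto)
        finally show ?thesis .
      qed
      ultimately have "measure \<mu> B \<le> e" by (intro LIMSEQ_le_const2) auto
      moreover have "measure \<mu> K \<le> measure \<mu> B"
        using KB' \<mu>(2) by (intro finite_measure_mono) auto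
      ultimately show ?thesis by simp
    qed
    then have "measure \<mu> K \<le> 0" by (rule field_le_epsilon[of _ 0, simplified])
    then show ?thesis by (simp add: emeasure_eq_measure measure_le_0_iff)
  qed
  have "emeasure \<mu> N = (SUP K \<in> {K. K \<subseteq> N \<and> compact K}. emeasure \<mu> K)"
    by (rule inner_regular) (use \<mu> N in auto)
  also have "\<dots> \<le> 0" using compact_null by (intro SUP_least) auto
  finally have "emeasure \<mu> N = 0" by simp
  then show "N \<in> null_sets \<mu>" using N \<mu>(2) by auto
qed

text \<open>Nonnegativity makes the limit \<open>F\<close> increasing, hence the distribution
  function of a measure; its density with respect to Lebesgue measure is the velocity
  sought.\<close>

lemma limit_of_nonneg_prims:
  fixes p :: "nat \<Rightarrow> real \<Rightarrow> real"
  assumes p: "uniformly_integrable p" and nn: "\<And>k s. 0 \<le> p k s" and T: "0 \<le> T"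
    and lim: "\<And>s. s \<in> {0..T} \<Longrightarrow> (\<lambda>k. prim (p k) s) \<longlonglongrightarrow> F s"
    and F: "continuous_on {0..T} F"
  obtains f where "integrable lborel f" "\<And>s. s \<in> {0..T} \<Longrightarrow> F s = prim f s"
proof -
  have ip: "integrable lborel (p k)" for k using p by (simp add: uniformly_integrable_def)
  \<comment> \<open>Freezing \<open>F\<close> outside \<open>[0,T]\<close> gives a continuous
    increasing function on the line, as the Stieltjes measure requires, with finite total
    mass.\<close>
  define cl where "cl s = max 0 (min T s)" for s
  have cl: "cl s \<in> {0..T}" for s using T by (auto simp: cl_def)
  define G where "G s = F (cl s)" for s
  define q where "q k s = indicator {0<..T} s * p k s" for k s
  have iq: "integrable lborel (q k)" for k
    unfolding q_def using integrable_mult_indicator[OF _ ip[of k], of "{0<..T}"] by simp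
  have F0: "F 0 = 0" using LIMSEQ_unique[OF lim[of 0], of 0] T by simp
  have qint: "(LINT s:{a<..b}|lborel. q k s) = prim (p k) (cl b) - prim (p k) (cl a)" if "a \<le> b" for a b k
  proof -
    have ab: "cl a \<le> cl b" using that by (auto simp: cl_def)
    have "prim (p k) (cl b) - prim (p k) (cl a) = (LINT s:{cl a<..cl b}|lborel. p k s)"
      using cl[of a] ab by (intro prim_diff ip) auto
    also have "\<dots> = (LINT s:{a<..b}|lborel. q k s)"
      unfolding set_lebesgue_integral_def q_def
      by (intro Bochner_Integration.integral_cong) (auto simp: indicator_def cl_def)
    finally show ?thesis by simp
  qed
  have limq: "(\<lambda>k. LINT s:{a<..b}|lborel. q k s) \<longlonglongrightarrow> G b - G a" if "a \<le> b" for a b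
    unfolding qint[OF that] G_def by (intro tendsto_intros lim cl)
  have mono: "G a \<le> G b" if "a \<le> b" for a b
  proof -
    have "0 \<le> G b - G a"
    proof (rule LIMSEQ_le_const[OF limq[OF that]], intro exI allI impI)
      fix k show "0 \<le> (LINT s:{a<..b}|lborel. q k s)"
        unfolding set_lebesgue_integral_def q_def by (intro integral_nonneg_AE) (use nn in auto)
    qed
    then show ?thesis by simp
  qed
  have contG: "continuous_on UNIV G" unfolding G_def
    by (rule continuous_on_compose2[OF F]) (use cl in \<open>auto simp: cl_def intro!: continuous_intros\<close>)
  then have rc: "continuous (at_right a) G" for a
    by (meson UNIV_I continuous_at_imp_continuous_within continuous_on_eq_continuous_at open_UNIV)
  define \<mu> where "\<mu> = interval_measure G"
  have sets: "sets \<mu> = sets borel" by (simp add: \<mu>_def)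
  have Ioc: "emeasure \<mu> {a<..b} = ennreal (G b - G a)" if "a \<le> b" for a b
    unfolding \<mu>_def by (rule emeasure_interval_measure_Ioc[OF that mono rc])
  have fin: "emeasure \<mu> UNIV \<le> ennreal (G T - G 0)"
  proof -
    have U: "(\<Union>n::nat. {- real n<..real n}) = UNIV"
    proof -
      have "\<exists>n::nat. - real n < x \<and> x \<le> real n" for x
        using reals_Archimedean2[of "\<bar>x\<bar>"] by (auto simp: abs_less_iff intro!: less_imp_le) (metis abs_less_iff less_imp_le minus_less_iff)
      then show ?thesis by (auto simp: set_eq_iff)
    qed
    have "emeasure \<mu> UNIV = (SUP n::nat. emeasure \<mu> {- real n<..real n})"
      unfolding U[symmetric] by (rule SUP_emeasure_incseq[symmetric]) (auto simp: sets incseq_def)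
    also have "\<dots> \<le> ennreal (G T - G 0)"
    proof (rule SUP_least)
      fix n :: nat
      have "G (real n) \<le> G T" unfolding G_def cl_def using mono[of "min T (real n)" T] T
        by (simp add: G_def cl_def)
      moreover have "G (- real n) = G 0" using T by (simp add: G_def cl_def)
      ultimately show "emeasure \<mu> {- real n<..real n} \<le> ennreal (G T - G 0)"
        by (subst Ioc) (auto intro!: ennreal_leI)
    qed
    finally show ?thesis .
  qed
  have \<mu>: "finite_measure \<mu>"
    by (rule finite_measureI) (use fin in \<open>auto simp: \<mu>_def top_unique\<close>)
  interpret finite_measure \<mu> by fact
  have mIoc: "measure \<mu> {a<..b} = G b - G a" if "a \<le> b" for a b
    using Ioc[OF that] mono[OF that] by (simp add: measure_def)
  have "uniformly_integrable q"
    by (rule uniformly_integrable_dominated[OF p, of _ 1]) (use iq in \<open>auto simp: q_def indicator_def\<close>)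
  then have "absolutely_continuous lborel \<mu>"
    using limq mIoc by (intro absolutely_continuous_weak_limit[OF \<mu> sets]) auto
  then obtain f0 where f0: "f0 \<in> borel_measurable lborel" "density lborel f0 = \<mu>"
    using sigma_finite_measure.Radon_Nikodym[OF sigma_finite_lborel] sets by fastforce
  have f0_int: "(\<integral>\<^sup>+s. f0 s \<partial>lborel) < \<infinity>"
  proof -
    have "(\<integral>\<^sup>+s. f0 s \<partial>lborel) = emeasure \<mu> UNIV"
      unfolding f0(2)[symmetric] using f0(1) by (simp add: emeasure_density)
    then show ?thesis using fin by (simp add: le_less_trans)
  qed
  \<comment> \<open>The density has a finite integral, so it is finite almost everywhere and may be
    replaced by a real function.\<close>
  then have AE: "AE s in lborel. f0 s = ennreal (enn2real (f0 s))"
    using nn_integral_noteq_infinite[of f0 lborel] f0(1) by (auto simp: ennreal_enn2real_if)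
  define f where "f s = enn2real (f0 s)" for s
  have [measurable]: "f \<in> borel_measurable borel" unfolding f_def using f0(1) by simp
  have int_f: "integrable lborel f"
  proof (rule integrableI_bounded)
    have "(\<integral>\<^sup>+s. ennreal (norm (f s)) \<partial>lborel) = (\<integral>\<^sup>+s. f0 s \<partial>lborel)"
      using AE by (intro nn_integral_cong_AE) (auto simp: f_def)
    then show "(\<integral>\<^sup>+s. ennreal (norm (f s)) \<partial>lborel) < \<infinity>" using f0_int by simp
  qed simp
  show ?thesis
  proof (rule that[OF int_f])
    fix s assume s: "s \<in> {0..T}"
    have "ennreal (G s - G 0) = (\<integral>\<^sup>+\<sigma>\<in>{0<..s}. f0 \<sigma> \<partial>lborel)"
      using Ioc[of 0 s] s f0(1) unfolding f0(2)[symmetric] by (simp add: emeasure_density)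
    also have "\<dots> = (\<integral>\<^sup>+\<sigma>. ennreal (indicator {0<..s} \<sigma> * f \<sigma>) \<partial>lborel)"
      using AE by (intro nn_integral_cong_AE, eventually_elim) (auto simp: f_def indicator_def)
    also have "\<dots> = ennreal (LINT \<sigma>:{0<..s}|lborel. f \<sigma>)"
      unfolding set_lebesgue_integral_def
      using set_integrable_of_integrable[OF int_f, of "{0<..s}"]
      by (subst nn_integral_eq_integral) (auto simp: set_integrable_def f_def)
    also have "(LINT \<sigma>:{0<..s}|lborel. f \<sigma>) = prim f s"
      using prim_diff[OF int_f, of 0 s] s by simp
    finally have "ennreal (G s - G 0) = ennreal (prim f s)" .
    moreover have "prim f s \<ge> 0"
      unfolding prim_def set_lebesgue_integral_def by (intro integral_nonneg_AE) (auto simp: f_def)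
    moreover have "G 0 \<le> G s" using s by (intro mono) auto
    ultimately have "G s - G 0 = prim f s" by simp
    then show "F s = prim f s" using s F0 T by (simp add: G_def cl_def)
  qed
qed

lemma prim_add:
  "integrable lborel f \<Longrightarrow> integrable lborel g \<Longrightarrow> prim (\<lambda>s. f s + g s) t = prim f t + prim g t"
  unfolding prim_def by (intro set_integral_add set_integrable_of_integrable) auto

lemma prim_diff_fun:
  "integrable lborel f \<Longrightarrow> integrable lborel g \<Longrightarrow> prim (\<lambda>s. f s - g s) t = prim f t - prim g t"
  unfolding prim_def by (intro set_integral_diff set_integrable_of_integrable) auto

lemma prim_inner:
  assumes "integrable lborel f" shows "prim (\<lambda>s. f s \<bullet> b) t = prim f t \<bullet> b"
  using set_integrable_of_integrable[OF assms, of "{0..t}"]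
  unfolding prim_def set_lebesgue_integral_def set_integrable_def
  by (subst integral_inner_left[symmetric]) auto

lemma prim_scaleR_left:
  assumes "integrable lborel f" shows "prim (\<lambda>s. f s *\<^sub>R b) t = prim f t *\<^sub>R b"
  using set_integrable_of_integrable[OF assms, of "{0..t}"]
  unfolding prim_def set_lebesgue_integral_def set_integrable_def
  by (subst integral_scaleR_left[symmetric]) auto

lemma prim_sum:
  assumes "\<And>i. i \<in> I \<Longrightarrow> integrable lborel (f i)"
  shows "prim (\<lambda>s. \<Sum>i\<in>I. f i s) t = (\<Sum>i\<in>I. prim (f i) t)"
  using set_integrable_of_integrable[OF assms, of _ "{0..t}"]
  unfolding prim_def set_lebesgue_integral_def set_integrable_def
  by (simp add: scaleR_sum_right Bochner_Integration.integral_sum)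

lemma norm_prim_le:
  assumes "integrable lborel f" shows "norm (prim f t) \<le> (LINT s|lborel. norm (f s))"
proof -
  have "norm (prim f t) \<le> (LINT s:{0..t}|lborel. norm (f s))"
    unfolding prim_def by (intro set_integral_norm_bound set_integrable_of_integrable assms) auto
  also have "\<dots> \<le> (LINT s|lborel. norm (f s))"
    unfolding set_lebesgue_integral_def
    using assms by (intro integral_mono integrable_mult_indicator) (auto simp: indicator_def)
  finally show ?thesis .
qed

text \<open>The functions \<open>prim |w| + prim w \<bullet> b\<close> are increasing in time, so their limits are distribution
  functions of measures, to which the Radon-Nikodym theorem applies.\<close>

lemma uniformly_integrable_imp_convergent_subseq:
  fixes w :: "nat \<Rightarrow> real \<Rightarrow> 'a::euclidean_space"
  assumes w: "uniformly_integrable w" and C: "\<And>k. (LINT s|lborel. norm (w k s)) \<le> C" and T: "0 \<le> T"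
  obtains r v where "strict_mono r" "integrable lborel v"
    "uniform_limit {0..T} (\<lambda>n. prim (w (r n))) (prim v) sequentially"
proof -
  have iw: "integrable lborel (w k)" for k using w by (simp add: uniformly_integrable_def)
  define nw where "nw k s = norm (w k s)" for k s
  have inw: "integrable lborel (nw k)" for k unfolding nw_def using iw by (rule integrable_norm)
  \<comment> \<open>Carrying the accumulated length \<open>prim (nw k)\<close> next to the path lets
    one application of Arzela-Ascoli produce a subsequence for both.\<close>
  define \<F> where "\<F> k s = (prim (w k) s, prim (nw k) s)" for k s
  have inc: "norm (\<F> k b - \<F> k a) \<le> 2 * (LINT s:{a<..b}|lborel. nw k s)" if "0 \<le> a" "a \<le> b" for k a b
  proof -
    have "norm (\<F> k b - \<F> k a) \<le> norm (prim (w k) b - prim (w k) a) + norm (prim (nw k) b - prim (nw k) a)"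
      unfolding \<F>_def diff_Pair by (rule norm_Pair_le)
    then show ?thesis
      using norm_prim_diff_le[OF iw that, of k] norm_prim_diff_le[OF inw that, of k] by (simp add: nw_def)
  qed
  obtain g r where g: "continuous_on {0..T} g" and r: "strict_mono (r :: nat \<Rightarrow> nat)"
    and unif: "\<And>e. 0 < e \<Longrightarrow> \<exists>N. \<forall>n x. n \<ge> N \<and> x \<in> {0..T} \<longrightarrow> norm (\<F> (r n) x - g x) < e"
  proof (rule Arzela_Ascoli[of "{0..T}" \<F> "2 * C"])
    show "norm (\<F> n x) \<le> 2 * C" for n x
    proof -
      have "norm (\<F> n x) \<le> norm (prim (w n) x) + norm (prim (nw n) x)"
        unfolding \<F>_def by (rule norm_Pair_le)
      also have "\<dots> \<le> 2 * C"
        using norm_prim_le[OF iw, of n x] norm_prim_le[OF inw, of n x] C[of n] by (simp add: nw_def)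
      finally show ?thesis .
    qed
    fix x e :: real assume x: "x \<in> {0..T}" and e: "0 < e"
    then have "e / 4 > 0" by simp
    then obtain d where d: "d > 0" "\<And>i A. A \<in> sets borel \<Longrightarrow> emeasure lborel A < ennreal d \<Longrightarrow>
        (LINT s:A|lborel. nw i s) \<le> e / 4"
      using w unfolding uniformly_integrable_def nw_def by meson
    \<comment> \<open>Equicontinuity: short intervals have small measure, so uniform integrability
      bounds the increments.\<close>
    have *: "norm (\<F> n b - \<F> n a) < e" if "0 \<le> a" "a \<le> b" "b - a < d" for n a b
    proof -
      have "(LINT s:{a<..b}|lborel. nw n s) \<le> e / 4"
        using that d(1) by (intro d(2)) (auto simp: ennreal_less_iff)
      then show ?thesis using inc[OF that(1,2), of n] e by simp
    qed
    have "norm (\<F> n x - \<F> n y) < e" if "y \<in> {0..T}" "norm (x - y) < d" for n y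
      using *[of x y n] *[of y x n] that x by (cases "x \<le> y") (auto simp: norm_minus_commute)
    with d(1) show "\<exists>d>0. \<forall>n y. y \<in> {0..T} \<and> norm (x - y) < d \<longrightarrow> norm (\<F> n x - \<F> n y) < e"
      by blast
  qed (auto intro: that)
  define g1 where "g1 s = fst (g s)" for s
  define g2 where "g2 s = snd (g s)" for s
  have lim: "(\<lambda>n. \<F> (r n) s) \<longlonglongrightarrow> g s" if "s \<in> {0..T}" for s
    using unif that by (intro LIMSEQ_I) blast
  have lim1: "(\<lambda>n. prim (w (r n)) s) \<longlonglongrightarrow> g1 s" and lim2: "(\<lambda>n. prim (nw (r n)) s) \<longlonglongrightarrow> g2 s"
    if "s \<in> {0..T}" for s
    using tendsto_fst[OF lim[OF that]] tendsto_snd[OF lim[OF that]] by (simp_all add: \<F>_def g1_def g2_def)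
  \<comment> \<open>The index 0 stands for the accumulated length alone, so that each coordinate of
    the limit path is a difference of two functions with densities.\<close>
  have "\<exists>f. integrable lborel f \<and> (\<forall>s\<in>{0..T}. g2 s + g1 s \<bullet> b = prim f s)" if b: "b \<in> insert 0 Basis" for b
  proof -
    define p where "p n s = nw (r n) s + w (r n) s \<bullet> b" for n s
    have ab: "\<bar>w (r n) s \<bullet> b\<bar> \<le> nw (r n) s" for n s
      using b Basis_le_norm[of b "w (r n) s"] by (auto simp: nw_def)
    have ui: "uniformly_integrable (\<lambda>n. w (r n))"
      using w unfolding uniformly_integrable_def by blast
    have p: "uniformly_integrable p"
    proof (rule uniformly_integrable_dominated[OF ui, of _ 2])
      show "p n \<in> borel_measurable borel" for n
        unfolding p_def using inw[of "r n"] iw[of "r n"] by auto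
      show "norm (p n s) \<le> 2 * norm (w (r n) s)" for n s
        using ab[of n s] unfolding p_def nw_def by simp
    qed
    obtain f where "integrable lborel f" "\<And>s. s \<in> {0..T} \<Longrightarrow> g2 s + g1 s \<bullet> b = prim f s"
    proof (rule limit_of_nonneg_prims[OF p _ T])
      show "0 \<le> p n s" for n s using ab[of n s] by (simp add: p_def)
      show "(\<lambda>k. prim (p k) s) \<longlonglongrightarrow> g2 s + g1 s \<bullet> b" if "s \<in> {0..T}" for s
        unfolding p_def using inw iw
        by (subst prim_add) (auto simp: prim_inner intro!: tendsto_intros lim1 lim2 that)
      show "continuous_on {0..T} (\<lambda>s. g2 s + g1 s \<bullet> b)"
        unfolding g1_def g2_def by (intro continuous_intros g)
    qed (rule that)
    then show ?thesis by blast
  qed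
  then have "\<forall>b. \<exists>f. b \<in> insert 0 Basis \<longrightarrow> integrable lborel f \<and> (\<forall>s\<in>{0..T}. g2 s + g1 s \<bullet> b = prim f s)"
    by blast
  from choice[OF this] obtain f where
    f: "\<And>b. b \<in> insert 0 Basis \<Longrightarrow> integrable lborel (f b)"
       "\<And>b s. b \<in> insert 0 Basis \<Longrightarrow> s \<in> {0..T} \<Longrightarrow> g2 s + g1 s \<bullet> b = prim (f b) s" by blast
  define v where "v s = (\<Sum>b\<in>Basis. (f b s - f 0 s) *\<^sub>R b)" for s
  have iv: "integrable lborel v" unfolding v_def
    by (intro Bochner_Integration.integrable_sum integrable_scaleR_left Bochner_Integration.integrable_diff f) auto
  have v: "prim v s = g1 s" if s: "s \<in> {0..T}" for s
  proof -
    have "prim v s = (\<Sum>b\<in>Basis. (prim (f b) s - prim (f 0) s) *\<^sub>R b)"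
      unfolding v_def using f(1)
      by (subst prim_sum) (auto simp: prim_scaleR_left prim_diff_fun)
    also have "\<dots> = (\<Sum>b\<in>Basis. (g1 s \<bullet> b) *\<^sub>R b)"
    proof (intro sum.cong refl)
      fix b :: 'a assume "b \<in> Basis"
      then have "g2 s + g1 s \<bullet> b = prim (f b) s" "g2 s + g1 s \<bullet> 0 = prim (f 0) s"
        using f(2) s by blast+
      then have "prim (f b) s - prim (f 0) s = g1 s \<bullet> b" by simp
      then show "(prim (f b) s - prim (f 0) s) *\<^sub>R b = (g1 s \<bullet> b) *\<^sub>R b" by simp
    qed
    finally show ?thesis by (simp add: euclidean_representation)
  qed
  have "uniform_limit {0..T} (\<lambda>n. prim (w (r n))) (prim v) sequentially"
    unfolding uniform_limit_sequentially_iff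
  proof (intro allI impI)
    fix e :: real assume "e > 0"
    then obtain N where N: "\<And>n x. n \<ge> N \<Longrightarrow> x \<in> {0..T} \<Longrightarrow> norm (\<F> (r n) x - g x) < e"
      using unif by blast
    have "dist (prim (w (r n)) x) (prim v x) < e" if "n \<ge> N" "x \<in> {0..T}" for n x
    proof -
      have "dist (prim (w (r n)) x) (prim v x) = norm (fst (\<F> (r n) x - g x))"
        using v[OF that(2)] by (simp add: dist_norm \<F>_def g1_def)
      also have "\<dots> \<le> norm (\<F> (r n) x - g x)" by (metis norm_fst_le prod.collapse)
      finally show ?thesis using N[OF that] by simp
    qed
    then show "\<exists>N. \<forall>n\<ge>N. \<forall>x\<in>{0..T}. dist (prim (w (r n)) x) (prim v x) < e" by blast
  qed
  with r iv show ?thesis by (rule that)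
qed

subsection \<open>Lower semicontinuity of the cost\<close>

text \<open>\<open>ennreal\<close> sends negative numbers to 0, so the right-hand side integrates
  the positive part. This admits affine minorants of any sign.\<close>

lemma ennreal_integral_le_nn_integral:
  fixes f :: "'a \<Rightarrow> real"
  assumes "integrable M f"
  shows "ennreal (integral\<^sup>L M f) \<le> (\<integral>\<^sup>+x. ennreal (f x) \<partial>M)"
proof -
  have i: "integrable M (\<lambda>x. max 0 (f x))" using assms by auto
  have "ennreal (integral\<^sup>L M f) \<le> ennreal (\<integral>x. max 0 (f x) \<partial>M)"
    by (intro ennreal_leI integral_mono assms i) auto
  also have "\<dots> = (\<integral>\<^sup>+x. ennreal (max 0 (f x)) \<partial>M)"
    by (rule nn_integral_eq_integral[symmetric, OF i]) auto
  also have "\<dots> = (\<integral>\<^sup>+x. ennreal (f x) \<partial>M)"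
    by (intro nn_integral_cong) (simp add: max_def ennreal_neg)
  finally show ?thesis .
qed

lemma ennreal_le_if_minus_epsilon_le:
  assumes "\<And>e. e > 0 \<Longrightarrow> ennreal (l - e) \<le> X" shows "ennreal l \<le> X"
proof (rule LIMSEQ_le_const2)
  have "(\<lambda>n. l - 1 / real (Suc n)) \<longlonglongrightarrow> l - 0"
    by (intro tendsto_intros LIMSEQ_Suc lim_1_over_n)
  then show "(\<lambda>n. ennreal (l - 1 / real (Suc n))) \<longlonglongrightarrow> ennreal l"
    by (intro tendsto_ennrealI) simp
qed (use assms in auto)

context lagrangian
begin

text \<open>A Jensen inequality for the joint integrand: the integral of an affine function of the
  velocity depends only on the increment of the path, a quantity that converges along weakly
  convergent velocities.\<close>

lemma nn_integral_L_ge_affine: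
  assumes w: "integrable lborel w" and s: "0 \<le> s" "0 < h"
    and minor: "\<And>x u. dist x x0 < \<delta> \<Longrightarrow> a + p \<bullet> u \<le> L x u"
    and \<xi>: "\<And>\<sigma>. \<sigma> \<in> {s<..s + h} \<Longrightarrow> dist (\<xi> \<sigma>) x0 < \<delta>"
  shows "ennreal h * ennreal (a + p \<bullet> ((prim w (s + h) - prim w s) /\<^sub>R h))
    \<le> (\<integral>\<^sup>+\<sigma>\<in>{s..s + h}. ennreal (L (\<xi> \<sigma>) (w \<sigma>)) \<partial>lborel)"
proof -
  define A where "A = {s<..s + h}"
  have ia: "integrable lborel (\<lambda>\<sigma>. indicator A \<sigma> *\<^sub>R a)"
    using s by (intro integrable_scaleR_left) (auto simp: A_def)
  have iw: "integrable lborel (\<lambda>\<sigma>. indicator A \<sigma> *\<^sub>R w \<sigma>)"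
    using w by (intro integrable_mult_indicator) (auto simp: A_def)
  have ip: "integrable lborel (\<lambda>\<sigma>. p \<bullet> (indicator A \<sigma> *\<^sub>R w \<sigma>))" using iw by (rule integrable_inner_right)
  have "(LINT \<sigma>|lborel. indicator A \<sigma> *\<^sub>R a + p \<bullet> (indicator A \<sigma> *\<^sub>R w \<sigma>)) =
     h * a + p \<bullet> (prim w (s + h) - prim w s)"
  proof -
    have "(LINT \<sigma>|lborel. p \<bullet> (indicator A \<sigma> *\<^sub>R w \<sigma>)) = p \<bullet> (LINT \<sigma>|lborel. indicator A \<sigma> *\<^sub>R w \<sigma>)"
      by (rule integral_inner_right[OF iw])
    also have "(LINT \<sigma>|lborel. indicator A \<sigma> *\<^sub>R w \<sigma>) = prim w (s + h) - prim w s"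
      using prim_diff[OF w s(1), of "s + h"] s by (simp add: A_def set_lebesgue_integral_def)
    finally have "(LINT \<sigma>|lborel. p \<bullet> (indicator A \<sigma> *\<^sub>R w \<sigma>)) = p \<bullet> (prim w (s + h) - prim w s)" .
    moreover have "(LINT \<sigma>|lborel. indicator A \<sigma> *\<^sub>R a) = h * a"
      using s by (simp add: A_def)
    ultimately show ?thesis by (simp only: Bochner_Integration.integral_add[OF ia ip])
  qed
  also have "\<dots> = h * (a + p \<bullet> ((prim w (s + h) - prim w s) /\<^sub>R h))"
    using s by (simp add: distrib_left flip: mult.assoc inner_diff_right)
  finally have "ennreal h * ennreal (a + p \<bullet> ((prim w (s + h) - prim w s) /\<^sub>R h)) =
     ennreal (LINT \<sigma>|lborel. indicator A \<sigma> *\<^sub>R a + p \<bullet> (indicator A \<sigma> *\<^sub>R w \<sigma>))"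
    using s by (simp add: ennreal_mult')
  also have "\<dots> \<le> (\<integral>\<^sup>+\<sigma>. ennreal (indicator A \<sigma> *\<^sub>R a + p \<bullet> (indicator A \<sigma> *\<^sub>R w \<sigma>)) \<partial>lborel)"
    by (intro ennreal_integral_le_nn_integral Bochner_Integration.integrable_add ia ip)
  also have "\<dots> \<le> (\<integral>\<^sup>+\<sigma>\<in>{s..s + h}. ennreal (L (\<xi> \<sigma>) (w \<sigma>)) \<partial>lborel)"
    by (intro nn_integral_mono) (auto simp: A_def indicator_def intro!: ennreal_leI minor \<xi>)
  finally show ?thesis .
qed

text \<open>By Fubini, a time \<open>\<sigma>\<close> belongs to the windows that start in
  \<open>{\<sigma> - h..\<sigma>}\<close>, a set of measure \<open>h\<close>, so averaging over
  windows creates no mass.\<close>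

lemma nn_integral_average_le:
  fixes G :: "real \<Rightarrow> ennreal"
  assumes [measurable]: "G \<in> borel_measurable borel" and h: "0 < h"
  shows "(\<integral>\<^sup>+s\<in>{0..}. (\<integral>\<^sup>+\<sigma>\<in>{s..s + h}. G \<sigma> \<partial>lborel) / ennreal h \<partial>lborel) \<le> (\<integral>\<^sup>+\<sigma>. G \<sigma> \<partial>lborel)"
proof -
  define H where "H s \<sigma> = G \<sigma> * indicator {p. 0 \<le> fst p \<and> fst p \<le> snd p \<and> snd p \<le> fst p + h} (s, \<sigma>) / ennreal h" for s \<sigma>
  have [measurable]: "(\<lambda>(s,\<sigma>). H s \<sigma>) \<in> borel_measurable (lborel \<Otimes>\<^sub>M lborel)"
  proof -
    have "(\<lambda>(s,\<sigma>). H s \<sigma>) = (\<lambda>z. G (snd z) * indicator {p. 0 \<le> fst p \<and> fst p \<le> snd p \<and> snd p \<le> fst p + h} z / ennreal h)"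
      by (auto simp: H_def)
    also have "\<dots> \<in> borel_measurable (lborel \<Otimes>\<^sub>M lborel)" by measurable
    finally show ?thesis .
  qed
  have "(\<integral>\<^sup>+s\<in>{0..}. (\<integral>\<^sup>+\<sigma>\<in>{s..s + h}. G \<sigma> \<partial>lborel) / ennreal h \<partial>lborel) = (\<integral>\<^sup>+s. (\<integral>\<^sup>+\<sigma>. H s \<sigma> \<partial>lborel) \<partial>lborel)"
  proof (rule nn_integral_cong)
    fix s :: real
    show "(\<integral>\<^sup>+\<sigma>\<in>{s..s + h}. G \<sigma> \<partial>lborel) / ennreal h * indicator {0..} s = (\<integral>\<^sup>+\<sigma>. H s \<sigma> \<partial>lborel)"
      unfolding H_def
      by (subst nn_integral_divide) (auto simp: indicator_def intro!: arg_cong2[where f="(/)"] nn_integral_cong)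
  qed
  also have "\<dots> = (\<integral>\<^sup>+\<sigma>. (\<integral>\<^sup>+s. H s \<sigma> \<partial>lborel) \<partial>lborel)"
    by (rule lborel_pair.Fubini'[symmetric]) measurable
  also have "\<dots> \<le> (\<integral>\<^sup>+\<sigma>. G \<sigma> \<partial>lborel)"
  proof (rule nn_integral_mono)
    fix \<sigma> :: real
    have "(\<integral>\<^sup>+s. H s \<sigma> \<partial>lborel) \<le> (\<integral>\<^sup>+s. G \<sigma> / ennreal h * indicator {\<sigma> - h..\<sigma>} s \<partial>lborel)"
      by (intro nn_integral_mono) (auto simp: H_def indicator_def)
    also have "\<dots> = G \<sigma> / ennreal h * ennreal h"
      using h by (subst nn_integral_cmult_indicator) auto
    also have "\<dots> = G \<sigma>"
      using h by (simp add: ennreal_divide_times)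
    finally show "(\<integral>\<^sup>+s. H s \<sigma> \<partial>lborel) \<le> G \<sigma>" .
  qed
  finally show ?thesis .
qed

text \<open>For a fixed window, mean velocities converge as \<open>k\<close> grows; shrinking the
  window then recovers \<open>v\<close> almost everywhere. Fatou's lemma is applied once for each
  limit, and averaging bounds the windowed cost by the full cost independently of the
  window.\<close>

lemma cost_le_liminf:
  fixes w :: "nat \<Rightarrow> real \<Rightarrow> 'a"
  assumes v: "integrable lborel v" and w: "\<And>k. integrable lborel (w k)"
    and \<xi>[measurable]: "\<And>k. \<xi> k \<in> borel_measurable borel"
    and unif: "uniform_limit {0..t} \<xi> (\<lambda>s. x + prim v s) sequentially"
    and lim: "\<And>s. s \<in> {0..t} \<Longrightarrow> (\<lambda>k. prim (w k) s) \<longlonglongrightarrow> prim v s"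
  shows "cost L t x v \<le> liminf (\<lambda>k. \<integral>\<^sup>+s\<in>{0..t}. ennreal (L (\<xi> k s) (w k s)) \<partial>lborel)"
proof -
  have [measurable]: "v \<in> borel_measurable borel" "\<And>k. w k \<in> borel_measurable borel"
    using v w by auto
  have "(\<lambda>n. 1 / real (Suc n)) \<longlonglongrightarrow> 0" by (intro LIMSEQ_Suc lim_1_over_n)
  then obtain r :: "nat \<Rightarrow> nat" where r: "strict_mono r"
    "AE s in lborel. 0 \<le> s \<longrightarrow> (\<lambda>n. (prim v (s + 1 / real (Suc (r n))) - prim v s) /\<^sub>R (1 / real (Suc (r n)))) \<longlonglongrightarrow> v s"
    using AE_difference_quotient_subseq[OF v, of "\<lambda>n. 1 / real (Suc n)"] by auto
  define h where "h n = 1 / real (Suc (r n))" for n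
  have h: "h n > 0" for n by (simp add: h_def)
  have h0: "h \<longlonglongrightarrow> 0"
    using LIMSEQ_subseq_LIMSEQ[OF \<open>(\<lambda>n. 1 / real (Suc n)) \<longlonglongrightarrow> 0\<close> r(1)]
    by (simp add: h_def[abs_def] o_def)
  have quot: "AE s in lborel. 0 \<le> s \<longrightarrow> (\<lambda>n. (prim v (s + h n) - prim v s) /\<^sub>R h n) \<longlonglongrightarrow> v s"
    using r(2) by (simp add: h_def)
  define G where "G k s = ennreal (L (\<xi> k s) (w k s)) * indicator {0..t} s" for k s
  have [measurable]: "G k \<in> borel_measurable borel" for k unfolding G_def by measurable
  define F where "F j k s = (\<integral>\<^sup>+\<sigma>\<in>{s..s + h j}. G k \<sigma> \<partial>lborel) / ennreal (h j) * indicator {0..} s" for j k s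
  have [measurable]: "F j k \<in> borel_measurable borel" for j k
  proof -
    have "F j k = (\<lambda>s. (\<integral>\<^sup>+\<sigma>. G k \<sigma> * indicator {p. fst p \<le> snd p \<and> snd p \<le> fst p + h j} (s, \<sigma>) \<partial>lborel) / ennreal (h j) * indicator {0..} s)"
      unfolding F_def by (auto simp: indicator_def fun_eq_iff intro!: arg_cong2[where f="(/)"] nn_integral_cong)
    also have "\<dots> \<in> borel_measurable borel" by measurable
    finally show ?thesis .
  qed
  have pt: "ennreal (L (x + prim v s) (v s)) \<le> liminf (\<lambda>j. liminf (\<lambda>k. F j k s))"
    if s: "0 \<le> s" "s < t" and q: "(\<lambda>n. (prim v (s + h n) - prim v s) /\<^sub>R h n) \<longlonglongrightarrow> v s" for s
  proof (rule ennreal_le_if_minus_epsilon_le)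
    fix e :: real assume "e > 0"
    obtain p a \<delta> where minor: "\<delta> > 0" "a + p \<bullet> v s > L (x + prim v s) (v s) - e"
      "\<And>x' u. dist x' (x + prim v s) < \<delta> \<Longrightarrow> a + p \<bullet> u \<le> L x' u"
      using affine_minorant[OF \<open>e > 0\<close>, of "x + prim v s" "v s"] by metis
    define l where "l = L (x + prim v s) (v s) - e"
    have "(\<lambda>n. a + p \<bullet> ((prim v (s + h n) - prim v s) /\<^sub>R h n)) \<longlonglongrightarrow> a + p \<bullet> v s"
      by (intro tendsto_intros q)
    then have ev1: "\<forall>\<^sub>F j in sequentially. l < a + p \<bullet> ((prim v (s + h j) - prim v s) /\<^sub>R h j)"
      using minor(2) by (intro order_tendstoD(1)) (auto simp: l_def)
    have ev2: "\<forall>\<^sub>F j in sequentially. h j < t - s"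
      using h0 s by (intro order_tendstoD(2)) auto
    obtain d where d: "d > 0" "\<And>\<sigma>. dist \<sigma> s < d \<Longrightarrow> dist (prim v \<sigma>) (prim v s) < \<delta> / 2"
      using isCont_prim[OF v, of s] minor(1) unfolding continuous_at_eps_delta by (meson half_gt_zero)
    have ev3: "\<forall>\<^sub>F j in sequentially. h j < d"
      using h0 d(1) by (intro order_tendstoD(2)) auto
    show "ennreal (L (x + prim v s) (v s) - e) \<le> liminf (\<lambda>j. liminf (\<lambda>k. F j k s))"
    proof (rule Liminf_bounded)
      show "\<forall>\<^sub>F j in sequentially. ennreal (L (x + prim v s) (v s) - e) \<le> liminf (\<lambda>k. F j k s)"
        using ev1 ev2 ev3
      proof eventually_elim
        case (elim j)
        have "(\<lambda>k. a + p \<bullet> ((prim (w k) (s + h j) - prim (w k) s) /\<^sub>R h j)) \<longlonglongrightarrow> a + p \<bullet> ((prim v (s + h j) - prim v s) /\<^sub>R h j)"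
          using s elim(2) h[of j] by (intro tendsto_intros lim) auto
        then have ev4: "\<forall>\<^sub>F k in sequentially. l < a + p \<bullet> ((prim (w k) (s + h j) - prim (w k) s) /\<^sub>R h j)"
          using elim(1) by (rule order_tendstoD(1))
        have ev5: "\<forall>\<^sub>F k in sequentially. \<forall>\<sigma>\<in>{0..t}. dist (\<xi> k \<sigma>) (x + prim v \<sigma>) < \<delta> / 2"
          using minor(1) by (intro uniform_limitD[OF unif]) auto
        show ?case
        proof (rule Liminf_bounded)
          show "\<forall>\<^sub>F k in sequentially. ennreal (L (x + prim v s) (v s) - e) \<le> F j k s"
            using ev4 ev5
          proof eventually_elim
            case (elim k)
            have near: "dist (\<xi> k \<sigma>) (x + prim v s) < \<delta>" if \<sigma>: "\<sigma> \<in> {s<..s + h j}" for \<sigma>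
            proof -
              have "dist (\<xi> k \<sigma>) (x + prim v \<sigma>) < \<delta> / 2"
                using elim(2) \<sigma> s \<open>h j < t - s\<close> by auto
              moreover have "dist (x + prim v \<sigma>) (x + prim v s) < \<delta> / 2"
                using d(2)[of \<sigma>] \<sigma> \<open>h j < d\<close> by (simp add: dist_real_def)
              ultimately show ?thesis
                using dist_triangle[of "\<xi> k \<sigma>" "x + prim v s" "x + prim v \<sigma>"] by linarith
            qed
            have "ennreal (h j) * ennreal l \<le> ennreal (h j) * ennreal (a + p \<bullet> ((prim (w k) (s + h j) - prim (w k) s) /\<^sub>R h j))"
              using elim(1) by (intro mult_left_mono ennreal_leI) auto
            also have "\<dots> \<le> (\<integral>\<^sup>+\<sigma>\<in>{s..s + h j}. ennreal (L (\<xi> k \<sigma>) (w k \<sigma>)) \<partial>lborel)"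
              by (rule nn_integral_L_ge_affine[OF w s(1) h minor(3) near])
            \<comment> \<open>For late \<open>j\<close> the window ends before \<open>t\<close>, so
              the cutoff in \<open>G\<close> is invisible.\<close>
            also have "\<dots> = (\<integral>\<^sup>+\<sigma>\<in>{s..s + h j}. G k \<sigma> \<partial>lborel)"
              using s \<open>h j < t - s\<close> by (intro nn_integral_cong) (auto simp: G_def indicator_def)
            finally have "ennreal (h j) * ennreal l / ennreal (h j) \<le> (\<integral>\<^sup>+\<sigma>\<in>{s..s + h j}. G k \<sigma> \<partial>lborel) / ennreal (h j)"
              by (rule divide_right_mono_ennreal)
            then have "ennreal l \<le> (\<integral>\<^sup>+\<sigma>\<in>{s..s + h j}. G k \<sigma> \<partial>lborel) / ennreal (h j)"
              using h[of j] by (simp add: mult_divide_eq_ennreal mult.commute)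
            then show ?case using s by (simp add: F_def l_def)
          qed
        qed
      qed
    qed
  qed
  \<comment> \<open>The endpoint is discarded because no window starting there fits into the
    interval.\<close>
  have "cost L t x v = (\<integral>\<^sup>+s. ennreal (L (x + prim v s) (v s)) * indicator {0..<t} s \<partial>lborel)"
    unfolding cost_def
    by (rule nn_integral_cong_AE, use AE_lborel_singleton[of t] in eventually_elim) (auto simp: indicator_def)
  also have "\<dots> \<le> (\<integral>\<^sup>+s. liminf (\<lambda>j. liminf (\<lambda>k. F j k s)) \<partial>lborel)"
    by (rule nn_integral_mono_AE, use quot in eventually_elim) (auto simp: indicator_def intro: pt)
  also have "\<dots> \<le> liminf (\<lambda>j. \<integral>\<^sup>+s. liminf (\<lambda>k. F j k s) \<partial>lborel)"
    by (rule nn_integral_liminf) measurable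
  also have "\<dots> \<le> liminf (\<lambda>j::nat. liminf (\<lambda>k. \<integral>\<^sup>+s. G k s \<partial>lborel))"
  proof (rule Liminf_mono, rule always_eventually, rule allI)
    fix j
    have "(\<integral>\<^sup>+s. liminf (\<lambda>k. F j k s) \<partial>lborel) \<le> liminf (\<lambda>k. \<integral>\<^sup>+s. F j k s \<partial>lborel)"
      by (rule nn_integral_liminf) measurable
    also have "\<dots> \<le> liminf (\<lambda>k. \<integral>\<^sup>+s. G k s \<partial>lborel)"
      unfolding F_def by (intro Liminf_mono always_eventually allI nn_integral_average_le h) measurable
    finally show "(\<integral>\<^sup>+s. liminf (\<lambda>k. F j k s) \<partial>lborel) \<le> liminf (\<lambda>k. \<integral>\<^sup>+s. G k s \<partial>lborel)" .
  qed
  also have "\<dots> = liminf (\<lambda>k. \<integral>\<^sup>+s. G k s \<partial>lborel)" by (simp add: Liminf_const)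
  finally show ?thesis unfolding G_def .
qed

end

section \<open>Compactness of trajectories with bounded cost\<close>

context lagrangian
begin

text \<open>De la Vallee-Poussin's criterion: the share of the speed bounded by \<open>L / K\<close>
  has total at most \<open>C' / K\<close>, and the constant share is small on sets of small
  measure.\<close>

lemma uniformly_integrable_of_bounded_cost:
  fixes w :: "nat \<Rightarrow> real \<Rightarrow> 'a"
  assumes w: "\<And>k. integrable lborel (w k)" and supp: "\<And>k s. s \<notin> {0..T k} \<Longrightarrow> w k s = 0"
    and [measurable]: "\<And>k. \<xi> k \<in> borel_measurable borel"
    and bound: "\<And>k. (\<integral>\<^sup>+s\<in>{0..T k}. ennreal (L (\<xi> k s) (w k s)) \<partial>lborel) \<le> ennreal C"
  shows "uniformly_integrable w"
proof -
  have [measurable]: "w k \<in> borel_measurable borel" for k using w[of k] by auto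
  define C' where "C' = max C 0"
  have C': "C' \<ge> 0" "ennreal C = ennreal C'" by (auto simp: C'_def max_def ennreal_neg)
  have "\<exists>d>0. \<forall>i. \<forall>A\<in>sets borel. emeasure lborel A < ennreal d \<longrightarrow> (LINT s:A|lborel. norm (w i s)) \<le> e"
    if e: "e > 0" for e
  proof -
    \<comment> \<open>Makes \<open>C' / K\<close> at most \<open>e / 2\<close>, also when
      \<open>C' = 0\<close>; \<open>d\<close> below leaves the other half to
      \<open>B * d\<close>.\<close>
    define K where "K = (2 * C' + 1) / e"
    have K: "K > 0" using C' e by (simp add: K_def add_nonneg_pos)
    have CK: "C' / K \<le> e / 2" using C' e by (simp add: K_def divide_simps)
    obtain B where B: "B \<ge> 0" "\<And>x u. norm u \<le> L x u / K + B" using norm_le_L[OF K] by blast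
    define d where "d = e / (2 * (B + 1))"
    have d: "d > 0" using B e by (simp add: d_def)
    have Bd: "B * d \<le> e / 2" using B e by (simp add: d_def field_simps)
    have "(LINT s:A|lborel. norm (w i s)) \<le> e" if A: "A \<in> sets borel" "emeasure lborel A < ennreal d" for A i
    proof -
      have [measurable]: "A \<in> sets borel" by fact
      have ia: "integrable lborel (\<lambda>s. indicator A s *\<^sub>R norm (w i s))"
        by (intro integrable_mult_indicator integrable_norm w) (use A in auto)
      have "ennreal (LINT s:A|lborel. norm (w i s)) = (\<integral>\<^sup>+s. ennreal (indicator A s *\<^sub>R norm (w i s)) \<partial>lborel)"
        unfolding set_lebesgue_integral_def by (rule nn_integral_eq_integral[symmetric, OF ia]) auto
      also have "\<dots> \<le> (\<integral>\<^sup>+s. ennreal (1 / K) * (ennreal (L (\<xi> i s) (w i s)) * indicator {0..T i} s) + ennreal B * indicator A s \<partial>lborel)"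
      proof (rule nn_integral_mono)
        fix s :: real
        show "ennreal (indicator A s *\<^sub>R norm (w i s)) \<le>
          ennreal (1 / K) * (ennreal (L (\<xi> i s) (w i s)) * indicator {0..T i} s) + ennreal B * indicator A s"
        proof (cases "s \<in> A \<inter> {0..T i}")
          case True
          have "ennreal (norm (w i s)) \<le> ennreal (L (\<xi> i s) (w i s) / K + B)" by (intro ennreal_leI B)
          also have "\<dots> = ennreal (1 / K) * ennreal (L (\<xi> i s) (w i s)) + ennreal B"
            using nonneg K B(1) by (simp add: ennreal_plus flip: ennreal_mult)
          finally show ?thesis using True by simp
        qed (auto simp: supp)
      qed
      also have "\<dots> = ennreal (1 / K) * (\<integral>\<^sup>+s\<in>{0..T i}. ennreal (L (\<xi> i s) (w i s)) \<partial>lborel) + ennreal B * emeasure lborel A"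
        by (subst nn_integral_add) (auto simp: nn_integral_cmult nn_integral_cmult_indicator)
      also have "\<dots> \<le> ennreal (1 / K) * ennreal C' + ennreal B * ennreal d"
        using bound[of i] A C' by (intro add_mono mult_left_mono) auto
      also have "\<dots> = ennreal (C' / K + B * d)"
        using K C' B d by (simp add: ennreal_plus flip: ennreal_mult)
      finally have "(LINT s:A|lborel. norm (w i s)) \<le> C' / K + B * d"
        using K C' B d by (subst (asm) ennreal_le_iff) auto
      with CK Bd show ?thesis by linarith
    qed
    with d show ?thesis by blast
  qed
  with w show ?thesis unfolding uniformly_integrable_def by blast
qed

text \<open>The case \<open>K = 1\<close>: the constant share now accumulates over the whole
  horizon, which is where the common bound \<open>T'\<close> enters.\<close>

lemma L1_bound_of_bounded_cost:
  fixes w :: "nat \<Rightarrow> real \<Rightarrow> 'a"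
  assumes w: "\<And>k. integrable lborel (w k)" and supp: "\<And>k s. s \<notin> {0..T k} \<Longrightarrow> w k s = 0"
    and [measurable]: "\<And>k. \<xi> k \<in> borel_measurable borel"
    and bound: "\<And>k. (\<integral>\<^sup>+s\<in>{0..T k}. ennreal (L (\<xi> k s) (w k s)) \<partial>lborel) \<le> ennreal C"
    and T: "\<And>k. T k \<le> T'"
  obtains B where "\<And>k. (LINT s|lborel. norm (w k s)) \<le> B"
proof -
  have [measurable]: "w k \<in> borel_measurable borel" for k using w[of k] by auto
  define C' where "C' = max C 0"
  have C': "C' \<ge> 0" "ennreal C = ennreal C'" by (auto simp: C'_def max_def ennreal_neg)
  obtain B where B: "B \<ge> 0" "\<And>x u. norm u \<le> L x u / 1 + B" using norm_le_L[OF zero_less_one] by blast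
  have "(LINT s|lborel. norm (w k s)) \<le> C' + B * max T' 0" for k
  proof -
    have "ennreal (LINT s|lborel. norm (w k s)) = (\<integral>\<^sup>+s. ennreal (norm (w k s)) \<partial>lborel)"
      by (rule nn_integral_eq_integral[symmetric, OF integrable_norm[OF w]]) auto
    also have "\<dots> \<le> (\<integral>\<^sup>+s. ennreal (L (\<xi> k s) (w k s)) * indicator {0..T k} s + ennreal B * indicator {0..max T' 0} s \<partial>lborel)"
    proof (rule nn_integral_mono)
      fix s :: real
      show "ennreal (norm (w k s)) \<le> ennreal (L (\<xi> k s) (w k s)) * indicator {0..T k} s + ennreal B * indicator {0..max T' 0} s"
      proof (cases "s \<in> {0..T k}")
        case True
        have "ennreal (norm (w k s)) \<le> ennreal (L (\<xi> k s) (w k s) + B)" using B(2)[of "w k s" "\<xi> k s"] by (intro ennreal_leI) simp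
        also have "\<dots> = ennreal (L (\<xi> k s) (w k s)) + ennreal B"
          using nonneg B(1) by (simp add: ennreal_plus)
        finally show ?thesis using True T[of k] by auto
      qed (auto simp: supp)
    qed
    also have "\<dots> = (\<integral>\<^sup>+s\<in>{0..T k}. ennreal (L (\<xi> k s) (w k s)) \<partial>lborel) + ennreal B * ennreal (max T' 0)"
      by (subst nn_integral_add) (auto simp: nn_integral_cmult_indicator)
    also have "\<dots> \<le> ennreal C' + ennreal B * ennreal (max T' 0)"
      using bound[of k] C' by (intro add_mono) auto
    also have "\<dots> = ennreal (C' + B * max T' 0)"
      using C' B by (simp add: ennreal_plus flip: ennreal_mult)
    finally show ?thesis
      using C' B by (subst (asm) ennreal_le_iff) auto
  qed
  then show ?thesis by (rule that)
qed

text \<open>Fatou's lemma for horizons increasing to \<open>t\<close>. When approximating horizons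
  tend to \<open>t\<close>, estimates are available only on \<open>[0,t']\<close> with
  \<open>t' < t\<close>; for \<open>t = 0\<close> the condition is void and the cost
  vanishes.\<close>

lemma cost_le_if_shorter:
  assumes v: "integrable lborel v"
    and le: "\<And>t'. 0 \<le> t' \<Longrightarrow> t' < t \<Longrightarrow> cost L t' x v \<le> X"
  shows "cost L t x v \<le> X"
proof (cases "0 < t")
  case True
  have [measurable]: "v \<in> borel_measurable borel" "prim v \<in> borel_measurable borel"
    using v borel_measurable_prim[OF v] by auto
  define a where "a n = t - t / real (Suc n)" for n
  have a: "a \<longlonglongrightarrow> t"
  proof -
    have "a \<longlonglongrightarrow> t - t * 0"
      unfolding a_def divide_inverse by (intro tendsto_intros LIMSEQ_inverse_real_of_nat)
    then show ?thesis by simp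
  qed
  have at: "0 \<le> a n" "a n < t" for n using True by (auto simp: a_def field_simps)
  have "cost L t x v = (\<integral>\<^sup>+s. ennreal (L (x + prim v s) (v s)) * indicator {0..<t} s \<partial>lborel)"
    unfolding cost_def
    by (rule nn_integral_cong_AE, use AE_lborel_singleton[of t] in eventually_elim) (auto simp: indicator_def)
  also have "\<dots> \<le> (\<integral>\<^sup>+s. liminf (\<lambda>n. ennreal (L (x + prim v s) (v s)) * indicator {0..a n} s) \<partial>lborel)"
  proof (rule nn_integral_mono)
    fix s :: real
    show "ennreal (L (x + prim v s) (v s)) * indicator {0..<t} s \<le>
       liminf (\<lambda>n. ennreal (L (x + prim v s) (v s)) * indicator {0..a n} s)"
    proof (cases "s \<in> {0..<t}")
      case True
      then have "\<forall>\<^sub>F n in sequentially. s < a n" using a by (intro order_tendstoD(1)) auto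
      then have "\<forall>\<^sub>F n in sequentially. ennreal (L (x + prim v s) (v s)) * indicator {0..<t} s \<le>
          ennreal (L (x + prim v s) (v s)) * indicator {0..a n} s"
        by eventually_elim (use True in \<open>auto simp: indicator_def\<close>)
      then show ?thesis by (rule Liminf_bounded)
    qed simp
  qed
  also have "\<dots> \<le> liminf (\<lambda>n. \<integral>\<^sup>+s. ennreal (L (x + prim v s) (v s)) * indicator {0..a n} s \<partial>lborel)"
    by (rule nn_integral_liminf) measurable
  also have "\<dots> = liminf (\<lambda>n. cost L (a n) x v)" by (simp add: cost_def)
  also have "\<dots> \<le> liminf (\<lambda>n::nat. X)" by (intro Liminf_mono always_eventually allI le at)
  finally show ?thesis by (simp add: Liminf_const)
next
  case False
  have "cost L t x v = (\<integral>\<^sup>+s. 0 \<partial>(lborel :: real measure))"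
    unfolding cost_def
    by (rule nn_integral_cong_AE, use AE_lborel_singleton[of 0] in eventually_elim)
      (use False in \<open>auto simp: indicator_def\<close>)
  then show ?thesis by simp
qed

text \<open>The cost integrand is evaluated along \<open>\<xi>\<close>, which only has to be uniformly close to the
  trajectory driven by \<open>w\<close>; this covers both exact trajectories and Euler polygons.\<close>

lemma trajectory_compactness:
  fixes w \<xi> :: "nat \<Rightarrow> real \<Rightarrow> 'a" and T :: "nat \<Rightarrow> real"
  assumes w: "\<And>k. integrable lborel (w k)" and supp: "\<And>k s. s \<notin> {0..T k} \<Longrightarrow> w k s = 0"
    and \<xi>[measurable]: "\<And>k. \<xi> k \<in> borel_measurable borel"
    and bound: "\<And>k. (\<integral>\<^sup>+s\<in>{0..T k}. ennreal (L (\<xi> k s) (w k s)) \<partial>lborel) \<le> ennreal C"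
    and T: "\<And>k. 0 \<le> T k" "T \<longlonglongrightarrow> t" and X: "X \<longlonglongrightarrow> x"
    and near: "\<And>k s. 0 \<le> s \<Longrightarrow> s < T k \<Longrightarrow> norm (\<xi> k s - X k - prim (w k) s) \<le> \<epsilon> k" and \<epsilon>: "\<epsilon> \<longlonglongrightarrow> 0"
  obtains r v where "strict_mono r" "integrable lborel v"
    "(\<lambda>n. prim (w (r n)) (T (r n))) \<longlonglongrightarrow> prim v t"
    "cost L t x v \<le> liminf (\<lambda>n. \<integral>\<^sup>+s\<in>{0..T (r n)}. ennreal (L (\<xi> (r n) s) (w (r n) s)) \<partial>lborel)"
proof -
  have t0: "0 \<le> t" by (rule LIMSEQ_le_const[OF T(2)]) (use T(1) in auto)
  \<comment> \<open>A common horizon: since the velocities vanish after \<open>T k\<close>, all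
    paths extend as constants up to \<open>T'\<close>, and one compact interval carries the
    limit.\<close>
  obtain T' where T'0: "\<And>k. norm (T k) \<le> T'"
    using convergent_imp_Bseq[of T] T(2) unfolding Bseq_def convergent_def by blast
  have T': "T k \<le> T'" for k using T'0[of k] by simp
  have tT': "t \<le> T'" by (rule LIMSEQ_le_const2[OF T(2)]) (use T' in auto)
  have ui: "uniformly_integrable w"
    by (rule uniformly_integrable_of_bounded_cost[OF w supp \<xi> bound])
  obtain B where B: "\<And>k. (LINT s|lborel. norm (w k s)) \<le> B"
    using L1_bound_of_bounded_cost[where w=w and T=T and \<xi>=\<xi>, OF w supp \<xi> bound T'] by blast
  have "0 \<le> T'" using t0 tT' by simp
  from uniformly_integrable_imp_convergent_subseq[OF ui B this] obtain r v where
    r: "strict_mono (r :: nat \<Rightarrow> nat)" and v: "integrable lborel v"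
    and unif: "uniform_limit {0..T'} (\<lambda>n. prim (w (r n))) (prim v) sequentially" .
  have Tr: "(\<lambda>n. T (r n)) \<longlonglongrightarrow> t" and Xr: "(\<lambda>n. X (r n)) \<longlonglongrightarrow> x" and \<epsilon>r: "(\<lambda>n. \<epsilon> (r n)) \<longlonglongrightarrow> 0"
    using LIMSEQ_subseq_LIMSEQ[OF T(2) r] LIMSEQ_subseq_LIMSEQ[OF X r] LIMSEQ_subseq_LIMSEQ[OF \<epsilon> r]
    by (simp_all add: o_def)
  show ?thesis
  proof (rule that[OF r v])
    have "(\<lambda>n. prim v (T (r n))) \<longlonglongrightarrow> prim v t"
      using isCont_tendsto_compose[OF isCont_prim[OF v] Tr] .
    \<comment> \<open>The evaluation time moves with \<open>n\<close>, so pointwise convergence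
      would not do; uniform convergence compares both paths at the same time
      \<open>T (r n)\<close>.\<close>
    moreover have "(\<lambda>n. prim (w (r n)) (T (r n)) - prim v (T (r n))) \<longlonglongrightarrow> 0"
    proof (rule tendstoI)
      fix e :: real assume "e > 0"
      from uniform_limitD[OF unif this]
      show "\<forall>\<^sub>F n in sequentially. dist (prim (w (r n)) (T (r n)) - prim v (T (r n))) 0 < e"
        by eventually_elim (use T(1) T' in \<open>auto simp: dist_norm\<close>)
    qed
    ultimately show "(\<lambda>n. prim (w (r n)) (T (r n))) \<longlonglongrightarrow> prim v t"
      using tendsto_add by fastforce
    show "cost L t x v \<le> liminf (\<lambda>n. \<integral>\<^sup>+s\<in>{0..T (r n)}. ennreal (L (\<xi> (r n) s) (w (r n) s)) \<partial>lborel)"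
    proof (rule cost_le_if_shorter[OF v])
      fix t' assume t': "0 \<le> t'" "t' < t"
      have ev: "\<forall>\<^sub>F n in sequentially. t' < T (r n)" using Tr t' by (intro order_tendstoD(1)) auto
      have "cost L t' x v \<le> liminf (\<lambda>n. \<integral>\<^sup>+s\<in>{0..t'}. ennreal (L (\<xi> (r n) s) (w (r n) s)) \<partial>lborel)"
      proof (rule cost_le_liminf[OF v w \<xi>])
        show "uniform_limit {0..t'} (\<lambda>n. \<xi> (r n)) (\<lambda>s. x + prim v s) sequentially"
        proof (rule uniform_limitI)
          fix e :: real assume e: "e > 0"
          then have e3: "e / 3 > 0" by simp
          have "\<forall>\<^sub>F n in sequentially. norm (X (r n) - x) < e / 3"
            using tendstoD[OF Xr e3] by (simp add: dist_norm)
          moreover have "\<forall>\<^sub>F n in sequentially. \<epsilon> (r n) < e / 3"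
            using \<epsilon>r e3 by (rule order_tendstoD(2))
          ultimately show "\<forall>\<^sub>F n in sequentially. \<forall>s\<in>{0..t'}. dist (\<xi> (r n) s) (x + prim v s) < e"
            using uniform_limitD[OF unif e3] ev
          proof eventually_elim
            case (elim n)
            show ?case
            proof
              fix s assume s: "s \<in> {0..t'}"
              have "\<xi> (r n) s - (x + prim v s) = (\<xi> (r n) s - X (r n) - prim (w (r n)) s) + (X (r n) - x) + (prim (w (r n)) s - prim v s)"
                by simp
              then have "norm (\<xi> (r n) s - (x + prim v s)) \<le> norm (\<xi> (r n) s - X (r n) - prim (w (r n)) s) + norm (X (r n) - x) + norm (prim (w (r n)) s - prim v s)"
                by (metis norm_triangle_ineq norm_triangle_mono order_refl)
              moreover have "norm (\<xi> (r n) s - X (r n) - prim (w (r n)) s) \<le> \<epsilon> (r n)"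
                using s elim by (intro near) auto
              moreover have "norm (prim (w (r n)) s - prim v s) < e / 3"
                using elim s t' tT' by (auto simp: dist_norm)
              ultimately show "dist (\<xi> (r n) s) (x + prim v s) < e"
                using elim by (simp add: dist_norm)
            qed
          qed
        qed
        fix s assume "s \<in> {0..t'}"
        then show "(\<lambda>n. prim (w (r n)) s) \<longlonglongrightarrow> prim v s"
          using t' tT' by (intro tendsto_uniform_limitI[OF unif]) auto
      qed
      also have "\<dots> \<le> liminf (\<lambda>n. \<integral>\<^sup>+s\<in>{0..T (r n)}. ennreal (L (\<xi> (r n) s) (w (r n) s)) \<partial>lborel)"
        by (rule Liminf_mono, use ev in eventually_elim, intro nn_integral_mono) (auto simp: indicator_def)
      finally show "cost L t' x v \<le> liminf (\<lambda>n. \<integral>\<^sup>+s\<in>{0..T (r n)}. ennreal (L (\<xi> (r n) s) (w (r n) s)) \<partial>lborel)" .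
    qed
  qed
qed

end

subsection \<open>The value function\<close>

text \<open>Fatou's lemma for the counting measure on two points.\<close>

lemma ennreal_liminf_add_le:
  fixes f g :: "nat \<Rightarrow> ennreal"
  shows "liminf f + liminf g \<le> liminf (\<lambda>n. f n + g n)"
  using nn_integral_liminf[of "\<lambda>n b. if b then f n else g n" "count_space UNIV"]
  by (simp add: nn_integral_count_space_finite UNIV_bool add.commute)

locale bolza = lagrangian L \<Theta>
  for L :: "real^'n \<Rightarrow> real^'n \<Rightarrow> real" and \<Theta> +
  fixes \<phi> :: "real^'n \<Rightarrow> ennreal"
  assumes lsc_\<phi>: "lsc_on UNIV \<phi>"
begin

abbreviation "V \<equiv> value_function L \<phi>"

lemma value_function_0: "V 0 x = \<phi> x"
proof (rule antisym)
  have c0: "cost L 0 x v = 0" if "integrable lborel v" for x v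
    using cost_le_if_shorter[OF that, of 0 x 0] by simp
  show "V 0 x \<le> \<phi> x"
    using value_function_le_cost[of "\<lambda>_. 0" L \<phi> 0 x] c0[of "\<lambda>_. 0" x] by simp
  show "\<phi> x \<le> V 0 x"
  proof (rule dense_ge)
    fix a assume "V 0 x < a"
    then obtain v where "integrable lborel v" "cost L 0 x v + \<phi> (x + prim v 0) < a"
      by (rule value_function_lessE) auto
    then show "\<phi> x \<le> a" using c0[of v x] by simp
  qed
qed

text \<open>Compactness for almost minimizing trajectories with converging data. Constant data yield
  minimizers, varying data lower semicontinuity of \<open>V\<close>; the vanishing surplus is there
  because an infimum is only approached.\<close>

lemma limit_trajectory:
  assumes T: "\<And>k. 0 \<le> T k" "T \<longlonglongrightarrow> t" and X: "X \<longlonglongrightarrow> x" and a: "a < \<infinity>"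
    and less: "\<And>k. V (T k) (X k) < a + ennreal (1 / real (Suc k))"
  obtains v where "integrable lborel v" "cost L t x v + \<phi> (x + prim v t) \<le> a"
proof -
  have "\<exists>w. integrable lborel w \<and> (\<forall>s. s \<notin> {0..T k} \<longrightarrow> w s = 0) \<and>
      cost L (T k) (X k) w + \<phi> (X k + prim w (T k)) < a + ennreal (1 / real (Suc k))" for k
    using value_function_lessE[OF less T(1)] by metis
  then have "\<forall>k. \<exists>w. integrable lborel w \<and> (\<forall>s. s \<notin> {0..T k} \<longrightarrow> w s = 0) \<and>
      cost L (T k) (X k) w + \<phi> (X k + prim w (T k)) < a + ennreal (1 / real (Suc k))" by blast
  from choice[OF this] obtain w where w: "\<And>k. integrable lborel (w k)"
    "\<And>k s. s \<notin> {0..T k} \<Longrightarrow> w k s = 0"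
    "\<And>k. cost L (T k) (X k) (w k) + \<phi> (X k + prim (w k) (T k)) < a + ennreal (1 / real (Suc k))"
    by blast
  define \<xi> where "\<xi> k s = X k + prim (w k) s" for k s
  have m: "\<xi> k \<in> borel_measurable borel" for k
    unfolding \<xi>_def using borel_measurable_prim[OF w(1)] by measurable
  have cost: "(\<integral>\<^sup>+s\<in>{0..T k}. ennreal (L (\<xi> k s) (w k s)) \<partial>lborel) = cost L (T k) (X k) (w k)" for k
    by (simp add: cost_def \<xi>_def)
  have bound: "cost L (T k) (X k) (w k) \<le> ennreal (enn2real a + 1)" for k
  proof -
    have "cost L (T k) (X k) (w k) \<le> a + ennreal (1 / real (Suc k))"
      using w(3)[of k] by (meson le_add1 less_imp_le order_trans le_iff_add)
    also have "\<dots> \<le> a + ennreal 1" by (intro add_left_mono ennreal_leI) simp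
    also have "\<dots> = ennreal (enn2real a + 1)" using a by (simp add: ennreal_plus)
    finally show ?thesis .
  qed
  obtain r v where rv: "strict_mono (r :: nat \<Rightarrow> nat)" "integrable lborel v"
    "(\<lambda>n. prim (w (r n)) (T (r n))) \<longlonglongrightarrow> prim v t"
    "cost L t x v \<le> liminf (\<lambda>n. \<integral>\<^sup>+s\<in>{0..T (r n)}. ennreal (L (\<xi> (r n) s) (w (r n) s)) \<partial>lborel)"
  proof (rule trajectory_compactness[where w=w and \<xi>=\<xi> and T=T and X=X and \<epsilon>="\<lambda>_. 0" and t=t and x=x and C="enn2real a + 1"])
    show "norm (\<xi> k s - X k - prim (w k) s) \<le> 0" for k s by (simp add: \<xi>_def)
  qed (use w T X m bound cost in auto)
  have Xr: "(\<lambda>n. X (r n)) \<longlonglongrightarrow> x" using LIMSEQ_subseq_LIMSEQ[OF X rv(1)] by (simp add: o_def)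
  have "\<phi> (x + prim v t) \<le> liminf (\<lambda>n. \<phi> (X (r n) + prim (w (r n)) (T (r n))))"
    by (rule lsc_on_le_Liminf[OF lsc_\<phi>]) (auto intro!: tendsto_add Xr rv(3))
  with rv(4) have "cost L t x v + \<phi> (x + prim v t) \<le>
      liminf (\<lambda>n. cost L (T (r n)) (X (r n)) (w (r n))) + liminf (\<lambda>n. \<phi> (X (r n) + prim (w (r n)) (T (r n))))"
    unfolding cost by (rule add_mono)
  also have "\<dots> \<le> liminf (\<lambda>n. cost L (T (r n)) (X (r n)) (w (r n)) + \<phi> (X (r n) + prim (w (r n)) (T (r n))))"
    by (rule ennreal_liminf_add_le)
  also have "\<dots> \<le> liminf (\<lambda>n. a + ennreal (1 / real (Suc (r n))))"
    by (intro Liminf_mono always_eventually allI less_imp_le w(3))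
  also have "\<dots> = a"
  proof (rule lim_imp_Liminf)
    have "(\<lambda>n. a + ennreal (1 / real (Suc n))) \<longlonglongrightarrow> a + ennreal 0"
      by (intro tendsto_add tendsto_const tendsto_ennrealI LIMSEQ_Suc lim_1_over_n)
    then show "(\<lambda>n. a + ennreal (1 / real (Suc (r n)))) \<longlonglongrightarrow> a"
      using LIMSEQ_subseq_LIMSEQ[OF _ rv(1)] by (fastforce simp: o_def)
  qed simp
  finally show ?thesis by (rule that[OF rv(2)])
qed

lemma less_add_inverse_Suc:
  fixes a :: ennreal assumes "b \<le> a" "a < \<infinity>" shows "b < a + ennreal (1 / real (Suc k))"
proof -
  have "a + 0 < a + ennreal (1 / real (Suc k))"
    using assms(2) by (subst ennreal_add_left_cancel_less) auto
  then have "a < a + ennreal (1 / real (Suc k))" unfolding add_0_right .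
  with assms(1) show ?thesis by (rule le_less_trans)
qed

lemma minimizer:
  assumes t: "0 \<le> t" and fin: "V t x < \<infinity>"
  obtains v where "integrable lborel v" "cost L t x v + \<phi> (x + prim v t) = V t x"
proof -
  obtain v where v: "integrable lborel v" "cost L t x v + \<phi> (x + prim v t) \<le> V t x"
    by (rule limit_trajectory[of "\<lambda>_. t" t "\<lambda>_. x" x "V t x"])
      (use t fin less_add_inverse_Suc[OF order_refl fin] in auto)
  then show ?thesis using value_function_le_cost[OF v(1), of L \<phi> t x] by (intro that[OF v(1)]) auto
qed

text \<open>Otherwise points with value at most \<open>a\<close> would tend to \<open>z\<close>, and
  a limit of their almost optimal trajectories would show that the value at \<open>z\<close> is at
  most \<open>a\<close>.\<close>

lemma lsc_value_function: "lsc_on ({0..} \<times> UNIV) (\<lambda>(t, x). V t x)"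
  unfolding lsc_on_def
proof (intro ballI allI impI)
  fix z a assume z: "z \<in> {0..} \<times> (UNIV :: (real^'n) set)" and a: "a < (case z of (t, x) \<Rightarrow> V t x)"
  obtain t x where tx: "z = (t, x)" by (cases z)
  show "\<forall>\<^sub>F y in at z within {0..} \<times> UNIV. a < (case y of (t, x) \<Rightarrow> V t x)"
  proof (rule ccontr)
    assume neg: "\<not> ?thesis"
    have "\<exists>y\<in>{0..} \<times> UNIV. dist y z < 1 / real (Suc k) \<and> (case y of (t, x) \<Rightarrow> V t x) \<le> a" for k
    proof -
      have "1 / real (Suc k) > 0" by simp
      then have "\<not> (\<forall>y\<in>{0..} \<times> UNIV. y \<noteq> z \<and> dist y z < 1 / real (Suc k) \<longrightarrow> a < (case y of (t, x) \<Rightarrow> V t x))"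
        using neg unfolding eventually_at by blast
      then show ?thesis unfolding not_less[symmetric] by blast
    qed
    then obtain y where y: "\<And>k. y k \<in> {0..} \<times> UNIV" "\<And>k. dist (y k) z < 1 / real (Suc k)"
      "\<And>k. (case y k of (t, x) \<Rightarrow> V t x) \<le> a" by metis
    have "(\<lambda>k. dist (y k) z) \<longlonglongrightarrow> 0"
      by (rule Lim_null_comparison[of _ "\<lambda>k. 1 / real (Suc k)"])
        (use y(2) LIMSEQ_Suc[OF lim_1_over_n] in \<open>auto intro!: always_eventually less_imp_le\<close>)
    then have lim: "y \<longlonglongrightarrow> z" by (rule tendsto_dist_iff[THEN iffD2])
    have fin: "a < \<infinity>" using order.strict_trans2[OF a top_greatest] by simp
    obtain v where v: "integrable lborel v" "cost L t x v + \<phi> (x + prim v t) \<le> a"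
    proof (rule limit_trajectory[of "\<lambda>k. fst (y k)" t "\<lambda>k. snd (y k)" x a])
      show "0 \<le> fst (y k)" for k using y(1)[of k] by auto
      show "(\<lambda>k. fst (y k)) \<longlonglongrightarrow> t" "(\<lambda>k. snd (y k)) \<longlonglongrightarrow> x"
        using tendsto_fst[OF lim] tendsto_snd[OF lim] by (simp_all add: tx)
      show "V (fst (y k)) (snd (y k)) < a + ennreal (1 / real (Suc k))" for k
        using y(3)[of k] by (intro less_add_inverse_Suc fin) (auto simp: split_beta)
    qed (use fin in auto)
    then have "V t x \<le> a" using value_function_le_cost[OF v(1), of L \<phi> t x] by simp
    with a tx show False by simp
  qed
qed

end

subsection \<open>Changes of clock\<close>

lemma prim_diff_supp:
  fixes f :: "real \<Rightarrow> 'a::euclidean_space"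
  assumes f: "integrable lborel f" and supp: "\<And>s. s < 0 \<Longrightarrow> f s = 0" and ab: "a \<le> b"
  shows "prim f b - prim f a = (LINT s:{a<..b}|lborel. f s)"
proof -
  have *: "prim f c = (LINT s:{..c}|lborel. f s)" for c
    unfolding prim_def set_lebesgue_integral_def
  proof (intro Bochner_Integration.integral_cong refl)
    fix s show "indicator {0..c} s *\<^sub>R f s = indicator {..c} s *\<^sub>R f s"
      by (cases "s < 0") (auto simp: indicator_def supp)
  qed
  have "{..b} = {..a} \<union> {a<..b}" "{..a} \<inter> {a<..b} = {}" using ab by auto
  then have "prim f b = prim f a + (LINT s:{a<..b}|lborel. f s)"
    unfolding *
    using set_integral_Un[of "{..a}" "{a<..b}" lborel f] set_integrable_of_integrable[OF f]
    by simp
  then show ?thesis by simp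
qed

text \<open>\<open>1 + \<mu>\<close> is the rate of a new clock with respect to the old one. The
  rates 2 and 1/2 mean half and double speed; total 0 keeps the horizon \<open>t\<close>.\<close>

locale clock =
  fixes \<mu> :: "real \<Rightarrow> real" and t :: real
  assumes meas [measurable]: "\<mu> \<in> borel_measurable borel"
    and bounds: "-1/2 \<le> \<mu> s" "\<mu> s \<le> 1"
    and outside: "s \<notin> {0..t} \<Longrightarrow> \<mu> s = 0"
    and total: "prim \<mu> t = 0"
    and t: "0 \<le> t"
begin

definition "clk s = s + prim \<mu> s"

lemma integrable_\<mu>: "integrable lborel \<mu>"
proof (rule Bochner_Integration.integrable_bound[of _ "indicator {0..t} :: real \<Rightarrow> real"])
  show "AE s in lborel. norm (\<mu> s) \<le> norm (indicator {0..t} s :: real)"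
  proof (rule AE_I2)
    fix s show "norm (\<mu> s) \<le> norm (indicator {0..t} s :: real)"
      using bounds[of s] outside[of s] by (auto simp: indicator_def)
  qed
qed (use t in auto)

lemma set_integrable_density: "set_integrable lborel {a<..b} (\<lambda>s. 1 + \<mu> s)"
  using set_integrable_of_integrable[OF integrable_\<mu>, of "{a<..b}"]
  by (intro set_integral_add) (cases "a \<le> b"; auto simp: set_integrable_def)+

lemma clk_diff: assumes "a \<le> b" shows "clk b - clk a = (LINT s:{a<..b}|lborel. 1 + \<mu> s)"
proof -
  have "(LINT s:{a<..b}|lborel. 1 + \<mu> s) = (LINT s:{a<..b}|lborel. 1) + (LINT s:{a<..b}|lborel. \<mu> s)"
    using set_integrable_of_integrable[OF integrable_\<mu>, of "{a<..b}"] assms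
    by (intro set_integral_add) (auto simp: set_integrable_def)
  also have "(LINT s:{a<..b}|lborel. \<mu> s) = prim \<mu> b - prim \<mu> a"
    using t by (intro prim_diff_supp[symmetric] integrable_\<mu> assms outside) auto
  finally show ?thesis using assms by (simp add: clk_def set_lebesgue_integral_def)
qed

lemma clk_diff_ge: assumes "a \<le> b" shows "(b - a) / 2 \<le> clk b - clk a"
proof -
  have "(b - a) / 2 = (LINT s:{a<..b}|lborel. 1 / 2)" using assms by (simp add: set_lebesgue_integral_def)
  also have "\<dots> \<le> (LINT s:{a<..b}|lborel. 1 + \<mu> s)"
  proof (rule set_integral_mono[OF _ set_integrable_density])
    show "set_integrable lborel {a<..b} (\<lambda>s. 1 / 2 :: real)" using assms by (simp add: set_integrable_def)
    fix s show "1 / 2 \<le> 1 + \<mu> s" using bounds(1)[of s] by simp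
  qed
  finally show ?thesis using clk_diff[OF assms] by simp
qed

lemma strict_mono_clk: "strict_mono clk"
proof (rule strict_monoI)
  fix a b :: real assume "a < b" then show "clk a < clk b" using clk_diff_ge[of a b] by simp
qed

lemma clk_less_iff [simp]: "clk a < clk b \<longleftrightarrow> a < b" and clk_le_iff [simp]: "clk a \<le> clk b \<longleftrightarrow> a \<le> b"
  using strict_mono_clk by (simp_all add: strict_mono_less strict_mono_less_eq)

lemma clk_0 [simp]: "clk 0 = 0" and clk_t [simp]: "clk t = t"
  by (simp_all add: clk_def total)

lemma isCont_clk: "isCont clk s"
  unfolding clk_def by (intro continuous_intros isCont_prim integrable_\<mu>)

text \<open>The clock is the identity outside \<open>[0,t]\<close>, so \<open>min 0 \<tau>\<close>
  and \<open>max t \<tau>\<close> bracket \<open>\<tau>\<close> for the intermediate value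
  theorem.\<close>

lemma surj_clk: "\<exists>s. clk s = \<tau>"
proof -
  have "clk (min 0 \<tau>) \<le> \<tau>" by (simp add: clk_def prim_nonpos)
  moreover have "\<tau> \<le> clk (max t \<tau>)"
  proof -
    have "(LINT s:{t<..max t \<tau>}|lborel. \<mu> s) = 0"
      unfolding set_lebesgue_integral_def using outside
      by (intro integral_eq_zero_AE AE_I2) (auto simp: indicator_def)
    then have "prim \<mu> (max t \<tau>) = 0"
      using prim_diff_supp[OF integrable_\<mu>, of t "max t \<tau>"] outside t by (simp add: total)
    then show ?thesis by (simp add: clk_def)
  qed
  moreover have "min 0 \<tau> \<le> max t \<tau>" using t by simp
  ultimately show ?thesis
    using IVT[of clk "min 0 \<tau>" \<tau> "max t \<tau>"] isCont_clk by blast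
qed

definition "unclk \<tau> = (THE s. clk s = \<tau>)"

lemma clk_unclk [simp]: "clk (unclk \<tau>) = \<tau>"
proof -
  obtain s where s: "clk s = \<tau>" using surj_clk by blast
  then have "unclk \<tau> = s"
    unfolding unclk_def by (intro the_equality) (auto simp: strict_mono_eq[OF strict_mono_clk])
  with s show ?thesis by simp
qed

lemma unclk_clk [simp]: "unclk (clk s) = s"
  using clk_unclk[of "clk s"] unfolding strict_mono_eq[OF strict_mono_clk] .

lemma less_clk_iff: "\<tau> < clk s \<longleftrightarrow> unclk \<tau> < s" and clk_less_iff': "clk s < \<tau> \<longleftrightarrow> s < unclk \<tau>"
  and le_clk_iff: "\<tau> \<le> clk s \<longleftrightarrow> unclk \<tau> \<le> s" and clk_le_iff': "clk s \<le> \<tau> \<longleftrightarrow> s \<le> unclk \<tau>"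
  using clk_less_iff[of "unclk \<tau>" s] clk_less_iff[of s "unclk \<tau>"]
    clk_le_iff[of "unclk \<tau>" s] clk_le_iff[of s "unclk \<tau>"] unfolding clk_unclk by blast+

lemma measurable_clk [measurable]: "clk \<in> borel_measurable borel"
  by (intro borel_measurable_continuous_onI continuous_at_imp_continuous_on ballI isCont_clk)

lemma measurable_unclk [measurable]: "unclk \<in> borel_measurable borel"
  by (rule borel_measurable_mono) (auto simp: mono_def simp flip: le_clk_iff)

text \<open>The substitution rule as an identity of measures: the weight of the preimage of an
  interval is an increment of the clock, hence the length of the interval. As \<open>\<mu>\<close>
  is merely measurable, this avoids pointwise derivatives of the clock.\<close>

lemma distr_clk: "distr (density lborel (\<lambda>s. ennreal (1 + \<mu> s))) borel clk = lborel"
proof (rule lborel_eqI[symmetric])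
  fix l u :: real assume lu: "\<And>b. b \<in> Basis \<Longrightarrow> l \<bullet> b \<le> u \<bullet> b"
  then have lu: "l \<le> u" by simp
  define a b where "a = unclk l" "b = unclk u"
  have ab: "a \<le> b" using lu unfolding a_b_def le_clk_iff[symmetric] by simp
  have "emeasure (distr (density lborel (\<lambda>s. ennreal (1 + \<mu> s))) borel clk) (box l u) =
     emeasure (density lborel (\<lambda>s. ennreal (1 + \<mu> s))) {a<..<b}"
    by (subst emeasure_distr) (auto intro!: arg_cong2[where f=emeasure] simp: box_real less_clk_iff clk_less_iff' a_b_def)
  also have "\<dots> = (\<integral>\<^sup>+s. ennreal (1 + \<mu> s) * indicator {a<..<b} s \<partial>lborel)"
    by (subst emeasure_density) auto
  also have "\<dots> = (\<integral>\<^sup>+s. ennreal (indicator {a<..b} s *\<^sub>R (1 + \<mu> s)) \<partial>lborel)"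
    by (rule nn_integral_cong_AE, use AE_lborel_singleton[of b] in eventually_elim) (auto simp: indicator_def)
  also have "\<dots> = ennreal (LINT s:{a<..b}|lborel. 1 + \<mu> s)"
    unfolding set_lebesgue_integral_def
  proof (rule nn_integral_eq_integral)
    show "integrable lborel (\<lambda>s. indicator {a<..b} s *\<^sub>R (1 + \<mu> s))"
      using set_integrable_density by (simp add: set_integrable_def)
    show "AE s in lborel. 0 \<le> indicator {a<..b} s *\<^sub>R (1 + \<mu> s)"
    proof (rule AE_I2)
      fix s show "0 \<le> indicator {a<..b} s *\<^sub>R (1 + \<mu> s)" using bounds(1)[of s] by simp
    qed
  qed
  also have "\<dots> = ennreal (u - l)" unfolding clk_diff[OF ab, symmetric] by (simp add: a_b_def)
  finally show "emeasure (distr (density lborel (\<lambda>s. ennreal (1 + \<mu> s))) borel clk) (box l u) = (\<Prod>b\<in>Basis. (u - l) \<bullet> b)"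
    by simp
qed simp

lemma nn_integral_clk:
  assumes [measurable]: "f \<in> borel_measurable borel"
  shows "(\<integral>\<^sup>+\<tau>. f \<tau> \<partial>lborel) = (\<integral>\<^sup>+s. ennreal (1 + \<mu> s) * f (clk s) \<partial>lborel)"
  by (subst distr_clk[symmetric], subst nn_integral_distr, simp, simp, subst nn_integral_density) auto

lemma integrable_clk:
  fixes f :: "real \<Rightarrow> 'a::euclidean_space"
  assumes [measurable]: "f \<in> borel_measurable borel"
  shows "integrable lborel f \<longleftrightarrow> integrable lborel (\<lambda>s. (1 + \<mu> s) *\<^sub>R f (clk s))"
proof -
  have nn: "0 \<le> 1 + \<mu> s" for s using bounds(1)[of s] by simp
  show ?thesis
    by (subst (1) distr_clk[symmetric], subst integrable_distr_eq, simp, simp, subst integrable_density)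
      (auto simp: nn)
qed

lemma integral_clk:
  fixes f :: "real \<Rightarrow> 'a::euclidean_space"
  assumes [measurable]: "f \<in> borel_measurable borel"
  shows "(LINT \<tau>|lborel. f \<tau>) = (LINT s|lborel. (1 + \<mu> s) *\<^sub>R f (clk s))"
proof -
  have nn: "0 \<le> 1 + \<mu> s" for s using bounds(1)[of s] by simp
  show ?thesis
    by (subst (1) distr_clk[symmetric], subst integral_distr, simp, simp, subst integral_density)
      (auto simp: nn)
qed

text \<open>\<open>w\<close> divides the velocity by the clock rate; by substitution its primitive
  is the old curve read on the new clock.\<close>

lemma reparametrize:
  fixes v :: "real \<Rightarrow> 'a::euclidean_space"
  assumes v: "integrable lborel v"
  obtains w where "integrable lborel w" "prim w t = prim v t"
    "\<And>\<tau>. \<tau> \<in> {0..t} \<Longrightarrow> prim w \<tau> = prim v (unclk \<tau>)"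
    "\<And>s. w (clk s) = (1 / (1 + \<mu> s)) *\<^sub>R v s"
proof -
  have [measurable]: "v \<in> borel_measurable borel" using v by auto
  define w where "w \<tau> = (1 / (1 + \<mu> (unclk \<tau>))) *\<^sub>R v (unclk \<tau>)" for \<tau>
  have [measurable]: "w \<in> borel_measurable borel" unfolding w_def by measurable
  have nz: "1 + \<mu> s \<noteq> 0" for s using bounds(1)[of s] by simp
  have w_clk: "w (clk s) = (1 / (1 + \<mu> s)) *\<^sub>R v s" for s by (simp add: w_def)
  have w: "integrable lborel w"
    using v by (subst integrable_clk) (simp_all add: w_clk nz)
  have prim: "prim w \<tau> = prim v (unclk \<tau>)" for \<tau>
  proof -
    have "prim w \<tau> = (LINT s|lborel. (1 + \<mu> s) *\<^sub>R indicator {0..\<tau>} (clk s) *\<^sub>R w (clk s))"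
      unfolding prim_def set_lebesgue_integral_def by (rule integral_clk) measurable
    also have "\<dots> = prim v (unclk \<tau>)"
      unfolding prim_def set_lebesgue_integral_def
    proof (intro Bochner_Integration.integral_cong refl)
      fix s
      have "0 \<le> clk s \<longleftrightarrow> 0 \<le> s" using clk_le_iff[of 0 s] by (simp del: clk_le_iff)
      then show "(1 + \<mu> s) *\<^sub>R indicator {0..\<tau>} (clk s) *\<^sub>R w (clk s) = indicator {0..unclk \<tau>} s *\<^sub>R v s"
        by (auto simp: indicator_def clk_le_iff' w_clk nz)
    qed
    finally show ?thesis .
  qed
  have "unclk t = t" using unclk_clk[of t] by simp
  then show ?thesis using prim w w_clk by (intro that[of w]) auto
qed

end

context lagrangian
begin

text \<open>Both trajectories pass through the same points, so after substitution \<open>L\<close>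
  is evaluated at the positions of the original one, and the costs can be compared for each
  \<open>s\<close> separately.\<close>

lemma cost_reparametrize:
  assumes "clock \<mu> t" and v: "integrable lborel v"
  obtains w where "integrable lborel w" "prim w t = prim v t"
    "cost L t x w = (\<integral>\<^sup>+s\<in>{0..t}. ennreal ((1 + \<mu> s) * L (x + prim v s) ((1 / (1 + \<mu> s)) *\<^sub>R v s)) \<partial>lborel)"
proof -
  interpret clock \<mu> t by fact
  obtain w where w: "integrable lborel w" "prim w t = prim v t"
    "\<And>\<tau>. \<tau> \<in> {0..t} \<Longrightarrow> prim w \<tau> = prim v (unclk \<tau>)"
    "\<And>s. w (clk s) = (1 / (1 + \<mu> s)) *\<^sub>R v s"
    using reparametrize[OF v] by metis
  have [measurable]: "w \<in> borel_measurable borel" "prim w \<in> borel_measurable borel"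
    using w(1) borel_measurable_prim by auto
  have iff: "clk s \<in> {0..t} \<longleftrightarrow> s \<in> {0..t}" for s
    using clk_le_iff[of 0 s] clk_le_iff[of s t] by (simp del: clk_le_iff)
  have "cost L t x w = (\<integral>\<^sup>+s. ennreal (1 + \<mu> s) * (ennreal (L (x + prim w (clk s)) (w (clk s))) * indicator {0..t} (clk s)) \<partial>lborel)"
    unfolding cost_def by (rule nn_integral_clk) measurable
  also have "\<dots> = (\<integral>\<^sup>+s\<in>{0..t}. ennreal ((1 + \<mu> s) * L (x + prim v s) ((1 / (1 + \<mu> s)) *\<^sub>R v s)) \<partial>lborel)"
  proof (intro nn_integral_cong)
    fix s
    have nn: "0 \<le> 1 + \<mu> s" using bounds(1)[of s] by simp
    show "ennreal (1 + \<mu> s) * (ennreal (L (x + prim w (clk s)) (w (clk s))) * indicator {0..t} (clk s)) =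
      ennreal ((1 + \<mu> s) * L (x + prim v s) ((1 / (1 + \<mu> s)) *\<^sub>R v s)) * indicator {0..t} s"
      using iff[of s] w(3)[of "clk s"] w(4)[of s] nn
      by (cases "s \<in> {0..t}") (auto simp: ennreal_mult' nonneg)
  qed
  finally show ?thesis by (rule that[OF w(1,2)])
qed

end

subsection \<open>The contingent inequality\<close>

context lagrangian
begin

text \<open>If the velocity were unbounded, then slowing down where it is large and recovering the lost
  time on a set \<open>E\<close> where \<open>L\<close> stays bounded at the doubled velocity would lower the cost.\<close>

lemma minimizer_bounded_velocity:
  assumes v: "integrable lborel v" and t: "0 < t" and fin: "cost L t x v < \<infinity>"
    and bdd: "\<forall>x0. \<exists>M>0. \<exists>r>0. \<forall>x\<in>cball x0 r. \<forall>u\<in>cball 0 r. L x u \<le> M"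
    and min: "\<And>w. integrable lborel w \<Longrightarrow> prim w t = prim v t \<Longrightarrow> cost L t x v \<le> cost L t x w"
  obtains R where "AE s in lborel. s \<in> {0..t} \<longrightarrow> norm (v s) \<le> R"
proof -
  have [measurable]: "v \<in> borel_measurable borel" "prim v \<in> borel_measurable borel"
    using v borel_measurable_prim by auto
  define y where "y s = x + prim v s" for s
  have [measurable]: "y \<in> borel_measurable borel" unfolding y_def by measurable
  have "continuous_on {0..t} y" unfolding y_def by (intro continuous_intros continuous_on_prim v)
  then have "compact (y ` {0..t})" by (intro compact_continuous_image) auto
  then obtain M r where M: "M > 0" and r: "r > 0"
    and Mr: "\<And>x u. x \<in> y ` {0..t} \<Longrightarrow> norm u \<le> r \<Longrightarrow> L x u \<le> M"
    using locally_bounded_imp_bounded_on_compact[OF bdd] by metis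
  have finite_sub: "emeasure lborel A < \<infinity>" if "A \<subseteq> {0..t}" for A
  proof -
    have "emeasure lborel A \<le> emeasure lborel {0..t}" by (rule emeasure_mono[OF that]) simp
    then show ?thesis using t by (simp add: le_less_trans)
  qed
  \<comment> \<open>Times at which speeding up is affordable. These sets exhaust
    \<open>[0,t]\<close>, so one of them has positive measure.\<close>
  define E where "E n = {s\<in>{0..t}. L (y s) (2 *\<^sub>R v s) \<le> real n \<and> norm (v s) \<le> real n}" for n
  have [measurable]: "E n \<in> sets borel" for n unfolding E_def by measurable
  have "incseq E" unfolding incseq_def E_def by force
  moreover have "(\<Union>n. E n) = {0..t}"
  proof -
    have "\<exists>n. s \<in> E n" if "s \<in> {0..t}" for s
    proof -
      obtain n :: nat where "max (L (y s) (2 *\<^sub>R v s)) (norm (v s)) \<le> real n"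
        using real_arch_simple by blast
      with that show ?thesis by (auto simp: E_def)
    qed
    then show ?thesis by (auto simp: E_def)
  qed
  moreover have "range E \<subseteq> sets lborel" by auto
  ultimately have "(\<lambda>n. measure lborel (E n)) \<longlonglongrightarrow> measure lborel {0..t}"
    using Lim_measure_incseq[of E lborel] t by auto
  then have "\<forall>\<^sub>F n in sequentially. 0 < measure lborel (E n)"
    using t by (intro order_tendstoD(1)) auto
  then obtain N where N: "0 < measure lborel (E N)" by (auto simp: eventually_sequentially)
  define m where "m = measure lborel (E N)"
  \<comment> \<open>Chosen so that half speed saves at least \<open>N + 1\<close> per unit of time
    lost, one more than the price \<open>N\<close> of regaining a unit on
    \<open>E N\<close>.\<close>
  define K where "K = (2 * M + real N + 1) / r"
  have rK: "r * K = 2 * M + real N + 1" using r by (simp add: K_def)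
  have K: "K \<ge> 0" using M r by (simp add: K_def)
  obtain R0 where R0: "R0 > 0" "\<And>u. norm u \<ge> R0 \<Longrightarrow> K * norm u \<le> \<Theta> u" using superlinear_norm by blast
  define A where "A n = {s\<in>{0..t}. real n < norm (v s)}" for n
  have [measurable]: "A n \<in> sets borel" for n unfolding A_def by measurable
  have "decseq A" unfolding decseq_def A_def by force
  moreover have "(\<Inter>n. A n) = {}"
  proof -
    have "\<exists>n. s \<notin> A n" for s
      using real_arch_simple[of "norm (v s)"] by (auto simp: A_def not_less)
    then show ?thesis by auto
  qed
  moreover have "emeasure lborel (A n) \<noteq> \<infinity>" for n
  proof -
    have "A n \<subseteq> {0..t}" by (auto simp: A_def)
    from finite_sub[OF this] show ?thesis by (rule less_imp_neq)
  qed
  moreover have "range A \<subseteq> sets lborel" by auto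
  ultimately have "(\<lambda>n. measure lborel (A n)) \<longlonglongrightarrow> measure lborel ({} :: real set)"
    using Lim_measure_decseq[of A lborel] by auto
  then have "\<forall>\<^sub>F n in sequentially. measure lborel (A n) < m / 2"
    using N by (intro order_tendstoD(2)) (auto simp: m_def)
  then obtain n0 where n0: "\<And>n. n \<ge> n0 \<Longrightarrow> measure lborel (A n) < m / 2" by (auto simp: eventually_sequentially)
  obtain n1 :: nat where n1: "max R0 (max (2 * r) (real N)) \<le> real n1" using real_arch_simple by blast
  \<comment> \<open>\<open>n0\<close> makes the set of high speeds small; \<open>n1\<close> puts
    those speeds above \<open>R0\<close> for the growth bound, \<open>2 * r\<close> for
    \<open>half_speed_le\<close>, and \<open>N\<close> for disjointness from
    \<open>E N\<close>.\<close>
  define n where "n = max n0 n1"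
  define B where "B = A n"
  define \<alpha> where "\<alpha> = measure lborel B"
  have \<alpha>: "0 \<le> \<alpha>" "\<alpha> < m / 2" using n0[of n] by (auto simp: \<alpha>_def B_def n_def)
  have [measurable]: "B \<in> sets borel" by (simp add: B_def)
  have Bt: "B \<subseteq> {0..t}" and Et: "E N \<subseteq> {0..t}" by (auto simp: B_def A_def E_def)
  have large: "R0 \<le> norm (v s)" "2 * r < norm (v s)" "real N < norm (v s)" if "s \<in> B" for s
    using that n1 by (auto simp: B_def A_def n_def)
  have disj: "B \<inter> E N = {}" using large(3) by (force simp: E_def)
  \<comment> \<open>The time \<open>\<alpha>\<close> lost on \<open>B\<close> equals the time
    \<open>\<delta> * m\<close> regained on \<open>E N\<close>; \<open>\<alpha> < m / 2\<close> puts
    \<open>\<delta>\<close> in the range of \<open>faster_le\<close>.\<close>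
  define \<delta> where "\<delta> = \<alpha> / m"
  have m: "m > 0" using N by (simp add: m_def)
  have \<delta>: "0 \<le> \<delta>" "\<delta> \<le> 1 / 2" using \<alpha> m by (auto simp: \<delta>_def field_simps)
  define \<mu> where "\<mu> s = indicator B s - \<delta> * indicator (E N) s" for s
  have iB: "integrable lborel (indicator B :: real \<Rightarrow> real)" and iE: "integrable lborel (indicator (E N) :: real \<Rightarrow> real)"
    using finite_sub[OF Bt] finite_sub[OF Et] by auto
  have eB: "emeasure lborel B = ennreal \<alpha>" and eE: "emeasure lborel (E N) = ennreal m"
    using finite_sub[OF Bt] finite_sub[OF Et] by (auto simp: \<alpha>_def m_def emeasure_eq_ennreal_measure top.not_eq_extremum)
  have "clock \<mu> t"
  proof
    show "\<mu> \<in> borel_measurable borel" unfolding \<mu>_def by measurable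
    show "-1/2 \<le> \<mu> s" "\<mu> s \<le> 1" for s using \<delta> disj by (auto simp: \<mu>_def indicator_def)
    show "\<mu> s = 0" if "s \<notin> {0..t}" for s using that Bt Et by (auto simp: \<mu>_def indicator_def)
    have "prim \<mu> t = (LINT s|lborel. indicator B s - \<delta> * indicator (E N) s)"
      unfolding prim_def set_lebesgue_integral_def \<mu>_def
      using Bt Et by (intro Bochner_Integration.integral_cong) (auto simp: indicator_def)
    also have "\<dots> = \<alpha> - \<delta> * m" using iB iE by (simp add: \<alpha>_def m_def)
    finally show "prim \<mu> t = 0" using m by (simp add: \<delta>_def)
  qed (use t in auto)
  then obtain w where w: "integrable lborel w" "prim w t = prim v t" and w3':
    "cost L t x w = (\<integral>\<^sup>+s\<in>{0..t}. ennreal ((1 + \<mu> s) * L (x + prim v s) ((1 / (1 + \<mu> s)) *\<^sub>R v s)) \<partial>lborel)"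
    by (rule cost_reparametrize[OF _ v, of \<mu> t x])
  note w3 = w3'[folded y_def]
  have pw: "(1 + \<mu> s) * L (y s) ((1 / (1 + \<mu> s)) *\<^sub>R v s) + (real N + 1) * indicator B s
      \<le> L (y s) (v s) + \<delta> * real N * indicator (E N) s" if s: "s \<in> {0..t}" for s
  proof -
    consider "s \<in> B" | "s \<in> E N" | "s \<notin> B" "s \<notin> E N" by blast
    then show ?thesis
    proof cases
      case 1
      then have sE: "s \<notin> E N" using disj by blast
      have "2 * L (y s) ((1/2) *\<^sub>R v s) \<le> L (y s) (v s) + 2 * M - r * K"
      proof (rule half_speed_le[OF _ r large(2)[OF 1] K])
        show "norm u \<le> r \<Longrightarrow> L (y s) u \<le> M" for u using s by (intro Mr) auto
        show "K * norm (v s) \<le> L (y s) (v s)"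
          using R0(2)[OF large(1)[OF 1]] \<Theta>_le[of "v s" "y s"] by simp
      qed
      then show ?thesis using 1 sE rK by (simp add: \<mu>_def)
    next
      case 2
      then have sB: "s \<notin> B" using disj by blast
      have "(1 - \<delta>) * L (y s) ((1 / (1 - \<delta>)) *\<^sub>R v s) \<le> L (y s) (v s) + \<delta> * L (y s) (2 *\<^sub>R v s)"
        by (rule faster_le[OF \<delta>])
      also have "\<delta> * L (y s) (2 *\<^sub>R v s) \<le> \<delta> * real N"
        using 2 \<delta> by (intro mult_left_mono) (auto simp: E_def)
      finally show ?thesis using 2 sB by (simp add: \<mu>_def)
    qed (simp add: \<mu>_def)
  qed
  have nn: "0 \<le> 1 + \<mu> s" for s using \<delta> disj by (auto simp: \<mu>_def indicator_def)
  have "cost L t x w + ennreal (real N + 1) * ennreal \<alpha> =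
     (\<integral>\<^sup>+s. ennreal ((1 + \<mu> s) * L (y s) ((1 / (1 + \<mu> s)) *\<^sub>R v s)) * indicator {0..t} s + ennreal (real N + 1) * indicator B s \<partial>lborel)"
    unfolding w3 by (subst nn_integral_add) (auto simp: nn_integral_cmult_indicator eB \<mu>_def)
  also have "\<dots> \<le> (\<integral>\<^sup>+s. ennreal (L (y s) (v s)) * indicator {0..t} s + ennreal (\<delta> * real N) * indicator (E N) s \<partial>lborel)"
  proof (rule nn_integral_mono)
    fix s
    show "ennreal ((1 + \<mu> s) * L (y s) ((1 / (1 + \<mu> s)) *\<^sub>R v s)) * indicator {0..t} s + ennreal (real N + 1) * indicator B s
      \<le> ennreal (L (y s) (v s)) * indicator {0..t} s + ennreal (\<delta> * real N) * indicator (E N) s"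
    proof (cases "s \<in> {0..t}")
      case True
      have "ennreal ((1 + \<mu> s) * L (y s) ((1 / (1 + \<mu> s)) *\<^sub>R v s)) * indicator {0..t} s + ennreal (real N + 1) * indicator B s
        = ennreal ((1 + \<mu> s) * L (y s) ((1 / (1 + \<mu> s)) *\<^sub>R v s) + (real N + 1) * indicator B s)"
        using True nn[of s] nonneg by (subst ennreal_plus) (auto simp: indicator_def)
      also have "\<dots> \<le> ennreal (L (y s) (v s) + \<delta> * real N * indicator (E N) s)"
        by (rule ennreal_leI[OF pw[OF True]])
      also have "\<dots> = ennreal (L (y s) (v s)) * indicator {0..t} s + ennreal (\<delta> * real N) * indicator (E N) s"
        using True \<delta>(1) nonneg by (subst ennreal_plus) (auto simp: indicator_def)
      finally show ?thesis .
    next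
      case False
      then have "s \<notin> B" "s \<notin> E N" using Bt Et by blast+
      with False show ?thesis by simp
    qed
  qed
  also have "\<dots> = cost L t x v + ennreal (\<delta> * real N) * ennreal m"
    unfolding cost_def y_def[symmetric] by (subst nn_integral_add) (auto simp: nn_integral_cmult_indicator eE)
  also have "\<dots> = cost L t x v + ennreal (real N * \<alpha>)"
  proof -
    have "ennreal (\<delta> * real N) * ennreal m = ennreal (\<delta> * real N * m)"
      using \<delta>(1) m by (simp only: ennreal_mult'' less_imp_le)
    also have "\<delta> * real N * m = real N * \<alpha>" using m by (simp add: \<delta>_def)
    finally show ?thesis by simp
  qed
  finally have "cost L t x w + ennreal ((real N + 1) * \<alpha>) \<le> cost L t x v + ennreal (real N * \<alpha>)"
    unfolding ennreal_mult''[OF \<alpha>(1), of "real N + 1"] .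
  with min[OF w(1,2)] have "cost L t x v + ennreal ((real N + 1) * \<alpha>) \<le> cost L t x v + ennreal (real N * \<alpha>)"
    by (meson add_right_mono order_trans)
  \<comment> \<open>Finite cost permits the cancellation; savings \<open>(N + 1) * \<alpha>\<close>
    against expenses \<open>N * \<alpha>\<close> then force \<open>\<alpha> = 0\<close>.\<close>
  then have "ennreal ((real N + 1) * \<alpha>) \<le> ennreal (real N * \<alpha>)"
    using fin by (auto simp: ennreal_add_left_cancel_le)
  then have "(real N + 1) * \<alpha> \<le> real N * \<alpha>" using \<alpha>(1) by (simp add: ennreal_le_iff)
  then have "\<alpha> = 0" using \<alpha>(1) by (simp add: algebra_simps)
  then have "emeasure lborel B = 0" using eB by simp
  then have "AE s in lborel. s \<notin> B" by (intro AE_not_in) (auto simp: null_sets_def)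
  then have "AE s in lborel. s \<in> {0..t} \<longrightarrow> norm (v s) \<le> real n"
    by eventually_elim (auto simp: B_def A_def)
  then show ?thesis by (rule that)
qed

section \<open>Dynamic programming along a minimizer\<close>

lemma cost_shift:
  assumes v: "integrable lborel v" and h: "0 \<le> h" "h \<le> t"
  shows "integrable lborel (\<lambda>s. v (h + s))" "prim (\<lambda>s. v (h + s)) (t - h) = prim v t - prim v h"
    "cost L h x v + cost L (t - h) (x + prim v h) (\<lambda>s. v (h + s)) \<le> cost L t x v"
proof -
  have [measurable]: "v \<in> borel_measurable borel" "prim v \<in> borel_measurable borel"
    using v borel_measurable_prim by auto
  show int: "integrable lborel (\<lambda>s. v (h + s))" by (rule integrable_translate[OF v])
  have prim: "prim (\<lambda>s. v (h + s)) s = prim v (h + s) - prim v h" if "0 \<le> s" for s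
  proof -
    have "prim v (h + s) - prim v h = (LINT \<sigma>:{h<..h + s}|lborel. v \<sigma>)"
      using that h by (intro prim_diff v) auto
    also have "\<dots> = (LINT \<sigma>:{0<..s}|lborel. v (h + \<sigma>))"
      unfolding set_lebesgue_integral_def
      by (subst integral_translate[of "\<lambda>\<sigma>. indicator {h<..h + s} \<sigma> *\<^sub>R v \<sigma>" h, symmetric])
        (auto intro!: Bochner_Integration.integral_cong simp: indicator_def)
    also have "\<dots> = prim (\<lambda>s. v (h + s)) s" using prim_diff[OF int order_refl that] by simp
    finally show ?thesis by simp
  qed
  show "prim (\<lambda>s. v (h + s)) (t - h) = prim v t - prim v h" using prim[of "t - h"] h by simp
  have "cost L (t - h) (x + prim v h) (\<lambda>s. v (h + s)) =
     (\<integral>\<^sup>+s. ennreal (L (x + prim v (h + s)) (v (h + s))) * indicator {h..t} (h + s) \<partial>lborel)"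
    unfolding cost_def by (intro nn_integral_cong) (auto simp: prim indicator_def)
  also have "\<dots> = (\<integral>\<^sup>+s. ennreal (L (x + prim v s) (v s)) * indicator {h..t} s \<partial>lborel)"
    using nn_integral_real_affine[of "\<lambda>s. ennreal (L (x + prim v s) (v s)) * indicator {h..t} s" 1 h] by simp
  finally have "cost L h x v + cost L (t - h) (x + prim v h) (\<lambda>s. v (h + s)) =
     (\<integral>\<^sup>+s. ennreal (L (x + prim v s) (v s)) * indicator {0..h} s + ennreal (L (x + prim v s) (v s)) * indicator {h..t} s \<partial>lborel)"
    unfolding cost_def by (subst nn_integral_add) auto
  also have "\<dots> \<le> cost L t x v"
    unfolding cost_def
    by (rule nn_integral_mono_AE, use AE_lborel_singleton[of h] in eventually_elim) (use h in \<open>auto simp: indicator_def\<close>)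
  finally show "cost L h x v + cost L (t - h) (x + prim v h) (\<lambda>s. v (h + s)) \<le> cost L t x v" .
qed

text \<open>The minorant at \<open>(x, u)\<close> is integrated over \<open>[0, h n]\<close>, where
  the path stays near \<open>x\<close> and the mean velocity is near \<open>u\<close>. No
  convergence of \<open>v\<close> itself at time 0 is available.\<close>

lemma eventually_average_cost_ge:
  assumes v: "integrable lborel v" and h: "\<And>n. h n > 0" "h \<longlonglongrightarrow> 0"
    and u: "(\<lambda>n. prim v (h n) /\<^sub>R h n) \<longlonglongrightarrow> u" and e: "e > 0"
  shows "\<forall>\<^sub>F n in sequentially. ennreal (h n) * ennreal (L x u - e) \<le> cost L (h n) x v"
proof -
  obtain p a \<delta> where minor: "\<delta> > 0" "a + p \<bullet> u > L x u - e"
    "\<And>x' u. dist x' x < \<delta> \<Longrightarrow> a + p \<bullet> u \<le> L x' u"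
    using affine_minorant[OF e, of x u] by metis
  have "(\<lambda>n. a + p \<bullet> (prim v (h n) /\<^sub>R h n)) \<longlonglongrightarrow> a + p \<bullet> u" by (intro tendsto_intros u)
  then have ev1: "\<forall>\<^sub>F n in sequentially. L x u - e < a + p \<bullet> (prim v (h n) /\<^sub>R h n)"
    using minor(2) by (rule order_tendstoD(1))
  obtain d where d: "d > 0" "\<And>\<sigma>. dist \<sigma> 0 < d \<Longrightarrow> dist (prim v \<sigma>) (prim v 0) < \<delta>"
    using isCont_prim[OF v, of 0] minor(1) unfolding continuous_at_eps_delta by meson
  have "\<forall>\<^sub>F n in sequentially. h n < d" using h(2) d(1) by (rule order_tendstoD(2))
  with ev1 show ?thesis
  proof eventually_elim
    case (elim n)
    have "ennreal (h n) * ennreal (L x u - e) \<le> ennreal (h n) * ennreal (a + p \<bullet> ((prim v (0 + h n) - prim v 0) /\<^sub>R h n))"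
      using elim(1) by (intro mult_left_mono ennreal_leI) auto
    also have "\<dots> \<le> (\<integral>\<^sup>+\<sigma>\<in>{0..0 + h n}. ennreal (L (x + prim v \<sigma>) (v \<sigma>)) \<partial>lborel)"
    proof (rule nn_integral_L_ge_affine[OF v order_refl h(1) minor(3)])
      fix \<sigma> assume "\<sigma> \<in> {0<..0 + h n}"
      then show "dist (x + prim v \<sigma>) x < \<delta>" using d(2)[of \<sigma>] elim(2) by (simp add: dist_norm)
    qed
    finally show ?case by (simp add: cost_def)
  qed
qed

end

text \<open>A single sequence tending to the limit point bounds the liminf from above; here the time
  direction is kept at exactly -1.\<close>

lemma contingent_derivative_le:
  assumes h: "h \<longlonglongrightarrow> 0" "\<And>n. h n > 0" and q: "q \<longlonglongrightarrow> u"
    and le: "\<forall>\<^sub>F n in sequentially.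
      (enn2ereal (W (t - h n) (x + h n *\<^sub>R q n)) - enn2ereal (W t x)) / ereal (h n) \<le> c"
  shows "contingent_derivative W t x (-1) u \<le> c"
proof (rule ccontr)
  define f where "f = (\<lambda>(h, \<alpha>', v). (enn2ereal (W (t + h * \<alpha>') (x + h *\<^sub>R v)) - enn2ereal (W t x)) / ereal h)"
  assume "\<not> contingent_derivative W t x (-1) u \<le> c"
  then have "c < Liminf (at_right 0 \<times>\<^sub>F nhds (-1, u)) f"
    by (simp add: contingent_derivative_def f_def not_le)
  then have "\<forall>\<^sub>F z in at_right 0 \<times>\<^sub>F nhds (-1, u). c < f z" by (rule less_LiminfD)
  moreover have "filterlim (\<lambda>n. (h n, -1::real, q n)) (at_right 0 \<times>\<^sub>F nhds (-1, u)) sequentially"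
  proof (intro filterlim_Pair)
    show "filterlim h (at_right 0) sequentially"
      unfolding filterlim_at using h(1) less_imp_neq[OF h(2), symmetric] h(2) by auto
    show "filterlim (\<lambda>n. (-1::real, q n)) (nhds (-1, u)) sequentially"
      by (intro tendsto_Pair tendsto_const q)
  qed
  ultimately have "\<forall>\<^sub>F n in sequentially. c < f (h n, -1, q n)"
    by (rule eventually_compose_filterlim)
  with le have "\<forall>\<^sub>F n in sequentially. False"
    by eventually_elim (auto simp: f_def)
  then show False by simp
qed

locale bolza_bounded = bolza L \<Theta> \<phi> for L \<Theta> \<phi> +
  assumes bdd: "\<forall>x0. \<exists>M>0. \<exists>r>0. \<forall>x\<in>cball x0 r. \<forall>u\<in>cball 0 r. L x u \<le> M"
begin

lemma value_function_contingent:
  assumes t: "0 < t" and fin: "V t x < \<infinity>"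
  shows "\<exists>u. contingent_derivative V t x (-1) u \<le> ereal (- L x u)"
proof -
  obtain v where v: "integrable lborel v" "cost L t x v + \<phi> (x + prim v t) = V t x"
    using minimizer[of t x] t fin by auto
  have fin_cost: "cost L t x v < \<infinity>" and fin_end: "\<phi> (x + prim v t) < \<infinity>"
    using v(2) fin by (auto simp: ennreal_add_eq_top top.not_eq_extremum[symmetric])
  \<comment> \<open>Competitors share the endpoint of \<open>v\<close>, where the terminal cost is
    finite and cancels.\<close>
  have "cost L t x v \<le> cost L t x w" if w: "integrable lborel w" "prim w t = prim v t" for w
  proof -
    have "cost L t x v + \<phi> (x + prim v t) \<le> cost L t x w + \<phi> (x + prim v t)"
      unfolding v(2) using value_function_le_cost[OF w(1), of L \<phi> t x] w(2) by simp
    then show ?thesis using fin_end by (auto simp: ennreal_add_left_cancel_le add.commute)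
  qed
  from minimizer_bounded_velocity[OF v(1) t fin_cost bdd this]
  obtain R where R: "AE s in lborel. s \<in> {0..t} \<longrightarrow> norm (v s) \<le> R" by metis
  define h where "h n = t / real (Suc (Suc n))" for n
  have h: "h n > 0" "h n < t" for n using t by (auto simp: h_def field_simps add_pos_nonneg)
  have h0: "h \<longlonglongrightarrow> 0"
  proof -
    have "(\<lambda>n. t * inverse (real (Suc (Suc n)))) \<longlonglongrightarrow> t * 0"
      by (intro tendsto_intros LIMSEQ_Suc[OF LIMSEQ_inverse_real_of_nat])
    then show ?thesis by (simp add: h_def[abs_def] divide_inverse)
  qed
  define q where "q n = prim v (h n) /\<^sub>R h n" for n
  have "norm (q n) \<le> R" for n
  proof -
    have "norm (prim v (h n)) \<le> (LINT s:{0<..h n}|lborel. norm (v s))"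
      using norm_prim_diff_le[OF v(1) order_refl less_imp_le[OF h(1)], of n] by simp
    also have "\<dots> \<le> (LINT s:{0<..h n}|lborel. R)"
      unfolding set_lebesgue_integral_def
    proof (rule integral_mono_AE)
      show "integrable lborel (\<lambda>s. indicator {0<..h n} s *\<^sub>R norm (v s))"
        by (intro integrable_mult_indicator integrable_norm v) auto
      show "integrable lborel (\<lambda>s. indicator {0<..h n} s *\<^sub>R R)"
        using h(1)[of n] by (intro integrable_scaleR_left integrable_real_indicator) auto
      show "AE s in lborel. indicator {0<..h n} s *\<^sub>R norm (v s) \<le> indicator {0<..h n} s *\<^sub>R R"
        using R by eventually_elim (use h(2)[of n] in \<open>auto simp: indicator_def\<close>)
    qed
    also have "\<dots> = h n * R" using h(1)[of n] by (simp add: set_lebesgue_integral_def)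
    finally show ?thesis using h(1)[of n] by (simp add: q_def field_simps)
  qed
  then have "bounded (range q)" by (auto simp: bounded_iff)
  then obtain u \<rho> where \<rho>: "strict_mono (\<rho> :: nat \<Rightarrow> nat)" and u: "(q \<circ> \<rho>) \<longlonglongrightarrow> u"
    using bounded_imp_convergent_subsequence by blast
  define k where "k n = h (\<rho> n)" for n
  have k0: "k \<longlonglongrightarrow> 0" using LIMSEQ_subseq_LIMSEQ[OF h0 \<rho>] by (simp add: k_def[abs_def] o_def)
  have k: "k n > 0" "k n < t" for n using h by (auto simp: k_def)
  have qk: "(\<lambda>n. prim v (k n) /\<^sub>R k n) \<longlonglongrightarrow> u" using u by (simp add: q_def k_def o_def)
  \<comment> \<open>The direction \<open>u\<close> was fixed before \<open>e\<close>, so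
    \<open>e\<close> may tend to 0 afterwards.\<close>
  have "contingent_derivative V t x (-1) u \<le> ereal (- L x u + e)" if e: "e > 0" for e
  proof (rule contingent_derivative_le[OF k0 k(1) qk])
    show "\<forall>\<^sub>F n in sequentially. (enn2ereal (V (t - k n) (x + k n *\<^sub>R (prim v (k n) /\<^sub>R k n))) - enn2ereal (V t x)) / ereal (k n)
      \<le> ereal (- L x u + e)"
      using eventually_average_cost_ge[OF v(1) k(1) k0 qk e, of x]
    proof eventually_elim
      case (elim n)
      define X where "X = x + prim v (k n)"
      have X: "x + k n *\<^sub>R (prim v (k n) /\<^sub>R k n) = X" using k(1)[of n] by (simp add: X_def)
      note sh = cost_shift[OF v(1) less_imp_le[OF k(1)[of n]] less_imp_le[OF k(2)[of n]]]
      have "ennreal (k n * (L x u - e)) + V (t - k n) X \<le> cost L (k n) x v + V (t - k n) X"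
        using elim k(1)[of n] by (intro add_right_mono) (simp add: ennreal_mult')
      also have "V (t - k n) X \<le> cost L (t - k n) X (\<lambda>s. v (k n + s)) + \<phi> (x + prim v t)"
        using value_function_le_cost[OF sh(1), of L \<phi> "t - k n" X] by (simp add: sh(2) X_def)
      also have "cost L (k n) x v + (cost L (t - k n) X (\<lambda>s. v (k n + s)) + \<phi> (x + prim v t)) \<le> V t x"
        unfolding v(2)[symmetric] X_def add.assoc[symmetric] by (intro add_right_mono sh(3))
      finally have le: "ennreal (k n * (L x u - e)) + V (t - k n) X \<le> V t x" by (simp add: add_left_mono)
      have fin': "V (t - k n) X < \<infinity>"
        using le fin by (meson add_increasing le_less_trans order_refl zero_le)
      obtain a b where ab: "V (t - k n) X = ennreal a" "V t x = ennreal b" "0 \<le> a" "0 \<le> b"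
        using fin fin' by (metis ennreal_cases infinity_ennreal_def less_irrefl)
      have "k n * (L x u - e) + a \<le> b"
      \<comment> \<open>\<open>ennreal\<close> truncates a negative running term to 0; in that case
        the inequality for the values alone is already stronger.\<close>
      proof (cases "0 \<le> k n * (L x u - e)")
        case True
        then show ?thesis using le ab by (simp add: ennreal_plus[symmetric] ennreal_le_iff del: ennreal_plus)
      next
        case False
        then show ?thesis using le ab by (simp add: ennreal_neg)
      qed
      then have "(a - b) / k n \<le> - L x u + e"
        using k(1)[of n] by (simp add: field_simps)
      then show ?case using ab k(1)[of n] unfolding X by (simp add: enn2ereal_ennreal)
    qed
  qed
  then have "contingent_derivative V t x (-1) u \<le> ereal (- L x u) + ereal e" if "e > 0" for e
    using that unfolding plus_ereal.simps by blast
  then have "contingent_derivative V t x (-1) u \<le> ereal (- L x u)"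
    by (rule ereal_le_epsilon2) blast
  then show ?thesis by blast
qed

end

subsection \<open>Comparison with supersolutions\<close>

text \<open>A Brezis-Browder argument with dependent choice: each step realizes at least half of the
  length still attainable. A longer successor of the upper bound \<open>q\<close> would be
  attainable from every \<open>f i\<close>, although the remaining gap is halved each time. Only
  countable chains need upper bounds, so limits of sequences suffice.\<close>

lemma maximal_chain_reaches:
  fixes R :: "'p \<Rightarrow> 'p \<Rightarrow> bool" and len :: "'p \<Rightarrow> real"
  assumes start: "D p0" and bound: "\<And>p. D p \<Longrightarrow> len p \<le> T"
    and refl: "\<And>p. D p \<Longrightarrow> R p p"
    and trans: "\<And>p q r. D p \<Longrightarrow> D q \<Longrightarrow> D r \<Longrightarrow> R p q \<Longrightarrow> R q r \<Longrightarrow> R p r"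
    and mono: "\<And>p q. R p q \<Longrightarrow> len p \<le> len q"
    and ext: "\<And>p. D p \<Longrightarrow> len p < T \<Longrightarrow> \<exists>q. D q \<and> R p q \<and> len p < len q"
    and chain: "\<And>f :: nat \<Rightarrow> 'p. (\<And>i. D (f i)) \<Longrightarrow> (\<And>i j. i \<le> j \<Longrightarrow> R (f i) (f j)) \<Longrightarrow> \<exists>q. D q \<and> (\<forall>i. R (f i) q)"
  obtains q where "D q" "len q = T"
proof -
  define S where "S p = Sup (len ` {q. D q \<and> R p q})" for p
  have bdd: "bdd_above (len ` {q. D q \<and> R p q})" for p using bound by (auto simp: bdd_above_def)
  have upper: "len q \<le> S p" if "D q" "R p q" for p q
    unfolding S_def using that by (intro cSup_upper bdd) auto
  have half: "\<exists>q. D q \<and> R p q \<and> (len p + S p) / 2 \<le> len q" if p: "D p" for p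
  proof (cases "len p < S p")
    case True
    then have "(len p + S p) / 2 < S p" by simp
    then obtain l where "l \<in> len ` {q. D q \<and> R p q}" "(len p + S p) / 2 < l"
      unfolding S_def using less_cSupE[of _ "len ` {q. D q \<and> R p q}"] p refl by blast
    then show ?thesis by (auto intro: less_imp_le)
  next
    case False
    then show ?thesis using p refl by (intro exI[of _ p]) auto
  qed
  obtain f where f: "\<And>i::nat. D (f i)" "\<And>i. R (f i) (f (Suc i)) \<and> (len (f i) + S (f i)) / 2 \<le> len (f (Suc i))"
    using dependent_nat_choice[of "\<lambda>_. D" "\<lambda>_ p q. R p q \<and> (len p + S p) / 2 \<le> len q"] start half by metis
  have Rf: "R (f i) (f j)" if "i \<le> j" for i j
    using that by (induction rule: dec_induct) (use f refl trans in blast)+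
  obtain q where q: "D q" "\<And>i. R (f i) q" using chain[of f, OF f(1) Rf] by blast
  have "len q = T"
  proof (rule ccontr)
    assume "len q \<noteq> T"
    then obtain q' where q': "D q'" "R q q'" "len q < len q'" using ext[OF q(1)] bound[OF q(1)] by force
    have S: "len q' \<le> S (f i)" for i using upper[OF q'(1)] trans[OF f(1) q(1) q'(1) q(2) q'(2)] by blast
    \<comment> \<open>The next length is at least the mean of \<open>len (f i)\<close> and
      \<open>S (f i)\<close>, and \<open>S (f i)\<close> is at least \<open>len q'\<close>.\<close>
    have "len q' - len (f i) \<le> (len q' - len (f 0)) * (1 / 2) ^ i" for i
    proof (induction i)
      case (Suc i)
      have "len q' - len (f (Suc i)) \<le> (len q' - len (f i)) / 2" using f(2)[of i] S[of i] by (simp add: field_simps)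
      with Suc show ?case by simp
    qed simp
    moreover have "len (f i) \<le> len q" for i using mono q(2) by blast
    ultimately have "len q' - len q \<le> (len q' - len (f 0)) * (1 / 2) ^ i" for i
      by (meson diff_left_mono order_trans)
    moreover have "(\<lambda>i. (len q' - len (f 0)) * (1 / 2) ^ i) \<longlonglongrightarrow> (len q' - len (f 0)) * 0"
      by (intro tendsto_intros LIMSEQ_power_zero) simp
    ultimately have "len q' - len q \<le> 0" by (intro LIMSEQ_le_const[of _ "(len q' - len (f 0)) * 0", simplified]) auto
    with q'(3) show False by simp
  qed
  with q(1) show ?thesis by (rule that)
qed

lemma prim_indicator_const:
  fixes u :: "'a::euclidean_space"
  assumes "0 \<le> s" "s \<le> b" "0 \<le> k"
  shows "prim (\<lambda>\<sigma>. indicator {s..<s + k} \<sigma> *\<^sub>R u) b = min k (b - s) *\<^sub>R u"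
proof -
  have "prim (\<lambda>\<sigma>. indicator {s..<s + k} \<sigma> *\<^sub>R u) b = (LINT \<sigma>|lborel. indicator {s..<min b (s + k)} \<sigma> *\<^sub>R u)"
    unfolding prim_def set_lebesgue_integral_def
    by (rule integral_cong_AE, simp, simp, use AE_lborel_singleton[of b] in eventually_elim)
      (use assms in \<open>auto simp: indicator_def\<close>)
  also have "\<dots> = (min b (s + k) - s) *\<^sub>R u" using assms by simp
  also have "min b (s + k) - s = min k (b - s)" by (simp add: min_def)
  finally show ?thesis .
qed

lemma prim_cong:
  fixes f g :: "real \<Rightarrow> 'a::euclidean_space"
  assumes "integrable lborel f" "integrable lborel g" "\<And>\<sigma>. 0 \<le> \<sigma> \<Longrightarrow> \<sigma> < s \<Longrightarrow> f \<sigma> = g \<sigma>"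
  shows "prim f s = prim g s"
proof (rule prim_cong_AE[of s])
  show "AE \<sigma> in lborel. \<sigma> \<in> {0..s} \<longrightarrow> f \<sigma> = g \<sigma>"
    using AE_lborel_singleton[of s] by eventually_elim (use assms(3) in auto)
qed (use assms in auto)

locale comparison = bolza L \<Theta> \<phi> for L :: "real^'n \<Rightarrow> real^'n \<Rightarrow> real" and \<Theta> \<phi> +
  fixes W :: "real \<Rightarrow> real^'n \<Rightarrow> ennreal" and t0 :: real and x0 :: "real^'n"
  assumes super: "contingent_supersolution L \<phi> W"
    and t0: "0 \<le> t0" and W0: "W t0 x0 < \<infinity>"
begin

lemma lsc_W: "lsc_on ({0..} \<times> UNIV) (\<lambda>(t, x). W t x)"
  and W_initial: "W 0 x = \<phi> x"
  and W_contingent: "0 < t \<Longrightarrow> W t x < \<infinity> \<Longrightarrow> \<exists>u. contingent_derivative W t x (-1) u \<le> ereal (- L x u)"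
  using super by (auto simp: contingent_supersolution_def)

text \<open>The liminf supplies short \<open>h\<close> with directions \<open>(\<alpha>, v)\<close>
  merely close to \<open>(-1, u)\<close>. The true time step is \<open>k = - h * \<alpha>\<close>;
  displacement and cost must be converted from \<open>h\<close> and \<open>v\<close> to
  \<open>k\<close> and \<open>u\<close>, at an error of at most
  \<open>\<epsilon> * k\<close>.\<close>

lemma euler_step:
  assumes \<tau>: "0 < \<tau>" and fin: "W \<tau> x < \<infinity>" and \<epsilon>: "0 < \<epsilon>"
  obtains k u x' where "0 < k" "k \<le> \<tau>" "norm (x' - x - k *\<^sub>R u) \<le> \<epsilon> * k" "k * norm u \<le> \<epsilon>"
    "W (\<tau> - k) x' + ennreal (k * L x u) \<le> W \<tau> x + ennreal (\<epsilon> * k)"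
proof -
  obtain u where u: "contingent_derivative W \<tau> x (-1) u \<le> ereal (- L x u)" using W_contingent[OF \<tau> fin] by blast
  define l where "l = L x u"
  have l: "0 \<le> l" by (simp add: l_def nonneg)
  \<comment> \<open>One tolerance for both errors: \<open>\<eta> * (1 + norm u)\<close> in the
    position and \<open>\<eta> * (1 + l)\<close> in the cost are at most
    \<open>\<epsilon> / 2\<close>, and \<open>\<eta> \<le> 1/2\<close> gives
    \<open>h / 2 \<le> k \<le> 2 * h\<close>.\<close>
  define \<eta> where "\<eta> = min (1/2) (\<epsilon> / (2 * (1 + norm u + l)))"
  have pos: "1 + norm u + l > 0" using l by (simp add: add_pos_nonneg)
  have "0 < \<eta>" unfolding \<eta>_def using pos \<epsilon> by simp
  moreover have "\<eta> \<le> 1/2" unfolding \<eta>_def by (rule min.cobounded1)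
  ultimately have \<eta>: "0 < \<eta>" "\<eta> \<le> 1/2" .
  have cancel: "\<epsilon> / (2 * c) * c = \<epsilon> / 2" if "c > 0" for c :: real using that by simp
  have \<eta>e: "\<eta> * (1 + norm u + l) \<le> \<epsilon> / 2"
  proof -
    have "\<eta> \<le> \<epsilon> / (2 * (1 + norm u + l))" by (simp add: \<eta>_def)
    then have "\<eta> * (1 + norm u + l) \<le> \<epsilon> / (2 * (1 + norm u + l)) * (1 + norm u + l)"
      using pos by (intro mult_right_mono) auto
    also have "\<dots> = \<epsilon> / 2" by (rule cancel[OF pos])
    finally show ?thesis .
  qed
  \<comment> \<open>As \<open>k \<le> 2 * h\<close>, this keeps the step within the remaining time
    and its length \<open>k * norm u\<close> below \<open>\<epsilon>\<close>.\<close>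
  define h0 where "h0 = min (\<tau> / 2) (\<epsilon> / (2 * (norm u + 1)))"
  have h0: "0 < h0" using \<tau> \<epsilon> by (simp add: h0_def add_nonneg_pos)
  define f where "f = (\<lambda>(h, \<alpha>', v). (enn2ereal (W (\<tau> + h * \<alpha>') (x + h *\<^sub>R v)) - enn2ereal (W \<tau> x)) / ereal h)"
  have "Liminf (at_right 0 \<times>\<^sub>F nhds (-1, u)) f < ereal (- l + \<eta>)"
    using le_less_trans[OF u, of "ereal (- l + \<eta>)"] \<eta>(1) by (simp add: contingent_derivative_def f_def l_def)
  then have "\<not> (\<forall>\<^sub>F z in at_right 0 \<times>\<^sub>F nhds (-1, u). ereal (- l + \<eta>) \<le> f z)"
    using Liminf_bounded[of "ereal (- l + \<eta>)" f] by (meson not_less)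
  then have freq: "\<exists>\<^sub>F z in at_right 0 \<times>\<^sub>F nhds (-1, u). f z < ereal (- l + \<eta>)"
    by (simp add: frequently_def not_less)
  have "\<forall>\<^sub>F h in at_right 0. 0 < h \<and> h < h0"
    using h0 by (auto simp: eventually_at_right_field)
  moreover have "\<forall>\<^sub>F p in nhds (-1, u). dist p (-1::real, u) < \<eta>"
    using \<eta>(1) by (auto simp: eventually_nhds_metric)
  ultimately have "\<forall>\<^sub>F z in at_right 0 \<times>\<^sub>F nhds (-1, u). (0 < fst z \<and> fst z < h0) \<and> dist (snd z) (-1::real, u) < \<eta>"
    by (rule eventually_prodI)
  then have "\<forall>\<^sub>F z in at_right 0 \<times>\<^sub>F nhds (-1, u). f z < ereal (- l + \<eta>) \<longrightarrow>
      0 < fst z \<and> fst z < h0 \<and> dist (snd z) (-1::real, u) < \<eta> \<and> f z < ereal (- l + \<eta>)"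
    by eventually_elim blast
  from frequently_ex[OF frequently_rev_mp[OF freq this]]
  obtain h \<alpha> v where z: "0 < h" "h < h0" "dist (\<alpha>, v) (-1::real, u) < \<eta>" "f (h, \<alpha>, v) < ereal (- l + \<eta>)"
    by auto
  have d\<alpha>: "\<bar>\<alpha> + 1\<bar> < \<eta>" and dv: "norm (v - u) < \<eta>"
    using z(3) dist_fst_le[of "(\<alpha>, v)" "(-1, u)"] dist_snd_le[of "(\<alpha>, v)" "(-1, u)"]
    by (auto simp: dist_norm)
  define k where "k = - h * \<alpha>"
  define x' where "x' = x + h *\<^sub>R v"
  have k: "h / 2 \<le> k" "k \<le> 2 * h"
  proof -
    have "1/2 \<le> - \<alpha>" "- \<alpha> \<le> 2" using d\<alpha> \<eta> by auto
    then have "h * (1/2) \<le> h * (- \<alpha>)" "h * (- \<alpha>) \<le> h * 2"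
      using z(1) by (simp_all only: mult_left_mono less_imp_le)
    then show "h / 2 \<le> k" "k \<le> 2 * h" by (auto simp: k_def)
  qed
  have k0: "0 < k" using k z(1) by linarith
  have k\<tau>: "k \<le> \<tau>" using k z(2) by (simp add: h0_def)
  have ku: "k * norm u \<le> \<epsilon>"
  proof -
    have "k \<le> 2 * (\<epsilon> / (2 * (norm u + 1)))" using k z(2) by (simp add: h0_def)
    then have "k * (norm u + 1) \<le> 2 * (\<epsilon> / (2 * (norm u + 1))) * (norm u + 1)" by (intro mult_right_mono) auto
    also have "\<dots> = \<epsilon>" by (subst mult.assoc, subst cancel) (auto intro: add_nonneg_pos)
    finally show ?thesis using k0 by (simp add: distrib_left)
  qed
  have hk: "h * \<epsilon> / 2 \<le> \<epsilon> * k"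
    using mult_left_mono[OF k(1), of \<epsilon>] \<epsilon> by (simp add: mult.commute)
  have near: "norm (x' - x - k *\<^sub>R u) \<le> \<epsilon> * k"
  proof -
    have "x' - x - k *\<^sub>R u = h *\<^sub>R ((v - u) + (\<alpha> + 1) *\<^sub>R u)"
      by (simp add: x'_def k_def algebra_simps)
    then have "norm (x' - x - k *\<^sub>R u) = h * norm ((v - u) + (\<alpha> + 1) *\<^sub>R u)" using z(1) by simp
    also have "norm ((v - u) + (\<alpha> + 1) *\<^sub>R u) \<le> \<eta> + \<eta> * norm u"
      using norm_triangle_ineq[of "v - u" "(\<alpha> + 1) *\<^sub>R u"] dv mult_right_mono[OF less_imp_le[OF d\<alpha>], of "norm u"] by simp
    also have "\<eta> + \<eta> * norm u \<le> \<epsilon> / 2" using \<eta>e mult_nonneg_nonneg[OF less_imp_le[OF \<eta>(1)] l] by (simp add: distrib_left)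
    finally have "norm (x' - x - k *\<^sub>R u) \<le> h * (\<epsilon> / 2)" using z(1) by (simp add: mult_left_mono)
    with hk show ?thesis by simp
  qed
  obtain b where b: "W \<tau> x = ennreal b" "0 \<le> b" using fin by (metis ennreal_cases infinity_ennreal_def less_irrefl)
  have fz: "(enn2ereal (W (\<tau> - k) x') - ereal b) / ereal h < ereal (- l + \<eta>)"
    using z(4) b by (simp add: f_def k_def x'_def enn2ereal_ennreal)
  then have "W (\<tau> - k) x' \<noteq> top" using z(1) by (auto simp: enn2ereal_top)
  then obtain a where a: "W (\<tau> - k) x' = ennreal a" "0 \<le> a" by (metis ennreal_cases)
  have "(a - b) / h < - l + \<eta>" using fz a z(1) by (simp add: enn2ereal_ennreal)
  then have "a - b < h * (- l + \<eta>)" using z(1) by (simp add: field_simps)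
  \<comment> \<open>The quotient accounts for the cost \<open>h * l\<close>, but the step lasts
    \<open>k\<close>; the difference \<open>k - h\<close> is at most
    \<open>h * \<eta>\<close>.\<close>
  then have "a + k * l \<le> b + (h * \<eta> + (k - h) * l)" by (simp add: algebra_simps)
  also have "(k - h) * l \<le> h * \<eta> * l"
  proof -
    have "k - h = h * (- (\<alpha> + 1))" by (simp add: k_def algebra_simps)
    also have "\<dots> \<le> h * \<eta>" using d\<alpha> z(1) by (intro mult_left_mono) auto
    finally show ?thesis using l by (rule mult_right_mono)
  qed
  also have "h * \<eta> + h * \<eta> * l \<le> h * (\<epsilon> / 2)"
  proof -
    have "\<eta> + \<eta> * l \<le> \<epsilon> / 2" using \<eta>e mult_nonneg_nonneg[OF less_imp_le[OF \<eta>(1)] norm_ge_zero[of u]] by (simp add: distrib_left)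
    then have "h * (\<eta> + \<eta> * l) \<le> h * (\<epsilon> / 2)" using z(1) by (intro mult_left_mono) auto
    then show ?thesis by (simp add: algebra_simps)
  qed
  finally have "a + k * l \<le> b + \<epsilon> * k" using hk by simp
  then have "ennreal (a + k * l) \<le> ennreal (b + \<epsilon> * k)" by (rule ennreal_leI)
  then have "W (\<tau> - k) x' + ennreal (k * L x u) \<le> W \<tau> x + ennreal (\<epsilon> * k)"
    using a b k0 l \<epsilon> by (simp add: ennreal_plus l_def)
  then show ?thesis using k0 k\<tau> near ku by (intro that)
qed

end

section \<open>Euler paths and their continuation\<close>

context comparison
begin

text \<open>\<open>(s, X, \<xi>, u)\<close> is an approximate trajectory on \<open>[0, s)\<close> ending at \<open>X\<close>: it is driven by the
  velocity \<open>u\<close>, up to an error, and pays the running cost at the lagged position \<open>\<xi>\<close>.\<close>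

definition euler_path :: "real \<Rightarrow> real \<times> (real^'n) \<times> (real \<Rightarrow> real^'n) \<times> (real \<Rightarrow> real^'n) \<Rightarrow> bool" where
  "euler_path \<epsilon> = (\<lambda>(s, X, \<xi>, u).
     0 \<le> s \<and> s \<le> t0 \<and> \<xi> \<in> borel_measurable borel \<and> integrable lborel u \<and> (\<forall>\<sigma>. \<sigma> \<notin> {0..<s} \<longrightarrow> u \<sigma> = 0) \<and>
     W (t0 - s) X + (\<integral>\<^sup>+\<sigma>\<in>{0..<s}. ennreal (L (\<xi> \<sigma>) (u \<sigma>)) \<partial>lborel) \<le> W t0 x0 + ennreal (\<epsilon> * s) \<and>
     norm (X - x0 - prim u s) \<le> \<epsilon> * s \<and>
     (\<forall>\<sigma>. 0 \<le> \<sigma> \<and> \<sigma> < s \<longrightarrow> norm (\<xi> \<sigma> - x0 - prim u \<sigma>) \<le> \<epsilon> * (t0 + 1)))"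

text \<open>The last condition says that the defect \<open>X - prim u s\<close> drifts at rate at
  most \<open>\<epsilon>\<close>. This makes endpoints converge when infinitely many steps
  accumulate.\<close>

definition extends :: "real \<Rightarrow> real \<times> (real^'n) \<times> (real \<Rightarrow> real^'n) \<times> (real \<Rightarrow> real^'n) \<Rightarrow>
    real \<times> (real^'n) \<times> (real \<Rightarrow> real^'n) \<times> (real \<Rightarrow> real^'n) \<Rightarrow> bool" where
  "extends \<epsilon> = (\<lambda>(s, X, \<xi>, u) (s', X', \<xi>', u').
     s \<le> s' \<and> (\<forall>\<sigma>. 0 \<le> \<sigma> \<and> \<sigma> < s \<longrightarrow> \<xi>' \<sigma> = \<xi> \<sigma> \<and> u' \<sigma> = u \<sigma>) \<and>
     norm ((X' - prim u' s') - (X - prim u s)) \<le> \<epsilon> * (s' - s))"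

lemma extends_refl: "extends \<epsilon> p p"
  by (auto simp: extends_def split: prod.splits)

lemma extends_trans: "extends \<epsilon> p q \<Longrightarrow> extends \<epsilon> q r \<Longrightarrow> extends \<epsilon> p r"
proof -
  assume pq: "extends \<epsilon> p q" and qr: "extends \<epsilon> q r"
  obtain s1 X1 \<xi>1 u1 where p: "p = (s1, X1, \<xi>1, u1)" by (cases p)
  obtain s2 X2 \<xi>2 u2 where q: "q = (s2, X2, \<xi>2, u2)" by (cases q)
  obtain s3 X3 \<xi>3 u3 where r: "r = (s3, X3, \<xi>3, u3)" by (cases r)
  have "norm ((X3 - prim u3 s3) - (X1 - prim u1 s1)) \<le>
     norm ((X3 - prim u3 s3) - (X2 - prim u2 s2)) + norm ((X2 - prim u2 s2) - (X1 - prim u1 s1))"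
    by (rule norm_diff_triangle_le[OF order_refl order_refl])
  also have "\<dots> \<le> \<epsilon> * (s3 - s2) + \<epsilon> * (s2 - s1)"
    using pq qr by (intro add_mono) (auto simp: extends_def p q r)
  also have "\<dots> = \<epsilon> * (s3 - s1)" by (simp add: algebra_simps)
  finally show ?thesis using pq qr by (auto simp: extends_def p q r)
qed

lemma euler_path_extend:
  assumes \<epsilon>: "0 < \<epsilon>" and p: "euler_path \<epsilon> p" and less: "fst p < t0"
  shows "\<exists>q. euler_path \<epsilon> q \<and> extends \<epsilon> p q \<and> fst p < fst q"
proof -
  obtain s X \<xi> u where p_eq: "p = (s, X, \<xi>, u)" by (cases p)
  have s: "0 \<le> s" "s < t0" and [measurable]: "\<xi> \<in> borel_measurable borel" and u: "integrable lborel u"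
    and supp: "\<And>\<sigma>. \<sigma> \<notin> {0..<s} \<Longrightarrow> u \<sigma> = 0"
    and val: "W (t0 - s) X + (\<integral>\<^sup>+\<sigma>\<in>{0..<s}. ennreal (L (\<xi> \<sigma>) (u \<sigma>)) \<partial>lborel) \<le> W t0 x0 + ennreal (\<epsilon> * s)"
    and endp: "norm (X - x0 - prim u s) \<le> \<epsilon> * s"
    and near: "\<And>\<sigma>. 0 \<le> \<sigma> \<Longrightarrow> \<sigma> < s \<Longrightarrow> norm (\<xi> \<sigma> - x0 - prim u \<sigma>) \<le> \<epsilon> * (t0 + 1)"
    using p less by (auto simp: euler_path_def p_eq)
  have [measurable]: "u \<in> borel_measurable borel" using u by auto
  have "W (t0 - s) X \<le> W t0 x0 + ennreal (\<epsilon> * s)"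
    using val by (meson add_increasing2 order_trans zero_le order_refl le_add_same_cancel1 add_mono)
  also have "\<dots> < \<infinity>" using W0 by simp
  finally have fin: "W (t0 - s) X < \<infinity>" .
  have "0 < t0 - s" using s by simp
  from euler_step[OF this fin \<epsilon>] obtain k c X' where
    k: "0 < k" "k \<le> t0 - s" and X': "norm (X' - X - k *\<^sub>R c) \<le> \<epsilon> * k" and kc: "k * norm c \<le> \<epsilon>"
    and step: "W (t0 - s - k) X' + ennreal (k * L X c) \<le> W (t0 - s) X + ennreal (\<epsilon> * k)" by metis
  \<comment> \<open>The position is frozen at the start of the step, because the contingent
    inequality charges \<open>L\<close> there.\<close>
  define \<xi>' where "\<xi>' \<sigma> = (if \<sigma> < s then \<xi> \<sigma> else X)" for \<sigma>
  define d where "d \<sigma> = indicator {s..<s + k} \<sigma> *\<^sub>R c" for \<sigma> :: real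
  define u' where "u' \<sigma> = u \<sigma> + d \<sigma>" for \<sigma>
  have [measurable]: "\<xi>' \<in> borel_measurable borel" unfolding \<xi>'_def by measurable
  have d: "integrable lborel d" unfolding d_def using k by (intro integrable_scaleR_left) auto
  have u': "integrable lborel u'" unfolding u'_def by (intro Bochner_Integration.integrable_add u d)
  have prim_u': "prim u' \<sigma> = prim u \<sigma> + prim d \<sigma>" for \<sigma> unfolding u'_def by (rule prim_add[OF u d])
  have prim_before: "prim u' \<sigma> = prim u \<sigma>" if "\<sigma> \<le> s" for \<sigma>
    by (rule prim_cong[OF u' u]) (use that in \<open>auto simp: u'_def d_def\<close>)
  have prim_after: "prim u' \<sigma> = prim u s + min k (\<sigma> - s) *\<^sub>R c" if "s \<le> \<sigma>" for \<sigma>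
  proof -
    have "prim u \<sigma> - prim u s = (LINT \<sigma>:{s<..\<sigma>}|lborel. u \<sigma>)" by (rule prim_diff[OF u s(1) that])
    also have "\<dots> = 0"
      unfolding set_lebesgue_integral_def by (intro integral_eq_zero_AE AE_I2) (auto simp: indicator_def supp)
    finally have "prim u \<sigma> = prim u s" by simp
    then show ?thesis
      unfolding prim_u' d_def using prim_indicator_const[OF s(1) that, of k c] k by simp
  qed
  define q where "q = (s + k, X', \<xi>', u')"
  have "(\<integral>\<^sup>+\<sigma>\<in>{0..<s + k}. ennreal (L (\<xi>' \<sigma>) (u' \<sigma>)) \<partial>lborel) =
     (\<integral>\<^sup>+\<sigma>. ennreal (L (\<xi> \<sigma>) (u \<sigma>)) * indicator {0..<s} \<sigma> + ennreal (L X c) * indicator {s..<s + k} \<sigma> \<partial>lborel)"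
    using s k by (intro nn_integral_cong) (auto simp: indicator_def \<xi>'_def u'_def d_def supp)
  also have "\<dots> = (\<integral>\<^sup>+\<sigma>\<in>{0..<s}. ennreal (L (\<xi> \<sigma>) (u \<sigma>)) \<partial>lborel) + ennreal (L X c) * ennreal k"
    using k by (subst nn_integral_add) (auto simp: nn_integral_cmult_indicator)
  also have "ennreal (L X c) * ennreal k = ennreal (k * L X c)"
    using k nonneg by (simp add: mult.commute flip: ennreal_mult)
  finally have int: "(\<integral>\<^sup>+\<sigma>\<in>{0..<s + k}. ennreal (L (\<xi>' \<sigma>) (u' \<sigma>)) \<partial>lborel) =
     (\<integral>\<^sup>+\<sigma>\<in>{0..<s}. ennreal (L (\<xi> \<sigma>) (u \<sigma>)) \<partial>lborel) + ennreal (k * L X c)" .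
  define I where "I = (\<integral>\<^sup>+\<sigma>\<in>{0..<s}. ennreal (L (\<xi> \<sigma>) (u \<sigma>)) \<partial>lborel)"
  have "W (t0 - (s + k)) X' + (I + ennreal (k * L X c)) = (W (t0 - s - k) X' + ennreal (k * L X c)) + I"
    by (simp add: ac_simps diff_diff_eq)
  also have "\<dots> \<le> (W (t0 - s) X + ennreal (\<epsilon> * k)) + I" by (rule add_right_mono[OF step])
  also have "\<dots> = (W (t0 - s) X + I) + ennreal (\<epsilon> * k)" by (simp add: ac_simps)
  also have "\<dots> \<le> (W t0 x0 + ennreal (\<epsilon> * s)) + ennreal (\<epsilon> * k)" unfolding I_def by (rule add_right_mono[OF val])
  also have "\<dots> = W t0 x0 + ennreal (\<epsilon> * (s + k))"
    using \<epsilon> s k by (simp add: distrib_left add.assoc)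
  finally have val': "W (t0 - (s + k)) X' + (I + ennreal (k * L X c)) \<le> W t0 x0 + ennreal (\<epsilon> * (s + k))" .
  have diff: "norm ((X' - prim u' (s + k)) - (X - prim u s)) \<le> \<epsilon> * (s + k - s)"
    using X' k by (simp add: prim_after algebra_simps)
  have endp': "norm (X' - x0 - prim u' (s + k)) \<le> \<epsilon> * (s + k)"
  proof -
    have "norm (X' - x0 - prim u' (s + k)) \<le> norm ((X' - prim u' (s + k)) - (X - prim u s)) + norm (X - x0 - prim u s)"
      using norm_triangle_ineq[of "(X' - prim u' (s + k)) - (X - prim u s)" "X - x0 - prim u s"] by (simp add: algebra_simps)
    also have "\<dots> \<le> \<epsilon> * (s + k)" using diff endp by (simp add: algebra_simps)
    finally show ?thesis .
  qed
  have near': "norm (\<xi>' \<sigma> - x0 - prim u' \<sigma>) \<le> \<epsilon> * (t0 + 1)" if \<sigma>: "0 \<le> \<sigma>" "\<sigma> < s + k" for \<sigma>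
  proof (cases "\<sigma> < s")
    case True
    then show ?thesis using near[of \<sigma>] \<sigma> by (simp add: \<xi>'_def prim_before)
  next
    case False
    have "norm (min k (\<sigma> - s) *\<^sub>R c) \<le> k * norm c" using False k by (simp add: mult_right_mono)
    then have "norm (X - x0 - prim u s - min k (\<sigma> - s) *\<^sub>R c) \<le> \<epsilon> * s + \<epsilon>"
      using norm_triangle_ineq4[of "X - x0 - prim u s" "min k (\<sigma> - s) *\<^sub>R c"] endp kc by linarith
    also have "\<dots> \<le> \<epsilon> * (t0 + 1)" using \<epsilon> s by (simp add: distrib_left)
    finally show ?thesis using False by (simp add: \<xi>'_def prim_after algebra_simps)
  qed
  have "euler_path \<epsilon> q"
    unfolding euler_path_def q_def prod.case
  proof (intro conjI allI impI)
    show "u' \<sigma> = 0" if "\<sigma> \<notin> {0..<s + k}" for \<sigma>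
      using that s k by (auto simp: u'_def d_def supp)
  qed (use s k u' endp' near' val' int in \<open>auto simp: I_def\<close>)
  moreover have "extends \<epsilon> p q"
    unfolding extends_def q_def p_eq prod.case using k diff by (auto simp: \<xi>'_def u'_def d_def)
  moreover have "fst p < fst q" using k by (simp add: p_eq q_def)
  ultimately show ?thesis by blast
qed

text \<open>The steps may accumulate at a time \<open>s1\<close> below \<open>t0\<close>. The paths
  glue together on \<open>[0,s1)\<close>, the uniform drift bound supplies an endpoint, and lower
  semicontinuity of \<open>W\<close> closes the value inequality there.\<close>

lemma euler_path_chain:
  assumes \<epsilon>: "0 < \<epsilon>" and p: "\<And>i::nat. euler_path \<epsilon> (f i)" and ext: "\<And>i j. i \<le> j \<Longrightarrow> extends \<epsilon> (f i) (f j)"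
  shows "\<exists>q. euler_path \<epsilon> q \<and> (\<forall>i. extends \<epsilon> (f i) q)"
proof -
  define s where "s i = fst (f i)" for i
  define X where "X i = fst (snd (f i))" for i
  define \<xi> where "\<xi> i = fst (snd (snd (f i)))" for i
  define u where "u i = snd (snd (snd (f i)))" for i
  have f: "f i = (s i, X i, \<xi> i, u i)" for i by (simp add: s_def X_def \<xi>_def u_def)
  have s: "0 \<le> s i" "s i \<le> t0" and [measurable]: "\<xi> i \<in> borel_measurable borel" and u: "integrable lborel (u i)"
    and supp: "\<And>\<sigma>. \<sigma> \<notin> {0..<s i} \<Longrightarrow> u i \<sigma> = 0"
    and val: "W (t0 - s i) (X i) + (\<integral>\<^sup>+\<sigma>\<in>{0..<s i}. ennreal (L (\<xi> i \<sigma>) (u i \<sigma>)) \<partial>lborel) \<le> W t0 x0 + ennreal (\<epsilon> * s i)"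
    and endp: "norm (X i - x0 - prim (u i) (s i)) \<le> \<epsilon> * s i"
    and near: "\<And>\<sigma>. 0 \<le> \<sigma> \<Longrightarrow> \<sigma> < s i \<Longrightarrow> norm (\<xi> i \<sigma> - x0 - prim (u i) \<sigma>) \<le> \<epsilon> * (t0 + 1)" for i
    using p[of i] unfolding euler_path_def f prod.case by blast+
  have mono: "s i \<le> s j" and same: "\<And>\<sigma>. 0 \<le> \<sigma> \<Longrightarrow> \<sigma> < s i \<Longrightarrow> \<xi> j \<sigma> = \<xi> i \<sigma> \<and> u j \<sigma> = u i \<sigma>"
    and diff: "norm ((X j - prim (u j) (s j)) - (X i - prim (u i) (s i))) \<le> \<epsilon> * (s j - s i)" if "i \<le> j" for i j
    using ext[OF that] unfolding extends_def f prod.case by blast+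
  have [measurable]: "u i \<in> borel_measurable borel" for i using u[of i] by auto
  define s1 where "s1 = Sup (range s)"
  have bdd: "bdd_above (range s)" using s(2) by (auto simp: bdd_above_def)
  have "incseq s" using mono by (simp add: incseq_def)
  then have lim_s: "s \<longlonglongrightarrow> s1" unfolding s1_def by (rule LIMSEQ_incseq_SUP[OF bdd])
  have s_le: "s i \<le> s1" for i unfolding s1_def by (rule cSUP_upper[OF _ bdd]) simp
  have s1: "0 \<le> s1" "s1 \<le> t0" using s_le[of 0] s(1)[of 0] LIMSEQ_le_const2[OF lim_s] s(2) by auto
  \<comment> \<open>Before \<open>s1\<close> both sequences are eventually constant, and from
    \<open>s1\<close> on they are 0; writing the glued functions as limits makes them
    measurable.\<close>
  define \<xi>1 where "\<xi>1 \<sigma> = lim (\<lambda>i. indicator {0..<s i} \<sigma> *\<^sub>R \<xi> i \<sigma>)" for \<sigma>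
  define u1 where "u1 \<sigma> = lim (\<lambda>i. u i \<sigma>)" for \<sigma>
  have [measurable]: "\<xi>1 \<in> borel_measurable borel" "u1 \<in> borel_measurable borel"
    unfolding \<xi>1_def u1_def by measurable
  have eq: "\<xi>1 \<sigma> = \<xi> i \<sigma> \<and> u1 \<sigma> = u i \<sigma>" if \<sigma>: "0 \<le> \<sigma>" "\<sigma> < s i" for i \<sigma>
  proof -
    have "\<forall>\<^sub>F j in sequentially. indicator {0..<s j} \<sigma> *\<^sub>R \<xi> j \<sigma> = \<xi> i \<sigma>"
      using eventually_ge_at_top[of i]
      by eventually_elim (use same \<sigma> mono in \<open>force simp: indicator_def\<close>)
    then have "(\<lambda>j. indicator {0..<s j} \<sigma> *\<^sub>R \<xi> j \<sigma>) \<longlonglongrightarrow> \<xi> i \<sigma>" by (rule tendsto_eventually)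
    moreover have "\<forall>\<^sub>F j in sequentially. u j \<sigma> = u i \<sigma>"
      using eventually_ge_at_top[of i] by eventually_elim (use same \<sigma> in blast)
    then have "(\<lambda>j. u j \<sigma>) \<longlonglongrightarrow> u i \<sigma>" by (rule tendsto_eventually)
    ultimately show ?thesis unfolding \<xi>1_def u1_def by (simp add: limI)
  qed
  have supp1: "u1 \<sigma> = 0" if \<sigma>: "\<sigma> \<notin> {0..<s1}" for \<sigma>
  proof -
    have "u i \<sigma> = 0" for i using \<sigma> s_le[of i] by (intro supp) auto
    then show ?thesis by (simp add: u1_def)
  qed
  define I where "I i = (\<integral>\<^sup>+\<sigma>\<in>{0..<s i}. ennreal (L (\<xi> i \<sigma>) (u i \<sigma>)) \<partial>lborel)" for i
  define I1 where "I1 = (\<integral>\<^sup>+\<sigma>\<in>{0..<s1}. ennreal (L (\<xi>1 \<sigma>) (u1 \<sigma>)) \<partial>lborel)"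
  have I1: "I1 \<le> liminf I"
  proof -
    have "I1 \<le> (\<integral>\<^sup>+\<sigma>. liminf (\<lambda>i. ennreal (L (\<xi> i \<sigma>) (u i \<sigma>)) * indicator {0..<s i} \<sigma>) \<partial>lborel)"
      unfolding I1_def
    proof (rule nn_integral_mono)
      fix \<sigma> :: real
      show "ennreal (L (\<xi>1 \<sigma>) (u1 \<sigma>)) * indicator {0..<s1} \<sigma> \<le>
         liminf (\<lambda>i. ennreal (L (\<xi> i \<sigma>) (u i \<sigma>)) * indicator {0..<s i} \<sigma>)"
      proof (cases "\<sigma> \<in> {0..<s1}")
        case True
        then have "\<forall>\<^sub>F i in sequentially. \<sigma> < s i" using lim_s by (intro order_tendstoD(1)) auto
        then have "\<forall>\<^sub>F i in sequentially. ennreal (L (\<xi>1 \<sigma>) (u1 \<sigma>)) * indicator {0..<s1} \<sigma> \<le>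
            ennreal (L (\<xi> i \<sigma>) (u i \<sigma>)) * indicator {0..<s i} \<sigma>"
          by eventually_elim (use True eq in \<open>auto simp: indicator_def\<close>)
        then show ?thesis by (rule Liminf_bounded)
      qed simp
    qed
    also have "\<dots> \<le> liminf I" unfolding I_def by (rule nn_integral_liminf) measurable
    finally show ?thesis .
  qed
  have W_fin: "W t0 x0 + ennreal (\<epsilon> * t0) < \<infinity>" using W0 by simp
  have I_le: "I i \<le> W t0 x0 + ennreal (\<epsilon> * t0)" for i
  proof -
    have "I i \<le> W (t0 - s i) (X i) + I i" by simp
    also have "\<dots> \<le> W t0 x0 + ennreal (\<epsilon> * s i)" unfolding I_def by (rule val)
    also have "\<dots> \<le> W t0 x0 + ennreal (\<epsilon> * t0)"
      using s(2)[of i] \<epsilon> by (intro add_left_mono ennreal_leI) simp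
    finally show ?thesis .
  qed
  have "liminf I \<le> W t0 x0 + ennreal (\<epsilon> * t0)"
  proof -
    have "liminf I \<le> liminf (\<lambda>i::nat. W t0 x0 + ennreal (\<epsilon> * t0))"
      by (intro Liminf_mono always_eventually allI I_le)
    then show ?thesis by (simp add: Liminf_const)
  qed
  then have I1_fin: "I1 < \<infinity>" using I1 W_fin by (meson le_less_trans)
  \<comment> \<open>Not inherited from the pieces: integrability up to \<open>s1\<close> rests on
    the finite total cost and superlinear growth.\<close>
  have u1: "integrable lborel u1"
  proof (rule integrableI_bounded)
    obtain C where C: "C \<ge> 0" "\<And>x c. norm c \<le> L x c / 1 + C" using norm_le_L[OF zero_less_one] by blast
    have "(\<integral>\<^sup>+\<sigma>. ennreal (norm (u1 \<sigma>)) \<partial>lborel) \<le>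
       (\<integral>\<^sup>+\<sigma>. ennreal (L (\<xi>1 \<sigma>) (u1 \<sigma>)) * indicator {0..<s1} \<sigma> + ennreal C * indicator {0..<s1} \<sigma> \<partial>lborel)"
    proof (rule nn_integral_mono)
      fix \<sigma> :: real
      show "ennreal (norm (u1 \<sigma>)) \<le> ennreal (L (\<xi>1 \<sigma>) (u1 \<sigma>)) * indicator {0..<s1} \<sigma> + ennreal C * indicator {0..<s1} \<sigma>"
      proof (cases "\<sigma> \<in> {0..<s1}")
        case True
        have "ennreal (norm (u1 \<sigma>)) \<le> ennreal (L (\<xi>1 \<sigma>) (u1 \<sigma>) + C)"
          using C(2)[of "u1 \<sigma>" "\<xi>1 \<sigma>"] by (intro ennreal_leI) simp
        also have "\<dots> = ennreal (L (\<xi>1 \<sigma>) (u1 \<sigma>)) + ennreal C" using nonneg C(1) by (simp add: ennreal_plus)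
        finally show ?thesis using True by simp
      qed (use supp1 in auto)
    qed
    also have "\<dots> = I1 + ennreal C * ennreal s1"
      unfolding I1_def using s1 by (subst nn_integral_add) (auto simp: nn_integral_cmult_indicator)
    also have "\<dots> < \<infinity>" using I1_fin by (simp add: ennreal_mult_less_top)
    finally show "(\<integral>\<^sup>+\<sigma>. ennreal (norm (u1 \<sigma>)) \<partial>lborel) < \<infinity>" .
  qed simp
  have prim1: "prim u1 \<sigma> = prim (u i) \<sigma>" if "\<sigma> \<le> s i" for i \<sigma>
    by (rule prim_cong[OF u1 u]) (use that eq in auto)
  \<comment> \<open>The defects are Cauchy since their increments are at most
    \<open>\<epsilon>\<close> times those of \<open>s\<close>; the driven parts converge because
    \<open>u1\<close> is integrable.\<close>
  define Z where "Z i = X i - prim (u i) (s i)" for i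
  have "Cauchy Z"
  proof (rule CauchyI')
    fix e :: real assume "e > 0"
    then have "e / \<epsilon> > 0" using \<epsilon> by simp
    then have "\<forall>\<^sub>F i in sequentially. s1 - e / \<epsilon> < s i" using lim_s by (intro order_tendstoD(1)) auto
    then obtain M where M: "\<And>i. i \<ge> M \<Longrightarrow> s1 - e / \<epsilon> < s i" by (auto simp: eventually_sequentially)
    have "norm (Z m - Z n) < e" if "m \<ge> M" "m < n" for m n
    proof -
      have "norm (Z n - Z m) \<le> \<epsilon> * (s n - s m)" unfolding Z_def using that by (intro diff) simp
      also have "\<dots> \<le> \<epsilon> * (s1 - s m)" using s_le[of n] \<epsilon> by simp
      also have "\<dots> < \<epsilon> * (e / \<epsilon>)" using M[OF that(1)] \<epsilon> by (intro mult_strict_left_mono) auto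
      finally show ?thesis using \<epsilon> by (simp add: norm_minus_commute)
    qed
    then show "\<exists>M. \<forall>m\<ge>M. \<forall>n>m. dist (Z m) (Z n) < e" unfolding dist_norm by blast
  qed
  then obtain Z1 where Z1: "Z \<longlonglongrightarrow> Z1" using Cauchy_convergent convergent_def by blast
  define X1 where "X1 = Z1 + prim u1 s1"
  have X_eq: "X i = Z i + prim u1 (s i)" for i using prim1[of "s i" i] by (simp add: Z_def)
  have "(\<lambda>i. prim u1 (s i)) \<longlonglongrightarrow> prim u1 s1" by (rule isCont_tendsto_compose[OF isCont_prim[OF u1] lim_s])
  then have lim_X: "X \<longlonglongrightarrow> X1" unfolding X_eq[abs_def] X1_def by (intro tendsto_add Z1)
  have diff1: "norm ((X1 - prim u1 s1) - (X i - prim (u i) (s i))) \<le> \<epsilon> * (s1 - s i)" for i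
  proof (rule LIMSEQ_le)
    show "(\<lambda>j. norm (Z j - Z i)) \<longlonglongrightarrow> norm ((X1 - prim u1 s1) - (X i - prim (u i) (s i)))"
      unfolding X1_def Z_def[symmetric] by (intro tendsto_intros) (use Z1 in simp)
    show "(\<lambda>j. \<epsilon> * (s j - s i)) \<longlonglongrightarrow> \<epsilon> * (s1 - s i)" by (intro tendsto_intros lim_s)
    show "\<exists>N. \<forall>n\<ge>N. norm (Z n - Z i) \<le> \<epsilon> * (s n - s i)" using diff unfolding Z_def by blast
  qed
  have endp1: "norm (X1 - x0 - prim u1 s1) \<le> \<epsilon> * s1"
  proof (rule LIMSEQ_le)
    show "(\<lambda>i. norm (Z i - x0)) \<longlonglongrightarrow> norm (X1 - x0 - prim u1 s1)"
      unfolding X1_def by (rule tendsto_eq_intros Z1 refl)+ simp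
    show "(\<lambda>i. \<epsilon> * s i) \<longlonglongrightarrow> \<epsilon> * s1" by (intro tendsto_intros lim_s)
    show "\<exists>N. \<forall>n\<ge>N. norm (Z n - x0) \<le> \<epsilon> * s n" using endp unfolding Z_def by (simp add: algebra_simps)
  qed
  have val1: "W (t0 - s1) X1 + I1 \<le> W t0 x0 + ennreal (\<epsilon> * s1)"
  proof -
    have "(case (t0 - s1, X1) of (t, x) \<Rightarrow> W t x) \<le> liminf (\<lambda>i. case (t0 - s i, X i) of (t, x) \<Rightarrow> W t x)"
      by (rule lsc_on_le_Liminf[OF lsc_W]) (use s s1 in \<open>auto intro!: tendsto_Pair tendsto_diff tendsto_const lim_s lim_X\<close>)
    then have "W (t0 - s1) X1 + I1 \<le> liminf (\<lambda>i. W (t0 - s i) (X i)) + liminf I"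
      using I1 by (intro add_mono) simp_all
    also have "\<dots> \<le> liminf (\<lambda>i. W (t0 - s i) (X i) + I i)" by (rule ennreal_liminf_add_le)
    also have "\<dots> \<le> liminf (\<lambda>i::nat. W t0 x0 + ennreal (\<epsilon> * s1))"
    proof (intro Liminf_mono always_eventually allI)
      fix i
      have "W (t0 - s i) (X i) + I i \<le> W t0 x0 + ennreal (\<epsilon> * s i)" unfolding I_def by (rule val)
      also have "\<dots> \<le> W t0 x0 + ennreal (\<epsilon> * s1)"
        using s_le[of i] \<epsilon> by (intro add_left_mono ennreal_leI) simp
      finally show "W (t0 - s i) (X i) + I i \<le> W t0 x0 + ennreal (\<epsilon> * s1)" .
    qed
    finally show ?thesis by (simp add: Liminf_const)
  qed
  have near1: "norm (\<xi>1 \<sigma> - x0 - prim u1 \<sigma>) \<le> \<epsilon> * (t0 + 1)" if \<sigma>: "0 \<le> \<sigma>" "\<sigma> < s1" for \<sigma>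
  proof -
    have "\<forall>\<^sub>F i in sequentially. \<sigma> < s i" using lim_s \<sigma>(2) by (rule order_tendstoD(1))
    then obtain i where "\<sigma> < s i" by (auto simp: eventually_sequentially)
    then show ?thesis using near[OF \<sigma>(1), of i] eq[OF \<sigma>(1), of i] prim1[of \<sigma> i] by simp
  qed
  have "euler_path \<epsilon> (s1, X1, \<xi>1, u1)"
    unfolding euler_path_def prod.case using s1 u1 supp1 val1 endp1 near1 by (auto simp: I1_def)
  moreover have "extends \<epsilon> (f i) (s1, X1, \<xi>1, u1)" for i
    unfolding extends_def f prod.case using s_le[of i] eq diff1[of i] by blast
  ultimately show ?thesis by blast
qed

lemma euler_path_exists:
  assumes \<epsilon>: "0 < \<epsilon>"
  obtains X \<xi> u where "euler_path \<epsilon> (t0, X, \<xi>, u)"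
proof -
  have "euler_path \<epsilon> (0, x0, \<lambda>_. 0, \<lambda>_. 0)" using t0 by (simp add: euler_path_def)
  then obtain q where "euler_path \<epsilon> q" "fst q = t0"
  proof (rule maximal_chain_reaches[where D="euler_path \<epsilon>" and R="extends \<epsilon>" and len=fst and T=t0])
    show "fst p \<le> t0" if "euler_path \<epsilon> p" for p using that by (auto simp: euler_path_def split: prod.splits)
    show "extends \<epsilon> p p" for p by (rule extends_refl)
    show "extends \<epsilon> p r" if "extends \<epsilon> p q" "extends \<epsilon> q r" for p q r using that by (rule extends_trans)
    show "fst p \<le> fst q" if "extends \<epsilon> p q" for p q using that by (auto simp: extends_def split: prod.splits)
    show "\<exists>q. euler_path \<epsilon> q \<and> extends \<epsilon> p q \<and> fst p < fst q" if "euler_path \<epsilon> p" "fst p < t0" for p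
      using \<epsilon> that by (rule euler_path_extend)
    show "\<exists>q. euler_path \<epsilon> q \<and> (\<forall>i. extends \<epsilon> (f i) q)"
      if "\<And>i. euler_path \<epsilon> (f i)" "\<And>i j. i \<le> j \<Longrightarrow> extends \<epsilon> (f i) (f j)" for f :: "nat \<Rightarrow> _"
      using \<epsilon> that by (rule euler_path_chain)
  qed
  then show ?thesis by (metis prod.collapse that)
qed

text \<open>The value inequality bounds the costs of the Euler paths, so the compactness theorem
  applies as \<open>\<epsilon> k\<close> tends to 0, with costs evaluated at lagged positions. At
  time 0 the value \<open>W 0 (X k)\<close> is the terminal cost.\<close>

lemma value_function_le: "V t0 x0 \<le> W t0 x0"
proof -
  define \<epsilon> where "\<epsilon> k = 1 / real (Suc k)" for k
  have \<epsilon>: "0 < \<epsilon> k" "\<epsilon> k \<le> 1" for k by (auto simp: \<epsilon>_def)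
  have \<epsilon>0: "\<epsilon> \<longlonglongrightarrow> 0" unfolding \<epsilon>_def[abs_def] by (intro LIMSEQ_Suc lim_1_over_n)
  have "\<forall>k. \<exists>p. euler_path (\<epsilon> k) (t0, p)" using euler_path_exists[OF \<epsilon>(1)] by metis
  from choice[OF this] obtain p where p: "\<And>k. euler_path (\<epsilon> k) (t0, p k)" by blast
  define X where "X k = fst (p k)" for k
  define \<xi> where "\<xi> k = fst (snd (p k))" for k
  define u where "u k = snd (snd (p k))" for k
  have pk: "p k = (X k, \<xi> k, u k)" for k by (simp add: X_def \<xi>_def u_def)
  have \<xi>: "\<xi> k \<in> borel_measurable borel" and u: "integrable lborel (u k)"
    and supp: "\<And>\<sigma>. \<sigma> \<notin> {0..<t0} \<Longrightarrow> u k \<sigma> = 0"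
    and val: "W 0 (X k) + (\<integral>\<^sup>+\<sigma>\<in>{0..<t0}. ennreal (L (\<xi> k \<sigma>) (u k \<sigma>)) \<partial>lborel) \<le> W t0 x0 + ennreal (\<epsilon> k * t0)"
    and endp: "norm (X k - x0 - prim (u k) t0) \<le> \<epsilon> k * t0"
    and near: "\<And>\<sigma>. 0 \<le> \<sigma> \<Longrightarrow> \<sigma> < t0 \<Longrightarrow> norm (\<xi> k \<sigma> - x0 - prim (u k) \<sigma>) \<le> \<epsilon> k * (t0 + 1)" for k
    using p[of k] unfolding euler_path_def pk prod.case diff_self by blast+
  define I where "I k = (\<integral>\<^sup>+\<sigma>\<in>{0..t0}. ennreal (L (\<xi> k \<sigma>) (u k \<sigma>)) \<partial>lborel)" for k
  have I: "I k = (\<integral>\<^sup>+\<sigma>\<in>{0..<t0}. ennreal (L (\<xi> k \<sigma>) (u k \<sigma>)) \<partial>lborel)" for k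
    unfolding I_def
    by (rule nn_integral_cong_AE, use AE_lborel_singleton[of t0] in eventually_elim) (auto simp: indicator_def)
  have val': "\<phi> (X k) + I k \<le> W t0 x0 + ennreal (\<epsilon> k * t0)" for k
    using val[of k] by (simp add: I W_initial)
  define C where "C = enn2real (W t0 x0) + t0"
  have bound: "I k \<le> ennreal C" for k
  proof -
    have "I k \<le> \<phi> (X k) + I k" by simp
    also have "\<dots> \<le> W t0 x0 + ennreal (\<epsilon> k * t0)" by (rule val')
    also have "\<dots> \<le> W t0 x0 + ennreal t0"
      using \<epsilon>(2)[of k] t0 by (intro add_left_mono ennreal_leI) (simp add: mult_left_le_one_le less_imp_le[OF \<epsilon>(1)])
    also have "\<dots> = ennreal C" using W0 t0 by (simp add: C_def ennreal_plus)
    finally show ?thesis .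
  qed
  obtain r v where r: "strict_mono (r :: nat \<Rightarrow> nat)" and v: "integrable lborel v"
    and lim: "(\<lambda>n. prim (u (r n)) t0) \<longlonglongrightarrow> prim v t0" and cost: "cost L t0 x0 v \<le> liminf (\<lambda>n. I (r n))"
  proof (rule trajectory_compactness[where w=u and \<xi>=\<xi> and T="\<lambda>_. t0" and X="\<lambda>_. x0" and \<epsilon>="\<lambda>k. \<epsilon> k * (t0 + 1)" and t=t0 and x=x0 and C=C])
    show "(\<lambda>k. \<epsilon> k * (t0 + 1)) \<longlonglongrightarrow> 0" by (rule tendsto_mult_left_zero[OF \<epsilon>0])
  qed (use u supp \<xi> bound t0 near in \<open>auto simp: I_def\<close>)
  have lim_X: "(\<lambda>n. X (r n)) \<longlonglongrightarrow> x0 + prim v t0"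
  proof -
    \<comment> \<open>The endpoint \<open>X k\<close> carries the value inequality but is not the
      end of the driven path; their distance is at most \<open>\<epsilon> k * t0\<close>.\<close>
    have "(\<lambda>k. X k - x0 - prim (u k) t0) \<longlonglongrightarrow> 0"
      by (rule Lim_null_comparison[of _ "\<lambda>k. \<epsilon> k * t0"]) (use endp tendsto_mult_left_zero[OF \<epsilon>0] in auto)
    then have "(\<lambda>n. X (r n) - x0 - prim (u (r n)) t0) \<longlonglongrightarrow> 0"
      using LIMSEQ_subseq_LIMSEQ[OF _ r] by (fastforce simp: o_def)
    from tendsto_add[OF tendsto_add[OF this lim] tendsto_const[of x0]] show ?thesis by (simp add: add.commute)
  qed
  have "V t0 x0 \<le> cost L t0 x0 v + \<phi> (x0 + prim v t0)" by (rule value_function_le_cost[OF v])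
  also have "\<dots> \<le> liminf (\<lambda>n. I (r n)) + liminf (\<lambda>n. \<phi> (X (r n)))"
    by (intro add_mono cost lsc_on_le_Liminf[OF lsc_\<phi>] lim_X) auto
  also have "\<dots> \<le> liminf (\<lambda>n. I (r n) + \<phi> (X (r n)))" by (rule ennreal_liminf_add_le)
  also have "\<dots> \<le> liminf (\<lambda>n. W t0 x0 + ennreal (\<epsilon> (r n) * t0))"
    using val' by (intro Liminf_mono always_eventually allI) (simp add: add.commute)
  also have "\<dots> = W t0 x0"
  proof (rule lim_imp_Liminf)
    have "(\<lambda>n. \<epsilon> (r n) * t0) \<longlonglongrightarrow> 0"
      using LIMSEQ_subseq_LIMSEQ[OF tendsto_mult_left_zero[OF \<epsilon>0] r] by (simp add: o_def)
    then have "(\<lambda>n. W t0 x0 + ennreal (\<epsilon> (r n) * t0)) \<longlonglongrightarrow> W t0 x0 + ennreal 0"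
      by (intro tendsto_add tendsto_const tendsto_ennrealI)
    then show "(\<lambda>n. W t0 x0 + ennreal (\<epsilon> (r n) * t0)) \<longlonglongrightarrow> W t0 x0" by simp
  qed simp
  finally show ?thesis .
qed

end

theorem corollary5p3:
  fixes L :: "real^'n \<Rightarrow> real^'n \<Rightarrow> real" and \<phi> :: "real^'n \<Rightarrow> ennreal"
  assumes "standing_assumptions L \<phi>"
    and "\<forall>x0. \<exists>M>0. \<exists>r>0. \<forall>x\<in>cball x0 r. \<forall>u\<in>cball 0 r. L x u \<le> M"
  shows "contingent_supersolution L \<phi> (value_function L \<phi>) \<and>
    (\<forall>W. contingent_supersolution L \<phi> W \<longrightarrow>
       (\<forall>t\<ge>0. \<forall>x. value_function L \<phi> t x \<le> W t x))"
proof -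
  obtain \<Theta> where "bolza L \<Theta> \<phi>"
    using assms(1) unfolding standing_assumptions_def bolza_def bolza_axioms_def lagrangian_def by blast
  then interpret bolza_bounded L \<Theta> \<phi>
    using assms(2) by (simp add: bolza_bounded_def bolza_bounded_axioms_def)
  have "contingent_supersolution L \<phi> V"
    unfolding contingent_supersolution_def
    using lsc_value_function value_function_0 value_function_contingent by blast
  moreover have "V t x \<le> W t x" if "contingent_supersolution L \<phi> W" "0 \<le> t" for W t x
  proof (cases "W t x < \<infinity>")
    case True
    with that interpret comparison L \<Theta> \<phi> W t x by unfold_locales
    show ?thesis by (rule value_function_le)
  qed (simp add: not_less top_unique)
  ultimately show ?thesis by blast
qed

end
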